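(* Let $F_3$ be the frame $\langle W,R\rangle$ with $W=\{r,a,b,c\}$ and $R=\{(r,a),(r,b),(r,c)\}$ (a root with exactly three successors, which themselves have no successors). Then both the satisfiability problem with respect to $F_3$ (given an $\mathcal{L}$ formula, decide whether it is satisfiable in $F_3$) and the poor man's satisfiability problem with respect to $F_3$ (the same problem restricted to poor man's formulas) are NP-complete.
   Context: $\mathcal{L}$ formulas are built inductively as follows: for every propositional variable $p$ (from a countably infinite set), $p$ and $\overline{p}$ are formulas; if $\phi,\psi$ are formulas, so are $\phi\wedge\psi$, $\phi\vee\psi$, $\Box\phi$, $\Diamond\phi$. A model based on a frame $\langle W,R\rangle$ adds a valuation $\pi$ mapping each variable to a subset of $W$; truth is standard Kripke semantics ($\overline{p}$ true at $w$ iff $w\notin\pi(p)$; $\Box\phi$ true at $w$ iff $\phi$ true at all $R$-successors; $\Diamond\phi$ true at $w$ iff $\phi$ true at some $R$-successor). A formula is satisfiable in a frame $F$ if it is true at some world of some model based on $F$. A poor man's formula is an $\mathcal{L}$ formula not containing $\vee$. *)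

theory Defs
  imports "HOL-Computational_Algebra.Polynomial"
begin

section \<open>Modal formulas and Kripke semantics\<close>

text \<open>The countably infinite set of propositional variables is the set of binary words.\<close>

type_synonym var = "bool list"

datatype form =
    Pos var
  | Neg var
  | And form form
  | Or form form
  | Box form
  | Dia form

fun poor_man :: "form \<Rightarrow> bool" where
  "poor_man (Pos p) = True"
| "poor_man (Neg p) = True"
| "poor_man (And \<phi> \<psi>) = (poor_man \<phi> \<and> poor_man \<psi>)"
| "poor_man (Or \<phi> \<psi>) = False"
| "poor_man (Box \<phi>) = poor_man \<phi>"
| "poor_man (Dia \<phi>) = poor_man \<phi>"

record 'w frame =
  worlds :: "'w set"
  rel :: "('w \<times> 'w) set"

fun holds :: "'w frame \<Rightarrow> (var \<Rightarrow> 'w set) \<Rightarrow> 'w \<Rightarrow> form \<Rightarrow> bool" where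
  "holds F \<pi> w (Pos p) \<longleftrightarrow> w \<in> \<pi> p"
| "holds F \<pi> w (Neg p) \<longleftrightarrow> w \<notin> \<pi> p"
| "holds F \<pi> w (And \<phi> \<psi>) \<longleftrightarrow> holds F \<pi> w \<phi> \<and> holds F \<pi> w \<psi>"
| "holds F \<pi> w (Or \<phi> \<psi>) \<longleftrightarrow> holds F \<pi> w \<phi> \<or> holds F \<pi> w \<psi>"
| "holds F \<pi> w (Box \<phi>) \<longleftrightarrow> (\<forall>v. (w, v) \<in> rel F \<longrightarrow> holds F \<pi> v \<phi>)"
| "holds F \<pi> w (Dia \<phi>) \<longleftrightarrow> (\<exists>v. (w, v) \<in> rel F \<and> holds F \<pi> v \<phi>)"

definition satisfiable_in :: "'w frame \<Rightarrow> form \<Rightarrow> bool" where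
  "satisfiable_in F \<phi> \<longleftrightarrow>
     (\<exists>\<pi>. (\<forall>p. \<pi> p \<subseteq> worlds F) \<and> (\<exists>w \<in> worlds F. holds F \<pi> w \<phi>))"

datatype world = r | a | b | c

definition F3 :: "world frame" where
  "F3 = \<lparr>worlds = {r, a, b, c}, rel = {(r, a), (r, b), (r, c)}\<rparr>"

hide_const (open) r a b c

section \<open>Decision problems on formulas as languages over the binary alphabet\<close>

text \<open>Formulas are written in prefix notation: a three-bit tag, followed by the arguments.
  A variable name \<open>b\<^sub>1 \<dots> b\<^sub>n\<close> is made self-delimiting as \<open>1 b\<^sub>1 \<dots> 1 b\<^sub>n 0\<close>, so that the length of
  the code is linear in the number of symbols of the formula, names being written out in binary.\<close>

fun encode_var :: "var \<Rightarrow> bool list" where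
  "encode_var [] = [False]"
| "encode_var (x # p) = True # x # encode_var p"

fun encode :: "form \<Rightarrow> bool list" where
  "encode (Pos p) = [False, False, False] @ encode_var p"
| "encode (Neg p) = [False, False, True] @ encode_var p"
| "encode (And \<phi> \<psi>) = [False, True, False] @ encode \<phi> @ encode \<psi>"
| "encode (Or \<phi> \<psi>) = [False, True, True] @ encode \<phi> @ encode \<psi>"
| "encode (Box \<phi>) = [True, False, False] @ encode \<phi>"
| "encode (Dia \<phi>) = [True, False, True] @ encode \<phi>"

lemma encode_var_prefix_free:
  "encode_var p @ xs = encode_var q @ ys \<Longrightarrow> p = q \<and> xs = ys"
proof (induction p arbitrary: q)
  case Nil
  then show ?case by (cases q) auto
next
  case (Cons x p)
  then show ?case by (cases q) auto
qed

lemma encode_prefix_free: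
  "encode \<phi> @ xs = encode \<psi> @ ys \<Longrightarrow> \<phi> = \<psi> \<and> xs = ys"
proof (induction \<phi> arbitrary: \<psi> xs ys)
  case (Pos p)
  then show ?case by (cases \<psi>) (auto dest: encode_var_prefix_free)
next
  case (Neg p)
  then show ?case by (cases \<psi>) (auto dest: encode_var_prefix_free)
next
  case (And \<phi>1 \<phi>2)
  from And.prems obtain \<psi>1 \<psi>2 where \<psi>: "\<psi> = And \<psi>1 \<psi>2"
    and eq: "encode \<phi>1 @ encode \<phi>2 @ xs = encode \<psi>1 @ encode \<psi>2 @ ys"
    by (cases \<psi>) auto
  from And.IH(1)[OF eq] And.IH(2)[of xs \<psi>2 ys] \<psi> show ?case by simp
next
  case (Or \<phi>1 \<phi>2)
  from Or.prems obtain \<psi>1 \<psi>2 where \<psi>: "\<psi> = Or \<psi>1 \<psi>2"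
    and eq: "encode \<phi>1 @ encode \<phi>2 @ xs = encode \<psi>1 @ encode \<psi>2 @ ys"
    by (cases \<psi>) auto
  from Or.IH(1)[OF eq] Or.IH(2)[of xs \<psi>2 ys] \<psi> show ?case by simp
next
  case (Box \<phi>)
  from Box.prems obtain \<psi>' where \<psi>: "\<psi> = Box \<psi>'" and eq: "encode \<phi> @ xs = encode \<psi>' @ ys"
    by (cases \<psi>) auto
  from Box.IH[OF eq] \<psi> show ?case by simp
next
  case (Dia \<phi>)
  from Dia.prems obtain \<psi>' where \<psi>: "\<psi> = Dia \<psi>'" and eq: "encode \<phi> @ xs = encode \<psi>' @ ys"
    by (cases \<psi>) auto
  from Dia.IH[OF eq] \<psi> show ?case by simp
qed

lemma inj_encode: "inj encode"
proof (rule injI)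
  fix \<phi> \<psi>
  assume "encode \<phi> = encode \<psi>"
  then show "\<phi> = \<psi>" using encode_prefix_free[of \<phi> "[]" \<psi> "[]"] by simp
qed

definition sat_problem :: "'w frame \<Rightarrow> bool list set" where
  "sat_problem F = {encode \<phi> |\<phi>. satisfiable_in F \<phi>}"

definition poor_man_sat_problem :: "'w frame \<Rightarrow> bool list set" where
  "poor_man_sat_problem F = {encode \<phi> |\<phi>. poor_man \<phi> \<and> satisfiable_in F \<phi>}"

section \<open>Deterministic multitape Turing machines\<close>

text \<open>States and tape symbols are initial segments of the natural numbers. Symbol 0 is the blank,
  1 and 2 are the input symbols \<open>False\<close> and \<open>True\<close>. Tapes are infinite in both directions. The
  transition function maps a state and the list of scanned symbols to a new state and, for every
  tape, the symbol to write and a head movement.\<close>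

datatype move = MoveLeft | Stay | MoveRight

record tm =
  num_tapes :: nat
  num_states :: nat
  num_symbols :: nat
  start :: nat
  accept :: nat
  reject :: nat
  delta :: "nat \<Rightarrow> nat list \<Rightarrow> nat \<times> (nat \<times> move) list"

definition wf_tm :: "tm \<Rightarrow> bool" where
  "wf_tm M \<longleftrightarrow>
     num_symbols M \<ge> 3 \<and>
     start M < num_states M \<and> accept M < num_states M \<and> reject M < num_states M \<and>
     accept M \<noteq> reject M \<and>
     (\<forall>q < num_states M. \<forall>ss. length ss = num_tapes M \<and> set ss \<subseteq> {..<num_symbols M} \<longrightarrow>
        (case delta M q ss of (q', acts) \<Rightarrow>
           q' < num_states M \<and> length acts = num_tapes M \<and>
           fst ` set acts \<subseteq> {..<num_symbols M}))"

text \<open>A tape is given by its contents and the position of its head.\<close>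

type_synonym tape = "(int \<Rightarrow> nat) \<times> int"
type_synonym config = "nat \<times> tape list"

definition scanned :: "tape \<Rightarrow> nat" where
  "scanned t = fst t (snd t)"

fun act :: "nat \<times> move \<Rightarrow> tape \<Rightarrow> tape" where
  "act (s, m) (f, h) =
     (f(h := s), case m of MoveLeft \<Rightarrow> h - 1 | Stay \<Rightarrow> h | MoveRight \<Rightarrow> h + 1)"

text \<open>Halting configurations are fixed points of \<open>step\<close>, so a machine that has halted after
  \<open>t\<close> steps is in the same configuration after any larger number of steps.\<close>

fun step :: "tm \<Rightarrow> config \<Rightarrow> config" where
  "step M (q, ts) =
     (if q = accept M \<or> q = reject M then (q, ts)
      else case delta M q (map scanned ts) of (q', acts) \<Rightarrow> (q', map2 act acts ts))"

definition word_contents :: "bool list \<Rightarrow> int \<Rightarrow> nat" where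
  "word_contents w i =
     (if 0 \<le> i \<and> i < int (length w) then (if w ! nat i then 2 else 1) else 0)"

text \<open>The input words are on the first tapes, one word per tape; all further tapes are blank.\<close>

definition init :: "tm \<Rightarrow> bool list list \<Rightarrow> config" where
  "init M ws =
     (start M,
      map (\<lambda>j. (word_contents (if j < length ws then ws ! j else []), 0)) [0..<num_tapes M])"

definition run :: "tm \<Rightarrow> bool list list \<Rightarrow> nat \<Rightarrow> config" where
  "run M ws t = (step M ^^ t) (init M ws)"

section \<open>Polynomial time, NP and NP-completeness\<close>

text \<open>The machine reads its input on tape 0 and leaves its output on tape 1.\<close>

definition poly_time_computable :: "(bool list \<Rightarrow> bool list) \<Rightarrow> bool" where
  "poly_time_computable f \<longleftrightarrow>
     (\<exists>M. \<exists>T :: nat poly. wf_tm M \<and> num_tapes M \<ge> 2 \<and>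
        (\<forall>x. case run M [x] (poly T (length x)) of (q, ts) \<Rightarrow>
           q = accept M \<and> fst (ts ! 1) = word_contents (f x)))"

text \<open>A binary relation on words is decided with the two words on tapes 0 and 1.\<close>

definition poly_time_decidable2 :: "(bool list \<Rightarrow> bool list \<Rightarrow> bool) \<Rightarrow> bool" where
  "poly_time_decidable2 V \<longleftrightarrow>
     (\<exists>M. \<exists>T :: nat poly. wf_tm M \<and> num_tapes M \<ge> 2 \<and>
        (\<forall>x y. fst (run M [x, y] (poly T (length x + length y))) =
           (if V x y then accept M else reject M)))"

definition NP :: "bool list set set" where
  "NP = {L. \<exists>V. \<exists>p :: nat poly. poly_time_decidable2 V \<and>
          (\<forall>x. x \<in> L \<longleftrightarrow> (\<exists>y. length y \<le> poly p (length x) \<and> V x y))}"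

definition poly_reducible :: "bool list set \<Rightarrow> bool list set \<Rightarrow> bool" where
  "poly_reducible K L \<longleftrightarrow> (\<exists>f. poly_time_computable f \<and> (\<forall>x. x \<in> K \<longleftrightarrow> f x \<in> L))"

definition NP_hard :: "bool list set \<Rightarrow> bool" where
  "NP_hard L \<longleftrightarrow> (\<forall>K \<in> NP. poly_reducible K L)"

definition NP_complete :: "bool list set \<Rightarrow> bool" where
  "NP_complete L \<longleftrightarrow> L \<in> NP \<and> NP_hard L"

end

theory Submission
  imports Defs "HOL-Library.Countable"
begin

text \<open>Membership in NP: a certificate lists pairs of a variable and a world at which it holds. A stack
  machine reads the formula in prefix notation once, from left to right, and evaluates each subformula
  to the set of worlds where it holds.

  Hardness: a computation of a polynomial-time verifier becomes a CNF whose variables describe the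
  tapes relative to their heads, so that the tapes move and not the heads. The CNF becomes a poor man's
  formula by way of 3-colouring: the three leaves of the frame are colours, a conjunct \<open>\<Diamond>\<psi>\<close> with
  \<open>\<psi>\<close> a conjunction of literals is a vertex, which has to choose a colour, and complementary literals
  are edges. One reduction serves both problems. It is computed by a machine that keeps its counters in
  unary and prints the clauses in nested loops; variable names are written in unary for this reason.\<close>

section \<open>A stack language compiled to Turing machines\<close>

text \<open>Without disjunction the only choice left in a formula is the successor that a diamond
  picks; with exactly three successors this is the choice of a colour. A variable may hold at
  several leaves and is not a colour itself: the diamond is the vertex, its positive literal names
  it, its negative literals are edges to other vertices. Avoiding the whole truth set of a neighbour
  also avoids its chosen leaf, so an edge need only be stated at one end.

  Since the verifier is deterministic, all clauses but the guess of the certificate are Horn: they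
  derive the facts of the run and forbid the wrong final states. No clause says that a cell has only
  one symbol. With positions relative to the heads the scanned cell is always cell 0, so no variable
  has to record a head position.

  The obstacle is that time is measured on actual Turing machines. Hence the stacks, which are tapes
  with the head on the top symbol, and a step bound inside the execution relation, so that
  correctness and running time come from one induction. Auxiliary variables are named after the
  literals they depend on, so that printing needs no supply of fresh names.\<close>

text \<open>\<open>Put\<close> is the second half of \<open>Push\<close> on the machine level and does not occur in programs.\<close>

datatype 'a cmd =
    Push nat "(nat \<Rightarrow> 'a option) \<Rightarrow> 'a"
  | Put nat 'a
  | Pop nat
  | Emit 'a
  | Seq "'a cmd" "'a cmd" (infixr ";;" 60)
  | Ite "(nat \<Rightarrow> 'a option) \<Rightarrow> bool" "'a cmd" "'a cmd"
  | While "(nat \<Rightarrow> 'a option) \<Rightarrow> bool" "'a cmd"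

type_synonym 'a store = "nat \<Rightarrow> 'a list"

definition tops :: "'a store \<Rightarrow> nat \<Rightarrow> 'a option" where
  "tops \<sigma> j = (case \<sigma> j of [] \<Rightarrow> None | x # _ \<Rightarrow> Some x)"

text \<open>The number is an upper bound for the number of steps of the compiled machine.\<close>

inductive exec :: "'a cmd \<Rightarrow> 'a store \<Rightarrow> 'a list \<Rightarrow> nat \<Rightarrow> 'a store \<Rightarrow> 'a list \<Rightarrow> bool" where
  exec_push: "\<lbrakk>\<sigma>' = \<sigma>(j := g (tops \<sigma>) # \<sigma> j); 2 \<le> N\<rbrakk> \<Longrightarrow> exec (Push j g) \<sigma> out N \<sigma>' out"
| exec_pop: "\<lbrakk>\<sigma>' = \<sigma>(j := tl (\<sigma> j)); 1 \<le> N\<rbrakk> \<Longrightarrow> exec (Pop j) \<sigma> out N \<sigma>' out"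
| exec_emit: "\<lbrakk>out' = out @ [x]; 1 \<le> N\<rbrakk> \<Longrightarrow> exec (Emit x) \<sigma> out N \<sigma> out'"
| exec_seq: "\<lbrakk>exec c \<sigma> out m \<sigma>' out'; exec d \<sigma>' out' n \<sigma>'' out''; m + n + 1 \<le> N\<rbrakk>
    \<Longrightarrow> exec (c ;; d) \<sigma> out N \<sigma>'' out''"
| exec_ite: "\<lbrakk>b (tops \<sigma>) \<Longrightarrow> exec c \<sigma> out m \<sigma>' out'; \<not> b (tops \<sigma>) \<Longrightarrow> exec d \<sigma> out m \<sigma>' out'; m + 1 \<le> N\<rbrakk>
    \<Longrightarrow> exec (Ite b c d) \<sigma> out N \<sigma>' out'"
| exec_while_end: "\<lbrakk>\<not> b (tops \<sigma>); 1 \<le> N\<rbrakk> \<Longrightarrow> exec (While b c) \<sigma> out N \<sigma> out"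
| exec_while: "\<lbrakk>b (tops \<sigma>); exec c \<sigma> out m \<sigma>' out'; exec (While b c) \<sigma>' out' n \<sigma>'' out''; m + n + 1 \<le> N\<rbrakk>
    \<Longrightarrow> exec (While b c) \<sigma> out N \<sigma>'' out''"

lemma exec_mono: "exec c \<sigma> out m \<sigma>' out' \<Longrightarrow> m \<le> n \<Longrightarrow> exec c \<sigma> out n \<sigma>' out'"
proof (induction arbitrary: n rule: exec.induct)
  case (exec_seq c \<sigma> out m \<sigma>' out' d m' \<sigma>'' out'' N)
  then show ?case by (intro exec.exec_seq[of c \<sigma> out m \<sigma>' out' d m']) auto
next
  case (exec_ite b \<sigma> c out m \<sigma>' out' d N)
  then show ?case by (intro exec.exec_ite[of b \<sigma> c out m]) auto
next
  case (exec_while b \<sigma> c out m \<sigma>' out' m' \<sigma>'' out'' N)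
  then show ?case by (intro exec.exec_while[of b \<sigma> c out m \<sigma>' out' m']) auto
qed (auto intro: exec.intros)

text \<open>\<open>Put\<close> overwrites the scanned cell; this is a push only directly after the
  left move, when that cell is still blank. Hence it is banned from programs.\<close>

fun uses_tapes :: "nat \<Rightarrow> bool \<Rightarrow> 'a cmd \<Rightarrow> bool" where
  "uses_tapes k om (Push j g) = (j < k \<and> \<not> (om \<and> j = 1))"
| "uses_tapes k om (Put j x) = False"
| "uses_tapes k om (Pop j) = (j < k \<and> \<not> (om \<and> j = 1))"
| "uses_tapes k om (Emit x) = om"
| "uses_tapes k om (c ;; d) = (uses_tapes k om c \<and> uses_tapes k om d)"
| "uses_tapes k om (Ite b c d) = (uses_tapes k om c \<and> uses_tapes k om d)"
| "uses_tapes k om (While b c) = uses_tapes k om c"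

text \<open>The control states of the compiled machine are the continuations, i.e. the lists of commands
  that remain to be executed.\<close>

fun next_cont :: "'a cmd list \<Rightarrow> (nat \<Rightarrow> 'a option) \<Rightarrow> 'a cmd list" where
  "next_cont (Push j g # K) t = Put j (g t) # K"
| "next_cont ((c ;; d) # K) t = c # d # K"
| "next_cont (Ite b c d # K) t = (if b t then c else d) # K"
| "next_cont (While b c # K) t = (if b t then c # While b c # K else K)"
| "next_cont (_ # K) t = K"
| "next_cont [] t = []"

text \<open>A loop reappears in its own continuation instead of being unrolled, and the symbol
  pending in a \<open>Put\<close> comes from a finite alphabet; so a program has finitely many
  control states.\<close>

fun conts :: "'a cmd \<Rightarrow> 'a cmd list \<Rightarrow> 'a cmd list set" where
  "conts (Push j g) K = insert (Push j g # K) (range (\<lambda>x. Put j x # K))"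
| "conts (c ;; d) K = insert ((c ;; d) # K) (conts c (d # K) \<union> conts d K)"
| "conts (Ite b c d) K = insert (Ite b c d # K) (conts c K \<union> conts d K)"
| "conts (While b c) K = insert (While b c # K) (conts c (While b c # K))"
| "conts c K = {c # K}"

lemma finite_conts: "finite (conts (c :: 'a::finite cmd) K)"
  by (induction c K rule: conts.induct) auto

lemma Cons_in_conts: "c # K \<in> conts c K"
  by (cases c) auto

text \<open>Control leaves the states of \<open>c\<close> only through \<open>K\<close>, which
  closes the state set under transitions.\<close>

lemma next_cont_in_conts: "X \<in> conts c K \<Longrightarrow> next_cont X t \<in> insert K (conts c K)"
proof (induction c K rule: conts.induct)
  case (2 c d K)
  then show ?case using Cons_in_conts[of c "d # K"] Cons_in_conts[of d K] by auto
next
  case (3 b c d K)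
  then show ?case using Cons_in_conts[of c K] Cons_in_conts[of d K] by auto
next
  case (4 b c K)
  then show ?case using Cons_in_conts[of c "While b c # K"] by (auto split: if_splits)
qed auto

section \<open>The compiled machine and its simulation of programs\<close>

locale compiler =
  fixes k :: nat and om :: bool and prog :: "'a::finite cmd" and good :: "(nat \<Rightarrow> 'a option) \<Rightarrow> bool"
    and cod :: "'a \<Rightarrow> nat" and bt :: "bool \<Rightarrow> 'a" and enc :: "'a cmd list \<Rightarrow> nat"
  assumes two_tapes: "2 \<le> k" and uses: "uses_tapes k om prog"
    and cod_inj: "inj cod" and cod_range: "range cod = {1..card (UNIV :: 'a set)}"
    and cod_bit: "cod (bt False) = 1" "cod (bt True) = 2"
    and enc_bij: "bij_betw enc (insert [] (conts prog [])) {2..<2 + card (insert [] (conts prog []))}"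
begin

definition Q :: "'a cmd list set" where "Q = insert [] (conts prog [])"

definition decode_sym :: "nat \<Rightarrow> 'a option" where
  "decode_sym s = (if s = 0 then None else Some (inv cod s))"

fun head_act :: "'a cmd list \<Rightarrow> nat \<Rightarrow> nat \<Rightarrow> nat \<times> move" where
  "head_act (Push i g # K) j s = (s, if j = i then MoveLeft else Stay)"
| "head_act (Put i x # K) j s = (if j = i then cod x else s, Stay)"
| "head_act (Pop i # K) j s = (if j = i then (0, MoveRight) else (s, Stay))"
| "head_act (Emit x # K) j s = (if j = 1 then (cod x, MoveRight) else (s, Stay))"
| "head_act _ j s = (s, Stay)"

definition read_syms :: "nat list \<Rightarrow> nat \<Rightarrow> 'a option" where
  "read_syms ss j = (if j < k then decode_sym (ss ! j) else None)"

text \<open>States 0 and 1 are acceptance and rejection, which is why \<open>enc\<close> starts at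
  2, just as symbol 0 is the blank and \<open>cod\<close> starts at 1.\<close>

definition machine :: tm where
  "machine = \<lparr>num_tapes = k, num_states = 2 + card Q, num_symbols = card (UNIV :: 'a set) + 1,
     start = enc [prog], accept = 0, reject = 1,
     delta = (\<lambda>q ss. if q < 2 then (q, map (\<lambda>s. (s, Stay)) ss)
       else let K = inv_into Q enc q in
         (if K = [] then (if good (read_syms ss) then 0 else 1) else enc (next_cont K (read_syms ss)),
          map (\<lambda>j. head_act K j (ss ! j)) [0..<k]))\<rparr>"

lemma bij_Q: "bij_betw enc Q {2..<2 + card Q}"
  using enc_bij by (simp add: Q_def)

lemma enc_bound: "K \<in> Q \<Longrightarrow> 2 \<le> enc K \<and> enc K < 2 + card Q"
  using bij_betw_apply[OF bij_Q, of K] by auto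

lemma dec_enc: "K \<in> Q \<Longrightarrow> inv_into Q enc (enc K) = K"
  using bij_betw_inv_into_left[OF bij_Q] by simp

lemma next_cont_Q: "K \<in> Q \<Longrightarrow> next_cont K t \<in> Q"
  using next_cont_in_conts[of K prog "[]" t] by (auto simp: Q_def)

lemma prog_in_Q: "[prog] \<in> Q"
  by (simp add: Q_def Cons_in_conts)

lemma cod_less: "cod x < card (UNIV :: 'a set) + 1" and cod_pos: "0 < cod x"
  using cod_range by (metis Suc_eq_plus1 atLeastAtMost_iff le_imp_less_Suc rangeI, 
     metis atLeastAtMost_iff rangeI One_nat_def Suc_le_eq)

lemma head_act_sym: "s < card (UNIV :: 'a set) + 1 \<Longrightarrow> fst (head_act K j s) < card (UNIV :: 'a set) + 1"
  using cod_less by (induction K j s rule: head_act.induct) auto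

lemma wf_machine: "wf_tm machine"
proof -
  have "card (UNIV :: 'a set) \<ge> 2"
    using cod_bit cod_less[of "bt True"] by simp
  moreover have "inv_into Q enc q \<in> Q" if "2 \<le> q" "q < 2 + card Q" for q
    using that bij_Q by (auto simp: bij_betw_def intro!: inv_into_into)
  ultimately show ?thesis
    using enc_bound[OF prog_in_Q] enc_bound next_cont_Q head_act_sym
    unfolding wf_tm_def machine_def
    by (auto simp: Let_def image_subset_iff subset_iff)
qed

text \<open>The stack extends to the right of the head and everything else is blank. So an input
  word with the head on cell 0 is already a stack with its first letter on top, and a pop has to
  leave a blank behind.\<close>

definition stack_tape :: "'a list \<Rightarrow> int \<Rightarrow> tape" where
  "stack_tape xs h = (\<lambda>i. if h \<le> i \<and> i < h + int (length xs) then cod (xs ! nat (i - h)) else 0, h)"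

definition out_tape :: "'a list \<Rightarrow> tape" where
  "out_tape xs =
     (\<lambda>i. if 0 \<le> i \<and> i < int (length xs) then cod (xs ! nat i) else 0, int (length xs))"

lemma scanned_stack: "scanned (stack_tape xs h) = (case xs of [] \<Rightarrow> 0 | x # _ \<Rightarrow> cod x)"
  by (cases xs) (auto simp: stack_tape_def scanned_def)

lemma scanned_out: "scanned (out_tape xs) = 0"
  by (simp add: out_tape_def scanned_def)

lemma act_id: "act (scanned t, Stay) t = t"
  by (cases t) (simp add: scanned_def)

lemma act_pop: "act (0, MoveRight) (stack_tape xs h) = stack_tape (tl xs) (h + 1)"
proof (cases xs)
  case (Cons x ys)
  have "nat (i - h) = Suc (nat (i - (h + 1)))" if "h < i" for i using that by simp
  then show ?thesis using Cons by (auto simp: stack_tape_def fun_eq_iff)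
qed (auto simp: stack_tape_def)

text \<open>A machine writes before it moves, so a push takes two steps: the first writes the old
  top back and moves left, the second fills the blank cell found there.\<close>

lemma act_push:
  "act (cod x, Stay) (act (scanned (stack_tape xs h), MoveLeft) (stack_tape xs h))
     = stack_tape (x # xs) (h - 1)"
proof -
  have "nat (i - (h - 1)) = Suc (nat (i - h))" if "h \<le> i" for i using that by simp
  then show ?thesis by (auto simp: stack_tape_def fun_eq_iff scanned_def)
qed

lemma act_emit: "act (cod x, MoveRight) (out_tape xs) = out_tape (xs @ [x])"
  by (auto simp: out_tape_def fun_eq_iff nth_append)

text \<open>In output mode (\<open>om\<close>) the head of tape 1 stays to the right of the output and reads a blank, so
  that stack 1 appears to be empty.\<close>

definition rep :: "'a store \<Rightarrow> 'a list \<Rightarrow> tape list \<Rightarrow> bool" where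
  "rep \<sigma> out ts \<longleftrightarrow> length ts = k \<and> (\<forall>j \<ge> k. \<sigma> j = []) \<and>
     (\<forall>j < k. if om \<and> j = 1 then \<sigma> j = [] \<and> ts ! j = out_tape out
       else \<exists>h. ts ! j = stack_tape (\<sigma> j) h)"

lemma read_rep:
  assumes "rep \<sigma> out ts"
  shows "read_syms (map scanned ts) = tops \<sigma>"
proof
  fix j
  show "read_syms (map scanned ts) j = tops \<sigma> j"
  proof (cases "j < k")
    case True
    then have "scanned (ts ! j) = (case \<sigma> j of [] \<Rightarrow> 0 | x # _ \<Rightarrow> cod x)"
      using assms by (auto simp: rep_def scanned_stack scanned_out split: if_splits)
    then show ?thesis
      using True assms cod_pos cod_inj
      by (auto simp: read_syms_def decode_sym_def tops_def rep_def split: list.splits) 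
  qed (use assms in \<open>auto simp: read_syms_def tops_def rep_def\<close>)
qed

lemma step_cont:
  assumes "K \<in> Q" "K \<noteq> []" "length ts = k"
  shows "step machine (enc K, ts) = (enc (next_cont K (read_syms (map scanned ts))),
     map (\<lambda>j. act (head_act K j (scanned (ts ! j))) (ts ! j)) [0..<k])"
  using enc_bound[OF assms(1)] dec_enc[OF assms(1)] assms(2,3)
  by (auto simp: machine_def Let_def intro!: nth_equalityI)

lemma step_idle:
  assumes "K \<in> Q" "K \<noteq> []" "length ts = k" "\<And>j s. head_act K j s = (s, Stay)"
  shows "step machine (enc K, ts) = (enc (next_cont K (read_syms (map scanned ts))), ts)"
  using step_cont[OF assms(1-3)] assms(3,4) by (auto simp: act_id intro!: nth_equalityI)

text \<open>The continuation \<open>K\<close> is arbitrary because a subcommand runs in front of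
  whatever is left to do. The inclusion in \<open>Q\<close> keeps all visited continuations where
  \<open>enc\<close> can be inverted.\<close>

lemma exec_simulation:
  assumes "exec c \<sigma> out N \<sigma>' out'" "uses_tapes k om c" "insert K (conts c K) \<subseteq> Q" "rep \<sigma> out ts"
  shows "\<exists>n \<le> N. \<exists>ts'. (step machine ^^ n) (enc (c # K), ts) = (enc K, ts') \<and> rep \<sigma>' out' ts'"
  using assms
proof (induction arbitrary: K ts rule: exec.induct)
  case (exec_push \<sigma>' \<sigma> j g N out)
  let ?c = "Push j g"
  have hQ: "Push j g # K \<in> Q" using exec_push.prems(2) Cons_in_conts[of "Push j g" K] by blast
  have len: "length ts = k" using exec_push by (simp add: rep_def)
  define ts1 where "ts1 = map (\<lambda>i. act (head_act (?c # K) i (scanned (ts ! i))) (ts ! i)) [0..<k]"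
  define ts2 where "ts2 = map (\<lambda>i. act (head_act (Put j (g (tops \<sigma>)) # K) i (scanned (ts1 ! i))) (ts1 ! i)) [0..<k]"
  have 1: "step machine (enc (?c # K), ts) = (enc (Put j (g (tops \<sigma>)) # K), ts1)"
    using step_cont[OF hQ _ len] read_rep[OF exec_push.prems(3)] by (simp add: ts1_def)
  have PQ: "Put j (g (tops \<sigma>)) # K \<in> Q" using next_cont_Q[OF hQ] by simp
  have 2: "step machine (enc (Put j (g (tops \<sigma>)) # K), ts1) = (enc K, ts2)"
  proof -
    have "length ts1 = k" by (simp add: ts1_def)
    then show ?thesis using step_cont[OF PQ, of ts1] unfolding ts2_def by simp
  qed
  have "(step machine ^^ 2) (enc (?c # K), ts) = (enc K, ts2)"
    using 1 2 by (simp add: numeral_2_eq_2)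
  moreover have "rep \<sigma>' out ts2"
    unfolding rep_def
  proof (intro conjI allI impI)
    fix i assume i: "i < k"
    obtain h where h: "ts ! j = stack_tape (\<sigma> j) h"
      using exec_push.prems by (auto simp: rep_def split: if_splits)
    have "ts2 ! i = (if i = j then stack_tape (g (tops \<sigma>) # \<sigma> j) (h - 1) else ts ! i)"
      using i by (auto simp: ts2_def ts1_def act_id act_push h)
    then show "if om \<and> i = 1 then \<sigma>' i = [] \<and> ts2 ! i = out_tape out
       else \<exists>h. ts2 ! i = stack_tape (\<sigma>' i) h"
      using i exec_push by (auto simp: rep_def)
  qed (use exec_push in \<open>auto simp: ts2_def rep_def\<close>)
  ultimately show ?case using exec_push.hyps by blast
next
  case (exec_pop \<sigma>' \<sigma> j N out)
  let ?c = "Pop j"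
  have hQ: "Pop j # K \<in> Q" using exec_pop.prems(2) Cons_in_conts[of "Pop j" K] by blast
  have len: "length ts = k" using exec_pop by (simp add: rep_def)
  define ts1 where "ts1 = map (\<lambda>i. act (head_act (?c # K) i (scanned (ts ! i))) (ts ! i)) [0..<k]"
  have "(step machine ^^ 1) (enc (?c # K), ts) = (enc K, ts1)"
    using step_cont[OF hQ _ len] by (simp add: ts1_def)
  moreover have "rep \<sigma>' out ts1"
    unfolding rep_def
  proof (intro conjI allI impI)
    fix i assume i: "i < k"
    obtain h where h: "ts ! j = stack_tape (\<sigma> j) h"
      using exec_pop.prems by (auto simp: rep_def split: if_splits)
    have "ts1 ! i = (if i = j then stack_tape (tl (\<sigma> j)) (h + 1) else ts ! i)"
      using i by (auto simp: ts1_def act_id act_pop h)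
    then show "if om \<and> i = 1 then \<sigma>' i = [] \<and> ts1 ! i = out_tape out
       else \<exists>h. ts1 ! i = stack_tape (\<sigma>' i) h"
      using i exec_pop by (auto simp: rep_def)
  qed (use exec_pop in \<open>auto simp: ts1_def rep_def\<close>)
  ultimately show ?case using exec_pop.hyps by blast
next
  case (exec_emit out' out x N \<sigma>)
  let ?c = "Emit x"
  have hQ: "Emit x # K \<in> Q" using exec_emit.prems(2) Cons_in_conts[of "Emit x" K] by blast
  have len: "length ts = k" using exec_emit.prems(3) unfolding rep_def by blast
  define ts1 where "ts1 = map (\<lambda>i. act (head_act (?c # K) i (scanned (ts ! i))) (ts ! i)) [0..<k]"
  have "(step machine ^^ 1) (enc (?c # K), ts) = (enc K, ts1)"
    using step_cont[OF hQ _ len] by (simp add: ts1_def)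
  moreover have "rep \<sigma> out' ts1"
    using exec_emit.prems(1,3) exec_emit.hyps two_tapes unfolding rep_def ts1_def
    by (auto simp: act_id act_emit)
  ultimately show ?case using exec_emit.hyps by blast
next
  case (exec_seq c \<sigma> out m \<sigma>' out' d n \<sigma>'' out'' N)
  have hQ: "(c ;; d) # K \<in> Q" using exec_seq.prems(2) Cons_in_conts[of "(c ;; d)" K] by blast
  have len: "length ts = k" using exec_seq by (simp add: rep_def)
  have 1: "step machine (enc ((c ;; d) # K), ts) = (enc (c # d # K), ts)"
    using step_idle[OF hQ _ len] by simp
  have dQ: "insert K (conts d K) \<subseteq> Q" using exec_seq.prems(2) by auto
  have cQ: "insert (d # K) (conts c (d # K)) \<subseteq> Q" using exec_seq.prems(2) Cons_in_conts[of d K] by auto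
  obtain n1 ts1 where 2: "n1 \<le> m" "(step machine ^^ n1) (enc (c # d # K), ts) = (enc (d # K), ts1)" "rep \<sigma>' out' ts1"
    using exec_seq.IH(1)[OF _ cQ exec_seq.prems(3)] exec_seq.prems(1) unfolding uses_tapes.simps by blast
  obtain n2 ts2 where 3: "n2 \<le> n" "(step machine ^^ n2) (enc (d # K), ts1) = (enc K, ts2)" "rep \<sigma>'' out'' ts2"
    using exec_seq.IH(2)[OF _ dQ 2(3)] exec_seq.prems(1) unfolding uses_tapes.simps by blast
  have "(step machine ^^ (n2 + (n1 + 1))) (enc ((c ;; d) # K), ts) = (enc K, ts2)"
    using 1 2 3 by (simp only: funpow_add o_apply) simp
  then show ?case using 2 3 exec_seq.hyps by (intro exI[of _ "n2 + (n1 + 1)"]) auto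
next
  case (exec_ite b \<sigma> c out m \<sigma>' out' d N)
  have hQ: "Ite b c d # K \<in> Q" using exec_ite.prems(2) Cons_in_conts[of "Ite b c d" K] by blast
  have len: "length ts = k" using exec_ite by (simp add: rep_def)
  let ?e = "if b (tops \<sigma>) then c else d"
  have 1: "step machine (enc (Ite b c d # K), ts) = (enc (?e # K), ts)"
    using step_idle[OF hQ _ len] read_rep[OF exec_ite.prems(3)] by simp
  have cQ: "insert K (conts ?e K) \<subseteq> Q" using exec_ite.prems(2) by auto
  obtain n1 ts1 where 2: "n1 \<le> m" "(step machine ^^ n1) (enc (?e # K), ts) = (enc K, ts1)" "rep \<sigma>' out' ts1"
    using exec_ite.IH(1)[OF _ _ _ exec_ite.prems(3), of K] exec_ite.IH(2)[OF _ _ _ exec_ite.prems(3), of K] exec_ite.prems cQ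
    by (cases "b (tops \<sigma>)") auto
  have "(step machine ^^ (n1 + 1)) (enc (Ite b c d # K), ts) = (enc K, ts1)"
    using 1 2 by (simp only: funpow_add o_apply) simp
  then show ?case using 2 exec_ite.hyps by (intro exI[of _ "n1 + 1"]) auto
next
  case (exec_while_end b \<sigma> N c out)
  have hQ: "While b c # K \<in> Q" using exec_while_end.prems(2) Cons_in_conts[of "While b c" K] by blast
  have len: "length ts = k" using exec_while_end by (simp add: rep_def)
  have "(step machine ^^ 1) (enc (While b c # K), ts) = (enc K, ts)"
    using step_idle[OF hQ _ len] read_rep[OF exec_while_end.prems(3)] exec_while_end.hyps by simp
  then show ?case using exec_while_end by blast
next
  case (exec_while b \<sigma> c out m \<sigma>' out' n \<sigma>'' out'' N)
  have hQ: "While b c # K \<in> Q" using exec_while.prems(2) Cons_in_conts[of "While b c" K] by blast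
  have len: "length ts = k" using exec_while by (simp add: rep_def)
  have 1: "step machine (enc (While b c # K), ts) = (enc (c # While b c # K), ts)"
    using step_idle[OF hQ _ len] read_rep[OF exec_while.prems(3)] exec_while.hyps by simp
  have cQ: "insert (While b c # K) (conts c (While b c # K)) \<subseteq> Q" using exec_while.prems(2) by auto
  obtain n1 ts1 where 2: "n1 \<le> m" "(step machine ^^ n1) (enc (c # While b c # K), ts) = (enc (While b c # K), ts1)" "rep \<sigma>' out' ts1"
    using exec_while.IH(1)[OF _ cQ exec_while.prems(3)] exec_while.prems(1) unfolding uses_tapes.simps by blast
  obtain n2 ts2 where 3: "n2 \<le> n" "(step machine ^^ n2) (enc (While b c # K), ts1) = (enc K, ts2)" "rep \<sigma>'' out'' ts2"
    using exec_while.IH(2)[OF exec_while.prems(1,2) 2(3)] by blast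
  have "(step machine ^^ (n2 + (n1 + 1))) (enc (While b c # K), ts) = (enc K, ts2)"
    using 1 2 3 by (simp only: funpow_add o_apply) simp
  then show ?case using 2 3 exec_while.hyps by (intro exI[of _ "n2 + (n1 + 1)"]) auto
qed

text \<open>The additional step leads from the empty continuation to acceptance or rejection. That
  configuration is a fixed point, so a bound on the number of steps is as good as the exact
  number.\<close>

lemma run_machine:
  assumes "exec prog \<sigma> [] N \<sigma>' out'" "rep \<sigma> [] (snd (init machine ws))"
  shows "\<exists>ts. run machine ws (N + 1) = (if good (tops \<sigma>') then 0 else 1, ts) \<and> rep \<sigma>' out' ts"
proof -
  define ts0 where "ts0 = snd (init machine ws)"
  have init: "init machine ws = (enc [prog], ts0)"
    by (simp add: ts0_def init_def machine_def)
  obtain n ts where n: "n \<le> N" "(step machine ^^ n) (enc [prog], ts0) = (enc [], ts)" "rep \<sigma>' out' ts"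
    using exec_simulation[OF assms(1) uses, of "[]" ts0] assms(2) by (auto simp: Q_def ts0_def)
  define q :: nat where "q = (if good (tops \<sigma>') then 0 else 1)"
  have QQ: "[] \<in> Q" by (simp add: Q_def)
  have len: "length ts = k" using n(3) unfolding rep_def by blast
  then have "step machine (enc [], ts) = (q, ts)"
    using enc_bound[OF QQ] dec_enc[OF QQ] read_rep[OF n(3)]
    by (auto simp: machine_def Let_def q_def act_id intro!: nth_equalityI)
  then have 1: "(step machine ^^ (n + 1)) (enc [prog], ts0) = (q, ts)"
    using n(2) by simp
  have fix_q: "(step machine ^^ m) (q, ts) = (q, ts)" for m
    by (induction m) (auto simp: machine_def q_def)
  have "(step machine ^^ ((N - n) + (n + 1))) (enc [prog], ts0) = (q, ts)"
    using funpow_add[of "N - n" "n + 1" "step machine"] 1 fix_q by (metis o_apply)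
  then show ?thesis using n by (auto simp: run_def init q_def)
qed

end

section \<open>From programs to polynomial-time predicates\<close>

lemma ex_coding:
  fixes bt :: "bool \<Rightarrow> 'a::finite"
  assumes "inj bt"
  shows "\<exists>cod :: 'a \<Rightarrow> nat. inj cod \<and> range cod = {1..card (UNIV :: 'a set)} \<and>
    cod (bt False) = 1 \<and> cod (bt True) = 2"
proof -
  let ?A = "UNIV - {bt False, bt True}" and ?B = "{3..card (UNIV :: 'a set)}"
  have ne: "bt False \<noteq> bt True" using assms by (auto dest: injD)
  then have two: "card {bt False, bt True} = 2" by simp
  then have "2 \<le> card (UNIV :: 'a set)" using card_mono[of UNIV "{bt False, bt True}"] by simp
  moreover have "card ?A = card ?B" using two by (simp add: card_Diff_subset)
  then obtain h where h: "bij_betw h ?A ?B" using finite_same_card_bij[of ?A ?B] by auto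
  \<comment> \<open>The input convention forces the codes 1 and 2 on the bits; the remaining symbols
    take any bijection onto the codes from 3 on.\<close>
  define cod where "cod x = (if x = bt False then 1 else if x = bt True then 2 else h x)" for x
  have "bij_betw cod ?A ?B" using h by (rule bij_betw_cong[THEN iffD1, rotated]) (auto simp: cod_def)
  moreover have "bij_betw cod {bt False, bt True} {1, 2}"
    using ne by (auto simp: cod_def bij_betw_def)
  ultimately have "bij_betw cod (?A \<union> {bt False, bt True}) (?B \<union> {1, 2})"
    by (intro bij_betw_combine) auto
  moreover have "?A \<union> {bt False, bt True} = UNIV" by auto
  moreover have "?B \<union> {1, 2} = {1..card (UNIV :: 'a set)}" using \<open>2 \<le> card (UNIV :: 'a set)\<close> by auto
  ultimately have "bij_betw cod UNIV {1..card (UNIV :: 'a set)}" by simp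
  then show ?thesis using ne by (intro exI[of _ cod]) (auto simp: bij_betw_def cod_def)
qed

lemma ex_compiler:
  fixes prog :: "'a::finite cmd"
  assumes "inj bt" "2 \<le> k" "uses_tapes k om prog"
  obtains cod enc where "compiler k om prog cod bt enc"
proof -
  obtain cod :: "'a \<Rightarrow> nat" where cod: "inj cod" "range cod = {1..card (UNIV :: 'a set)}"
      "cod (bt False) = 1" "cod (bt True) = 2"
    using ex_coding[OF assms(1)] by blast
  let ?Q = "insert [] (conts prog [])"
  obtain enc where "bij_betw enc ?Q {2..<2 + card ?Q}"
    using finite_same_card_bij[of ?Q "{2..<2 + card ?Q}"] finite_conts[of prog "[]"] by auto
  with cod assms show ?thesis by (intro that[of cod enc]) unfold_locales
qed

text \<open>With \<open>bool\<close> as the whole alphabet the symbols on tape 1 are exactly those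
  of \<open>word_contents\<close>, so the output needs no translation.\<close>

lemma poly_time_computableI:
  fixes prog :: "bool cmd"
  assumes "2 \<le> k" "uses_tapes k True prog"
    and run: "\<And>x. \<exists>\<sigma>'. exec prog ((\<lambda>_. [])(0 := x)) [] (poly T (length x)) \<sigma>' (f x)"
  shows "poly_time_computable f"
proof -
  have "inj (\<lambda>b :: bool. b)" by simp
  then obtain cod enc where "compiler k True prog cod (\<lambda>b. b) enc"
    by (rule ex_compiler[OF _ assms(1,2)])
  then interpret compiler k True prog "\<lambda>_. True" cod "\<lambda>b. b" enc .
  have cod_eq: "cod b = (if b then 2 else 1)" for b using cod_bit by (cases b) auto
  have "case run machine [x] (poly (T + 1) (length x)) of (q, ts) \<Rightarrow>
      q = accept machine \<and> fst (ts ! 1) = word_contents (f x)" for x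
  proof -
    obtain \<sigma>' where b: "exec prog ((\<lambda>_. [])(0 := x)) [] (poly T (length x)) \<sigma>' (f x)"
      using run by blast
    have "rep ((\<lambda>_. [])(0 := x)) [] (snd (init machine [x]))"
      using two_tapes unfolding rep_def
      by (auto simp: init_def machine_def out_tape_def stack_tape_def word_contents_def fun_eq_iff cod_eq
        intro!: exI[of _ 0])
    from run_machine[OF b this] obtain ts where
      "run machine [x] (poly T (length x) + 1) = (0, ts)" "rep \<sigma>' (f x) ts" by auto
    moreover from this have "ts ! 1 = out_tape (f x)" using two_tapes unfolding rep_def by auto
    ultimately show ?thesis
      by (auto simp: machine_def out_tape_def word_contents_def fun_eq_iff cod_eq)
  qed
  moreover have "num_tapes machine \<ge> 2" using two_tapes by (simp add: machine_def)
  ultimately show ?thesis unfolding poly_time_computable_def using wf_machine by blast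
qed

text \<open>Here tape 1 is an ordinary stack that holds the second word, and the alphabet may have
  more symbols than the bits.\<close>

lemma poly_time_decidable2I:
  fixes prog :: "'a::finite cmd"
  assumes "inj bt" "2 \<le> k" "uses_tapes k False prog"
    and run: "\<And>x y. \<exists>\<sigma>'. exec prog ((\<lambda>_. [])(0 := map bt x, 1 := map bt y)) []
      (poly T (length x + length y)) \<sigma>' [] \<and> good (tops \<sigma>') = V x y"
  shows "poly_time_decidable2 V"
proof -
  obtain cod enc where "compiler k False prog cod bt enc"
    by (rule ex_compiler[OF assms(1-3)])
  then interpret compiler k False prog good cod bt enc .
  have cod_eq: "cod (bt b) = (if b then 2 else 1)" for b using cod_bit by (cases b) auto
  have "fst (run machine [x, y] (poly (T + 1) (length x + length y))) =
      (if V x y then accept machine else reject machine)" for x y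
  proof -
    let ?\<sigma> = "(\<lambda>_. [])(0 := map bt x, 1 := map bt y)"
    obtain \<sigma>' where b: "exec prog ?\<sigma> [] (poly T (length x + length y)) \<sigma>' []"
      and g: "good (tops \<sigma>') = V x y"
      using run by blast
    have "rep ?\<sigma> [] (snd (init machine [x, y]))"
      using two_tapes unfolding rep_def
      by (auto simp: init_def machine_def stack_tape_def word_contents_def fun_eq_iff cod_eq nth_Cons'
        intro!: exI[of _ 0])
    from run_machine[OF b this] g show ?thesis
      by (auto simp: machine_def)
  qed
  moreover have "num_tapes machine \<ge> 2" using two_tapes by (simp add: machine_def)
  ultimately show ?thesis unfolding poly_time_decidable2_def using wf_machine by blast
qed

section \<open>From clauses to poor man's formulas\<close>

text \<open>The leaf where \<open>[0]\<close> holds is the neutral colour, of the other two the one where \<open>[1]\<close> holds is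
  true. A clause is a chain of OR gadgets of the usual reduction from satisfiability to 3-colouring,
  one for every prefix; the names of the two inner vertices (4 and 5) and of the output (6) of a gadget
  contain the prefix. If both inputs of a gadget hold at the false leaf, so does its output.\<close>

abbreviation (input) num :: "nat \<Rightarrow> nat" where "num \<equiv> \<lambda>n. n"

text \<open>The type of the numbers in a name is a parameter, as the blocks are needed both for concrete
  numbers and for the symbolic ones of the templates below; \<open>cst\<close> embeds the constants.\<close>

type_synonym 'n lit = "bool \<times> 'n list"

text \<open>The length in front of each name makes the concatenation uniquely decodable, see
  \<open>inj_flat\<close>.\<close>

definition flat :: "(nat \<Rightarrow> 'n) \<Rightarrow> 'n lit list \<Rightarrow> 'n list" where
  "flat cst ls = concat (map (\<lambda>(s, v). cst (if s then 1 else 0) # cst (length v) # v) ls)"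

fun lit_name :: "(nat \<Rightarrow> 'n) \<Rightarrow> 'n lit \<Rightarrow> 'n list" where
  "lit_name cst (s, v) = cst (if s then 2 else 3) # v"

text \<open>A prefix of one literal has no gadget: its output is the vertex of the literal.\<close>

fun or_name :: "(nat \<Rightarrow> 'n) \<Rightarrow> 'n lit list \<Rightarrow> 'n list" where
  "or_name cst [l] = lit_name cst l"
| "or_name cst ls = cst 6 # flat cst ls"

definition gadget :: "(nat \<Rightarrow> 'n) \<Rightarrow> 'n lit list \<Rightarrow> 'n lit \<Rightarrow> 'n lit list list" where
  "gadget cst pre l = (let A = cst 4 # flat cst (pre @ [l]); B = cst 5 # flat cst (pre @ [l]) in
     [[(True, A), (False, or_name cst pre)],
      [(True, B), (False, lit_name cst l), (False, A)],
      [(True, or_name cst (pre @ [l])), (False, A), (False, B)]])"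

fun chain :: "(nat \<Rightarrow> 'n) \<Rightarrow> 'n lit list \<Rightarrow> 'n lit list \<Rightarrow> 'n lit list list" where
  "chain cst pre [] = []"
| "chain cst pre (l # ls) = gadget cst pre l @ chain cst (pre @ [l]) ls"

text \<open>A variable, its complement and the neutral vertex form a triangle.\<close>

definition declare_var :: "(nat \<Rightarrow> 'n) \<Rightarrow> 'n list \<Rightarrow> 'n lit list list" where
  "declare_var cst v = [[(True, cst 2 # v), (False, [cst 0])],
     [(True, cst 3 # v), (False, cst 2 # v), (False, [cst 0])]]"

definition block :: "(nat \<Rightarrow> 'n) \<Rightarrow> 'n lit list \<Rightarrow> 'n lit list list" where
  "block cst C = concat (map (\<lambda>l. declare_var cst (snd l)) C) @ chain cst [hd C] (tl C) @
     [[(False, [cst 0]), (False, [cst 1]), (False, or_name cst C)]]"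

text \<open>Together with the diamond that closes \<open>dias_form\<close> and puts
  \<open>[0]\<close> somewhere, these two force three different leaves.\<close>

definition palette :: "nat lit list list" where
  "palette = [[(False, [0]), (True, [1])], [(False, [0]), (False, [1])]]"

fun name_word :: "nat list \<Rightarrow> var" where
  "name_word [] = []"
| "name_word (m # ms) = replicate m True @ False # name_word ms"

lemma replicate_True_False_eq:
  "replicate m True @ False # xs = replicate n True @ False # ys \<Longrightarrow> m = n \<and> xs = ys"
proof (induction m arbitrary: n)
  case 0
  then show ?case by (cases n) auto
next
  case (Suc m)
  then show ?case by (cases n) auto
qed

lemma inj_name_word: "inj name_word"
proof (rule injI)
  fix xs ys
  assume "name_word xs = name_word ys"
  then show "xs = ys"
  proof (induction xs arbitrary: ys)
    case Nil
    then show ?case by (cases ys) auto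
  next
    case (Cons x xs)
    then show ?case by (cases ys) (auto dest!: replicate_True_False_eq)
  qed
qed

fun lit_form :: "nat lit \<Rightarrow> form" where
  "lit_form (s, v) = (if s then Pos (name_word v) else Neg (name_word v))"

lemma holds_lit_form: "holds F \<pi> w (lit_form l) \<longleftrightarrow> (w \<in> \<pi> (name_word (snd l))) = fst l"
  by (cases l) auto

lemma poor_man_lit_form: "poor_man (lit_form l)"
  by (cases l) auto

fun conj_form :: "nat lit list \<Rightarrow> form" where
  "conj_form [l] = lit_form l"
| "conj_form (l # ls) = And (lit_form l) (conj_form ls)"
| "conj_form [] = undefined"

fun dias_form :: "nat lit list list \<Rightarrow> form" where
  "dias_form [] = Dia (Pos (name_word [0]))"
| "dias_form (P # Ps) = And (Dia (conj_form P)) (dias_form Ps)"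

definition cnf_form :: "nat lit list list \<Rightarrow> form" where
  "cnf_form Cs = dias_form (palette @ concat (map (block num) Cs))"

definition cnf_sat :: "nat lit list list \<Rightarrow> bool" where
  "cnf_sat Cs \<longleftrightarrow> (\<exists>\<alpha>. \<forall>C \<in> set Cs. \<exists>(s, v) \<in> set C. \<alpha> v = s)"

definition somewhere :: "(nat list \<Rightarrow> world set) \<Rightarrow> nat lit list \<Rightarrow> bool" where
  "somewhere \<rho> P \<longleftrightarrow> (\<exists>w \<in> {world.a, world.b, world.c}. \<forall>(s, v) \<in> set P. (w \<in> \<rho> v) = s)"

lemma somewhereE:
  assumes "somewhere \<rho> P"
  obtains w where "w \<in> {world.a, world.b, world.c}" "\<forall>l \<in> set P. (w \<in> \<rho> (snd l)) = fst l"
  using assms unfolding somewhere_def split_beta by blast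

lemma poor_man_conj_form: "P \<noteq> [] \<Longrightarrow> poor_man (conj_form P)"
  by (induction P rule: conj_form.induct) (simp_all add: poor_man_lit_form del: lit_form.simps)

lemma holds_conj_form:
  "P \<noteq> [] \<Longrightarrow> holds F \<pi> w (conj_form P) \<longleftrightarrow> (\<forall>(s, v) \<in> set P. (w \<in> \<pi> (name_word v)) = s)"
  by (induction P rule: conj_form.induct) (simp_all add: holds_lit_form split_beta del: lit_form.simps)

lemma poor_man_dias_form: "[] \<notin> set Ps \<Longrightarrow> poor_man (dias_form Ps)"
  by (induction Ps) (auto simp: poor_man_conj_form)

lemma rel_F3: "(w, v) \<in> rel F3 \<longleftrightarrow> w = world.r \<and> v \<in> {world.a, world.b, world.c}"
  by (auto simp: F3_def)

lemma leaf_iff: "w \<in> {world.a, world.b, world.c} \<longleftrightarrow> w \<noteq> world.r"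
  by (cases w) auto

lemma worlds_F3: "worlds F3 = UNIV"
proof -
  have "w \<in> worlds F3" for w by (cases w) (auto simp: F3_def)
  then show ?thesis by blast
qed

text \<open>Only the root has successors, and the conjunction always contains a diamond, so it holds
  nowhere else. The inserted conjunct is the closing diamond.\<close>

lemma holds_dias_form:
  "[] \<notin> set Ps \<Longrightarrow> holds F3 \<pi> w (dias_form Ps) \<longleftrightarrow>
     w = world.r \<and> (\<forall>P \<in> insert [(True, [0])] (set Ps). somewhere (\<pi> \<circ> name_word) P)"
proof (induction Ps)
  case Nil
  show ?case by (simp add: somewhere_def rel_F3) blast
next
  case (Cons P Ps)
  then have P: "P \<noteq> []" and "[] \<notin> set Ps" by auto
  have "holds F3 \<pi> w (Dia (conj_form P)) \<longleftrightarrow> w = world.r \<and> somewhere (\<pi> \<circ> name_word) P"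
    unfolding holds.simps rel_F3 holds_conj_form[OF P] somewhere_def o_apply by blast
  then show ?case
    unfolding dias_form.simps holds.simps(3) Cons.IH[OF \<open>[] \<notin> set Ps\<close>] list.set ball_simps by blast
qed

lemma satisfiable_dias_form:
  assumes "[] \<notin> set Ps"
  shows "satisfiable_in F3 (dias_form Ps) \<longleftrightarrow>
     (\<exists>\<rho>. \<forall>P \<in> insert [(True, [0])] (set Ps). somewhere \<rho> P)"
proof
  assume "\<exists>\<rho>. \<forall>P \<in> insert [(True, [0])] (set Ps). somewhere \<rho> P"
  then obtain \<rho> where \<rho>: "\<forall>P \<in> insert [(True, [0])] (set Ps). somewhere \<rho> P" ..
  \<comment> \<open>Distinct names are distinct variables, so every choice of truth sets for the
    names extends to a valuation.\<close>
  have "(\<rho> \<circ> inv name_word) \<circ> name_word = \<rho>"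
    using inj_name_word by (simp add: o_assoc[symmetric])
  then have "holds F3 (\<rho> \<circ> inv name_word) world.r (dias_form Ps)"
    unfolding holds_dias_form[OF assms] using \<rho> by simp
  then show "satisfiable_in F3 (dias_form Ps)"
    unfolding satisfiable_in_def worlds_F3 by blast
next
  assume "satisfiable_in F3 (dias_form Ps)"
  then obtain \<pi> w where "holds F3 \<pi> w (dias_form Ps)"
    unfolding satisfiable_in_def by blast
  then show "\<exists>\<rho>. \<forall>P \<in> insert [(True, [0])] (set Ps). somewhere \<rho> P"
    unfolding holds_dias_form[OF assms] by (intro exI[of _ "\<pi> \<circ> name_word"]) (rule conjunct2)
qed

lemma nonempty_block: "[] \<notin> set (block cst C)"
proof -
  have "[] \<notin> set (chain cst pre ls)" for pre ls
    by (induction ls arbitrary: pre) (auto simp: gadget_def Let_def)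
  then show ?thesis by (auto simp: block_def declare_var_def)
qed

lemma nonempty_cnf: "[] \<notin> set (palette @ concat (map (block num) Cs))"
  using nonempty_block by (auto simp: palette_def)

lemma poor_man_cnf_form: "poor_man (cnf_form Cs)"
  unfolding cnf_form_def by (rule poor_man_dias_form[OF nonempty_cnf])

lemma satisfiable_cnf_form:
  "satisfiable_in F3 (cnf_form Cs) \<longleftrightarrow> (\<exists>\<rho>. \<forall>P \<in> insert [(True, [0])] (set (palette @ concat (map (block num) Cs))).
     somewhere \<rho> P)"
  unfolding cnf_form_def by (rule satisfiable_dias_form[OF nonempty_cnf])

section \<open>From a model to a satisfying assignment\<close>

lemma cnf_sat_if_satisfiable:
  assumes "\<And>C. C \<in> set Cs \<Longrightarrow> C \<noteq> []" and "satisfiable_in F3 (cnf_form Cs)"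
  shows "cnf_sat Cs"
proof -
  have "\<exists>\<rho>. \<forall>P \<in> insert [(True, [0])] (set (palette @ concat (map (block num) Cs))). somewhere \<rho> P"
    using assms(2) unfolding satisfiable_cnf_form .
  then obtain \<rho> where all: "\<forall>P \<in> insert [(True, [0])] (set (palette @ concat (map (block num) Cs))). somewhere \<rho> P"
    by (rule exE)
  have \<rho>: "somewhere \<rho> P" if "P \<in> insert [(True, [0])] (set (palette @ concat (map (block num) Cs)))" for P
    using all that by (rule bspec)
  let ?W = "{world.a, world.b, world.c}"
  have pal: "somewhere \<rho> [(True, [0])]" "somewhere \<rho> [(False, [0]), (True, [1])]" "somewhere \<rho> [(False, [0]), (False, [1])]"
    by (rule \<rho>, simp add: palette_def)+
  obtain N where N: "N \<in> ?W" "N \<in> \<rho> [0]" by (rule somewhereE[OF pal(1)]) simp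
  obtain T where T: "T \<in> ?W" "T \<notin> \<rho> [0]" "T \<in> \<rho> [1]" by (rule somewhereE[OF pal(2)]) simp
  obtain F where F: "F \<in> ?W" "F \<notin> \<rho> [0]" "F \<notin> \<rho> [1]" by (rule somewhereE[OF pal(3)]) simp
  note W = N(1) T(1) F(1) and NTF = N(2) T(2,3) F(2,3)
  \<comment> \<open>Being pairwise different, the three witnesses exhaust the leaves; from here on
    they stand for the colours neutral, true and false.\<close>
  have "N \<noteq> T" "N \<noteq> F" "T \<noteq> F" using NTF by auto
  then have "card {N, T, F} = 3" by simp
  then have "{N, T, F} = ?W" using W by (intro card_subset_eq) auto
  then have some: thesis if "somewhere \<rho> P"
      "\<And>w. w \<in> {N, T, F} \<Longrightarrow> \<forall>l \<in> set P. (w \<in> \<rho> (snd l)) = fst l \<Longrightarrow> thesis" for P thesis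
    using that by (elim somewhereE) metis
  define \<alpha> where "\<alpha> v \<longleftrightarrow> T \<in> \<rho> (2 # v)" for v
  have "\<exists>(s, v) \<in> set C. \<alpha> v = s" if C: "C \<in> set Cs" for C
  proof (rule ccontr)
    assume false: "\<not> (\<exists>(s, v) \<in> set C. \<alpha> v = s)"
    have \<rho>C: "somewhere \<rho> P" if "P \<in> set (block num C)" for P using \<rho> C that by auto
    obtain l ls where lls: "C = l # ls" using assms(1)[OF C] by (cases C) auto
    \<comment> \<open>The diamond that declares the literal needs a leaf other than
      \<open>N\<close>. It cannot be \<open>T\<close>: there the literal fails, or the vertex of
      \<open>v\<close>, which it must avoid, holds.\<close>
    have off: "F \<in> \<rho> (lit_name num (s, v))" if sv: "(s, v) \<in> set C" for s v
    proof -
      have "set (declare_var num v) \<subseteq> set (block num C)"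
        using sv by (force simp: block_def)
      then have "somewhere \<rho> [(True, 2 # v), (False, [0])]"
          "somewhere \<rho> [(True, 3 # v), (False, 2 # v), (False, [0])]"
        using \<rho>C by (auto simp: declare_var_def)
      then obtain w1 w2 where "w1 \<in> {N, T, F}" "w1 \<in> \<rho> (2 # v)" "w1 \<notin> \<rho> [0]"
          "w2 \<in> {N, T, F}" "w2 \<in> \<rho> (3 # v)" "w2 \<notin> \<rho> (2 # v)" "w2 \<notin> \<rho> [0]"
        by (elim some) simp
      moreover have "\<alpha> v \<noteq> s" using sv false by auto
      ultimately show ?thesis using NTF by (cases s) (auto simp: \<alpha>_def)
    qed
    \<comment> \<open>When both inputs hold at \<open>F\<close>, the witnesses of \<open>A\<close>
      and \<open>B\<close> are two different leaves other than \<open>F\<close>. The output avoids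
      both of them, and only \<open>F\<close> remains.\<close>
    have step: "F \<in> \<rho> (or_name num (pre @ [l]))"
      if g: "set (gadget num pre l) \<subseteq> set (block num C)"
        and "F \<in> \<rho> (or_name num pre)" "F \<in> \<rho> (lit_name num l)" for pre l
    proof -
      let ?A = "4 # flat num (pre @ [l])" and ?B = "5 # flat num (pre @ [l])"
      have "somewhere \<rho> P" if "P \<in> set (gadget num pre l)" for P using g \<rho>C that by auto
      then have "somewhere \<rho> [(True, ?A), (False, or_name num pre)]"
          "somewhere \<rho> [(True, ?B), (False, lit_name num l), (False, ?A)]"
          "somewhere \<rho> [(True, or_name num (pre @ [l])), (False, ?A), (False, ?B)]"
        by (simp_all add: gadget_def Let_def)
      then obtain wa wb wo where "wa \<in> {N, T, F}" "wa \<in> \<rho> (?A)" "wa \<notin> \<rho> (or_name num pre)"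
          "wb \<in> {N, T, F}" "wb \<in> \<rho> (?B)" "wb \<notin> \<rho> (lit_name num l)" "wb \<notin> \<rho> (?A)"
          "wo \<in> {N, T, F}" "wo \<in> \<rho> (or_name num (pre @ [l]))" "wo \<notin> \<rho> (?A)" "wo \<notin> \<rho> (?B)"
        by (elim some) simp
      moreover have "wa \<noteq> F" "wb \<noteq> F" "wa \<noteq> wb" "wo \<noteq> wa" "wo \<noteq> wb" using calculation that(2,3) by metis+
      ultimately show ?thesis by blast
    qed
    have "F \<in> \<rho> (or_name num (pre @ ls'))"
      if "set (chain num pre ls') \<subseteq> set (block num C)" "F \<in> \<rho> (or_name num pre)" "set ls' \<subseteq> set C" for pre ls'
      using that
    proof (induction ls' arbitrary: pre)
      case (Cons l' ls')
      have "F \<in> \<rho> (or_name num (pre @ [l']))"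
        using step[of pre l'] Cons.prems off by (cases l') auto
      then show ?case using Cons.IH[of "pre @ [l']"] Cons.prems by simp
    qed simp
    from this[of "[l]" ls] have "F \<in> \<rho> (or_name num C)"
      using off by (cases l) (auto simp: lls block_def)
    \<comment> \<open>\<open>F\<close> is the only leaf outside the truth sets of \<open>[0]\<close>
      and \<open>[1]\<close>, so this diamond says that the clause does not come out false.\<close>
    moreover have "somewhere \<rho> [(False, [0]), (False, [1]), (False, or_name num C)]"
      using \<rho>C by (simp add: block_def)
    ultimately show False using NTF by (elim some) auto
  qed
  then show ?thesis unfolding cnf_sat_def by blast
qed

section \<open>From a satisfying assignment to a colouring\<close>

lemma inj_flat: "inj (flat num)"
proof (rule injI)
  fix xs ys :: "nat lit list"
  assume "flat num xs = flat num ys"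
  then show "xs = ys"
  proof (induction xs arbitrary: ys)
    case Nil
    then show ?case by (cases ys) (auto simp: flat_def)
  next
    case (Cons x xs)
    obtain s v where x: "x = (s, v)" by fastforce
    with Cons.prems obtain y ys' where ys: "ys = y # ys'" by (cases ys) (auto simp: flat_def)
    obtain s' v' where y: "y = (s', v')" by fastforce
    note xy = x y
    have "v = v' \<and> flat num xs = flat num ys' \<and> s = s'"
      using Cons.prems unfolding ys xy by (auto simp: flat_def split: if_splits)
    then show ?case using Cons.IH ys xy by simp
  qed
qed

definition sat_lit :: "(nat list \<Rightarrow> bool) \<Rightarrow> nat lit \<Rightarrow> bool" where
  "sat_lit \<alpha> l \<longleftrightarrow> \<alpha> (snd l) = fst l"

text \<open>The worlds \<open>a\<close>, \<open>b\<close> and \<open>c\<close> are the colours neutral, true and false.\<close>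

definition truth_colour :: "bool \<Rightarrow> world" where
  "truth_colour x = (if x then world.b else world.c)"

text \<open>The colour is computed from the name, so a name has to determine its prefix. Clauses
  with a common prefix share vertices, which is harmless because the colour depends on nothing else
  in the clause. The values for the tags 4 and 5 complete the triangle of a gadget: a true prefix
  makes \<open>A\<close> false and \<open>B\<close> neutral; after a false prefix a true literal
  makes \<open>A\<close> neutral and \<open>B\<close> false, and a false one makes \<open>A\<close>
  true and \<open>B\<close> neutral. The colour left over is the value of the disjunction.\<close>

definition colour :: "(nat list \<Rightarrow> bool) \<Rightarrow> nat list \<Rightarrow> world" where
  "colour \<alpha> v = (let k = hd v; u = tl v; ls = inv (flat num) u;
       pre = list_ex (sat_lit \<alpha>) (butlast ls); l = sat_lit \<alpha> (last ls) in
     if k = 0 then world.a else if k = 1 then world.b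
     else if k = 2 then truth_colour (\<alpha> u) else if k = 3 then truth_colour (\<not> \<alpha> u)
     else if k = 4 then (if pre then world.c else if l then world.a else world.b)
     else if k = 5 then (if pre then world.a else if l then world.c else world.a)
     else truth_colour (list_ex (sat_lit \<alpha>) ls))"

lemma colour_lit: "colour \<alpha> (lit_name num l) = truth_colour (sat_lit \<alpha> l)"
  by (cases l) (auto simp: colour_def sat_lit_def)

lemma colour_or: "ls \<noteq> [] \<Longrightarrow> colour \<alpha> (or_name num ls) = truth_colour (list_ex (sat_lit \<alpha>) ls)"
  using inj_flat by (cases "(num, ls)" rule: or_name.cases) (auto simp: colour_lit, auto simp: colour_def)

text \<open>With singleton truth sets a diamond turns into inequalities between colours, its witness
  being the colour of the vertex.\<close>

lemma somewhere_colour: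
  assumes "w \<noteq> world.r" "\<forall>l \<in> set P. (w = colour \<alpha> (snd l)) = fst l"
  shows "somewhere (\<lambda>v. {colour \<alpha> v}) P"
  unfolding somewhere_def
proof (rule bexI[of _ w])
  show "\<forall>(s, v) \<in> set P. (w \<in> {colour \<alpha> v}) = s" using assms(2) by (simp add: split_beta)
  show "w \<in> {world.a, world.b, world.c}" using assms(1) unfolding leaf_iff .
qed

lemma satisfiable_if_cnf_sat:
  assumes "\<And>C. C \<in> set Cs \<Longrightarrow> C \<noteq> []" and "cnf_sat Cs"
  shows "satisfiable_in F3 (cnf_form Cs)"
proof -
  obtain \<alpha> where sat: "\<forall>C \<in> set Cs. \<exists>(s, v) \<in> set C. \<alpha> v = s"
    using assms(2) unfolding cnf_sat_def by (rule exE)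
  have \<alpha>: "list_ex (sat_lit \<alpha>) C" if "C \<in> set Cs" for C
    using bspec[OF sat that] by (simp add: list_ex_iff sat_lit_def split_beta)
  let ?\<rho> = "\<lambda>v. {colour \<alpha> v}"
  have pal: "colour \<alpha> [0] = world.a" "colour \<alpha> [Suc 0] = world.b" by (auto simp: colour_def)
  have decl: "somewhere ?\<rho> P" if P: "P \<in> set (declare_var num v)" for P v
  proof -
    have v: "colour \<alpha> (2 # v) = truth_colour (\<alpha> v)" "colour \<alpha> (3 # v) = truth_colour (\<not> \<alpha> v)"
      by (auto simp: colour_def)
    from P consider "P = [(True, 2 # v), (False, [0])]" | "P = [(True, 3 # v), (False, 2 # v), (False, [0])]"
      by (auto simp: declare_var_def)
    then show ?thesis
    proof cases
      case 1
      then show ?thesis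
        by (intro somewhere_colour[of "truth_colour (\<alpha> v)"]) (auto simp: v pal truth_colour_def)
    next
      case 2
      then show ?thesis
        by (intro somewhere_colour[of "truth_colour (\<not> \<alpha> v)"]) (auto simp: v pal truth_colour_def)
    qed
  qed
  have gad: "somewhere ?\<rho> P" if P: "P \<in> set (gadget num pre l)" and "pre \<noteq> []" for P pre l
  proof -
    let ?A = "4 # flat num (pre @ [l])" and ?B = "5 # flat num (pre @ [l])"
    let ?p = "list_ex (sat_lit \<alpha>) pre" and ?l = "sat_lit \<alpha> l"
    let ?a = "if ?p then world.c else if ?l then world.a else world.b"
    let ?b = "if ?p then world.a else if ?l then world.c else world.a"
    have "inv (flat num) (flat num (pre @ [l])) = pre @ [l]" using inj_flat by simp
    then have AB: "colour \<alpha> ?A = ?a" "colour \<alpha> ?B = ?b"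
      by (simp_all add: colour_def Let_def)
    have pre: "colour \<alpha> (or_name num pre) = truth_colour ?p"
        "colour \<alpha> (or_name num (pre @ [l])) = truth_colour (?p \<or> ?l)"
      using colour_or[OF \<open>pre \<noteq> []\<close>] colour_or[of "pre @ [l]"] by simp_all
    note simps = AB pre colour_lit[of \<alpha> l] truth_colour_def
    from P consider "P = [(True, ?A), (False, or_name num pre)]"
      | "P = [(True, ?B), (False, lit_name num l), (False, ?A)]"
      | "P = [(True, or_name num (pre @ [l])), (False, ?A), (False, ?B)]"
      unfolding gadget_def Let_def by auto
    then show ?thesis
    proof cases
      case 1
      then show ?thesis by (intro somewhere_colour[of ?a]; cases ?p; cases ?l; simp add: simps)
    next
      case 2
      then show ?thesis by (intro somewhere_colour[of ?b]; cases ?p; cases ?l; simp add: simps)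
    next
      case 3
      then show ?thesis by (intro somewhere_colour[of "truth_colour (?p \<or> ?l)"]; cases ?p; cases ?l; simp add: simps)
    qed
  qed
  have ch: "somewhere ?\<rho> P" if "P \<in> set (chain num pre ls)" "pre \<noteq> []" for P pre ls
    using that
  proof (induction ls arbitrary: pre)
    case (Cons l ls)
    then show ?case using gad[of P pre l] Cons.IH[of "pre @ [l]"] by auto
  qed simp
  have bl: "somewhere ?\<rho> P" if P: "P \<in> set (block num C)" and C: "C \<in> set Cs" for P C
  proof -
    from P consider "P \<in> set (chain num [hd C] (tl C))" | l where "P \<in> set (declare_var num (snd l))"
      | "P = [(False, [0]), (False, [1]), (False, or_name num C)]"
      unfolding block_def by auto
    then show ?thesis
    proof cases
      case 3
      have "colour \<alpha> (or_name num C) = world.b"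
        using colour_or[OF assms(1)[OF C]] \<alpha>[OF C] by (simp add: truth_colour_def)
      then show ?thesis using 3 by (intro somewhere_colour[of world.c]) (auto simp: pal)
    qed (use ch decl in blast)+
  qed
  have pals: "somewhere ?\<rho> [(True, [0])]" "somewhere ?\<rho> [(False, [0]), (True, [1])]"
      "somewhere ?\<rho> [(False, [0]), (False, [1])]"
    by (rule somewhere_colour[of world.a], simp_all add: pal)
      (rule somewhere_colour[of world.b], simp_all add: pal,
       rule somewhere_colour[of world.c], simp_all add: pal)
  have "\<forall>P \<in> insert [(True, [0])] (set (palette @ concat (map (block num) Cs))). somewhere ?\<rho> P"
  proof (rule ballI)
    fix P
    assume "P \<in> insert [(True, [0])] (set (palette @ concat (map (block num) Cs)))"
    then consider "P = [(True, [0])]" | "P = [(False, [0]), (True, [1])]" | "P = [(False, [0]), (False, [1])]"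
      | C where "C \<in> set Cs" "P \<in> set (block num C)"
      unfolding palette_def by auto
    then show "somewhere ?\<rho> P" using pals bl by cases simp_all
  qed
  then show ?thesis unfolding satisfiable_cnf_form by (rule exI[of _ ?\<rho>])
qed

section \<open>The tableau of a computation\<close>

text \<open>State, instruction (state and scanned symbols), and symbol in a cell to the left or right of the
  head of a tape.\<close>

datatype tag = TQ nat | TA nat "nat list" | TL nat nat | TR nat nat

instance tag :: countable
  by countable_datatype

text \<open>A constant plus a sum of counters.\<close>

type_synonym nexp = "nat \<times> nat list"
type_synonym tlit = "bool \<times> tag \<times> nexp \<times> nexp"

definition nexp_val :: "(nat \<Rightarrow> nat) \<Rightarrow> nexp \<Rightarrow> nat" where
  "nexp_val \<rho> e = fst e + sum_list (map \<rho> (snd e))"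

definition inst_lit :: "(nat \<Rightarrow> nat) \<Rightarrow> tlit \<Rightarrow> nat lit" where
  "inst_lit \<rho> = (\<lambda>(s, g, te, ie). (s, [to_nat g, nexp_val \<rho> te, nexp_val \<rho> ie]))"

fun tlit_sat :: "(tag \<Rightarrow> nat \<Rightarrow> nat \<Rightarrow> bool) \<Rightarrow> (nat \<Rightarrow> nat) \<Rightarrow> tlit \<Rightarrow> bool" where
  "tlit_sat \<beta> \<rho> (True, g, te, ie) = \<beta> g (nexp_val \<rho> te) (nexp_val \<rho> ie)"
| "tlit_sat \<beta> \<rho> (False, g, te, ie) = (\<not> \<beta> g (nexp_val \<rho> te) (nexp_val \<rho> ie))"

definition clause_sat :: "(tag \<Rightarrow> nat \<Rightarrow> nat \<Rightarrow> bool) \<Rightarrow> (nat \<Rightarrow> nat) \<Rightarrow> tlit list \<Rightarrow> bool" where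
  "clause_sat \<beta> \<rho> C \<longleftrightarrow> list_ex (tlit_sat \<beta> \<rho>) C"

definition implication :: "(tag \<times> nexp \<times> nexp) list \<Rightarrow> (tag \<times> nexp \<times> nexp) \<Rightarrow> tlit list" where
  "implication Ps c = map (Pair False) Ps @ [(True, c)]"

lemma clause_sat_implication:
  "clause_sat \<beta> \<rho> (implication Ps c) \<longleftrightarrow>
     ((\<forall>(g, te, ie) \<in> set Ps. \<beta> g (nexp_val \<rho> te) (nexp_val \<rho> ie)) \<longrightarrow> tlit_sat \<beta> \<rho> (True, c))"
  by (auto simp: clause_sat_def implication_def list_ex_iff split: prod.splits) fastforce+

text \<open>The scanned cell is cell 0 to the right.\<close>

definition right_cell :: "tape \<Rightarrow> nat \<Rightarrow> nat" where
  "right_cell \<tau> i = fst \<tau> (snd \<tau> + int i)"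

definition left_cell :: "tape \<Rightarrow> nat \<Rightarrow> nat" where
  "left_cell \<tau> i = fst \<tau> (snd \<tau> - 1 - int i)"

lemma cells_act_Stay:
  "right_cell (act (w, Stay) \<tau>) 0 = w"
  "right_cell (act (w, Stay) \<tau>) (Suc i) = right_cell \<tau> (Suc i)"
  "left_cell (act (w, Stay) \<tau>) i = left_cell \<tau> i"
  by (cases \<tau>; simp add: right_cell_def left_cell_def)+

lemma cells_act_MoveRight:
  "right_cell (act (w, MoveRight) \<tau>) i = right_cell \<tau> (Suc i)"
  "left_cell (act (w, MoveRight) \<tau>) 0 = w"
  "left_cell (act (w, MoveRight) \<tau>) (Suc i) = left_cell \<tau> i"
  by (cases \<tau>; simp add: right_cell_def left_cell_def algebra_simps)+

lemma cells_act_MoveLeft: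
  "right_cell (act (w, MoveLeft) \<tau>) 0 = left_cell \<tau> 0"
  "right_cell (act (w, MoveLeft) \<tau>) (Suc 0) = w"
  "right_cell (act (w, MoveLeft) \<tau>) (Suc (Suc i)) = right_cell \<tau> (Suc i)"
  "left_cell (act (w, MoveLeft) \<tau>) i = left_cell \<tau> (Suc i)"
  by (cases \<tau>; simp add: right_cell_def left_cell_def algebra_simps)+

lemma scanned_right_cell: "scanned \<tau> = right_cell \<tau> 0"
  by (simp add: scanned_def right_cell_def)

text \<open>Counters 2, 3 and 5 contain the length of the input and the bounds for the certificate and the
  time; counters 6 and 7 contain the current time and cell.\<close>

abbreviation "zer \<equiv> (0 :: nat, [] :: nat list)"
abbreviation "one \<equiv> (1 :: nat, [] :: nat list)"
abbreviation "now \<equiv> (0 :: nat, [6 :: nat])"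
abbreviation "soon \<equiv> (1 :: nat, [6 :: nat])"
abbreviation "here c \<equiv> (c :: nat, [7 :: nat])"

text \<open>Printed while the input is being consumed. Counter 2 then holds the number of bits read
  so far, which is the position of the current bit, and becomes the input length only at the
  end.\<close>

definition input_clause :: "bool \<Rightarrow> tlit list" where
  "input_clause b = [(True, TR 0 (if b then 2 else 1), zer, (0, [2]))]"

text \<open>The nondeterminism, and the only clause with several positive literals. The implication
  makes a blank final, so that the guessed cells spell a word without gaps.\<close>

definition guess_clauses :: "tlit list list" where
  "guess_clauses = [[(True, TR 1 0, zer, here 0), (True, TR 1 1, zer, here 0), (True, TR 1 2, zer, here 0)],
     implication [(TR 1 0, zer, here 0)] (TR 1 0, zer, here 1)]"

text \<open>The blanks of tapes 0 and 1 start behind the input and the certificate bound, hence the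
  sums of two counters.\<close>

definition blank_clauses :: "nat \<Rightarrow> tlit list list" where
  "blank_clauses k = map (\<lambda>j. [(True, TL j 0, zer, here 0)]) [0..<k] @
     [[(True, TR 0 0, zer, (0, [2, 7]))], [(True, TR 1 0, zer, (0, [3, 7]))]] @
     map (\<lambda>j. [(True, TR j 0, zer, here 0)]) [2..<k]"

definition start_clause :: "tm \<Rightarrow> tlit list" where
  "start_clause M = [(True, TQ (start M), zer, zer)]"

definition accept_clauses :: "tm \<Rightarrow> tlit list list" where
  "accept_clauses M =
     map (\<lambda>q. [(False, TQ q, (0, [5]), zer)]) (filter (\<lambda>q. q \<noteq> accept M) [0..<num_states M])"

text \<open>Halting configurations repeat themselves, as in \<open>step\<close>; therefore
  acceptance can be demanded at the single time \<open>b\<close>.\<close>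

definition next_actions :: "tm \<Rightarrow> nat \<Rightarrow> nat list \<Rightarrow> nat \<times> (nat \<times> move) list" where
  "next_actions M q ss = (if q = accept M \<or> q = reject M then (q, map (\<lambda>s. (s, Stay)) ss) else delta M q ss)"

definition control :: "tm \<Rightarrow> (nat \<times> nat list) list" where
  "control M = List.product [0..<num_states M] (List.n_lists (num_tapes M) [0..<num_symbols M])"

text \<open>These rules supply the cells that a shift of the tape does not. After a left move the
  scanned symbol is whatever stood to the left, so that case needs one clause per symbol.\<close>

definition head_rules :: "tm \<Rightarrow> nat \<Rightarrow> nat list \<Rightarrow> nat \<Rightarrow> tlit list list" where
  "head_rules M q ss j = (let (w, m) = snd (next_actions M q ss) ! j; A = (TA q ss, now, zer) in case m of
     Stay \<Rightarrow> [implication [A] (TR j w, soon, zer)]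
   | MoveRight \<Rightarrow> [implication [A] (TL j w, soon, zer)]
   | MoveLeft \<Rightarrow> implication [A] (TR j w, soon, one) #
       map (\<lambda>s. implication [A, (TL j s, now, zer)] (TR j s, soon, zer)) [0..<num_symbols M])"

text \<open>\<open>TA\<close> condenses the state and all scanned symbols into one variable, so that
  the cell rules get by with two premises for any number of tapes.\<close>

definition control_rules :: "tm \<Rightarrow> nat \<Rightarrow> nat list \<Rightarrow> tlit list list" where
  "control_rules M q ss =
     implication ((TQ q, now, zer) # map (\<lambda>j. (TR j (ss ! j), now, zer)) [0..<num_tapes M]) (TA q ss, now, zer) #
     implication [(TA q ss, now, zer)] (TQ (fst (next_actions M q ss)), soon, zer) #
     concat (map (head_rules M q ss) [0..<num_tapes M])"

text \<open>A move of the head shifts the contents the other way: distances on one side grow by one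
  and on the other side shrink by one.\<close>

definition cell_rules :: "tm \<Rightarrow> nat \<Rightarrow> nat list \<Rightarrow> nat \<Rightarrow> nat \<Rightarrow> tlit list list" where
  "cell_rules M q ss j s = (let A = (TA q ss, now, zer) in case snd (snd (next_actions M q ss) ! j) of
     Stay \<Rightarrow> [implication [A, (TR j s, now, here 1)] (TR j s, soon, here 1),
       implication [A, (TL j s, now, here 0)] (TL j s, soon, here 0)]
   | MoveRight \<Rightarrow> [implication [A, (TR j s, now, here 1)] (TR j s, soon, here 0),
       implication [A, (TL j s, now, here 0)] (TL j s, soon, here 1)]
   | MoveLeft \<Rightarrow> [implication [A, (TR j s, now, here 1)] (TR j s, soon, here 2),
       implication [A, (TL j s, now, here 1)] (TL j s, soon, here 0)])"

definition time_clauses :: "tm \<Rightarrow> tlit list list" where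
  "time_clauses M = concat (map (\<lambda>(q, ss). control_rules M q ss) (control M))"

definition cell_clauses :: "tm \<Rightarrow> tlit list list" where
  "cell_clauses M = concat (map (\<lambda>(q, ss). concat (map (\<lambda>j. concat (map (cell_rules M q ss j)
     [0..<num_symbols M])) [0..<num_tapes M])) (control M))"

text \<open>Counter 4 holds the argument of the time polynomial; with it this is exactly the store
  in which the clauses after those for the input are printed.\<close>

definition counters :: "nat \<Rightarrow> nat \<Rightarrow> nat \<Rightarrow> nat \<Rightarrow> nat" where
  "counters n p b = (\<lambda>_. 0)(2 := n, 3 := p, 4 := n + p, 5 := b)"

definition inst :: "(nat \<Rightarrow> nat) \<Rightarrow> tlit list list \<Rightarrow> nat lit list list" where
  "inst \<rho> Cs = map (map (inst_lit \<rho>)) Cs"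

definition tableau :: "tm \<Rightarrow> bool list \<Rightarrow> nat \<Rightarrow> nat \<Rightarrow> nat lit list list" where
  "tableau M x p b = (let \<rho> = counters (length x) p b in
     concat (map (\<lambda>i. inst ((\<lambda>_. 0)(2 := i)) [input_clause (x ! i)]) [0..<length x]) @
     inst \<rho> [start_clause M] @
     concat (map (\<lambda>i. inst (\<rho>(7 := i)) (blank_clauses (num_tapes M))) [0..<b]) @
     concat (map (\<lambda>i. inst (\<rho>(7 := i)) guess_clauses) [0..<p]) @
     concat (map (\<lambda>t. inst (\<rho>(6 := t)) (time_clauses M) @
       concat (map (\<lambda>i. inst (\<rho>(6 := t, 7 := i)) (cell_clauses M)) [0..<b])) [0..<b]) @
     inst \<rho> (accept_clauses M))"

definition tableau_sat :: "tm \<Rightarrow> bool list \<Rightarrow> nat \<Rightarrow> nat \<Rightarrow> (tag \<Rightarrow> nat \<Rightarrow> nat \<Rightarrow> bool) \<Rightarrow> bool" where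
  "tableau_sat M x p b \<beta> \<longleftrightarrow> (let \<rho> = counters (length x) p b in
     (\<forall>i < length x. clause_sat \<beta> ((\<lambda>_. 0)(2 := i)) (input_clause (x ! i))) \<and>
     clause_sat \<beta> \<rho> (start_clause M) \<and>
     (\<forall>i < b. \<forall>C \<in> set (blank_clauses (num_tapes M)). clause_sat \<beta> (\<rho>(7 := i)) C) \<and>
     (\<forall>i < p. \<forall>C \<in> set guess_clauses. clause_sat \<beta> (\<rho>(7 := i)) C) \<and>
     (\<forall>t < b. \<forall>C \<in> set (time_clauses M). clause_sat \<beta> (\<rho>(6 := t)) C) \<and>
     (\<forall>t < b. \<forall>i < b. \<forall>C \<in> set (cell_clauses M). clause_sat \<beta> (\<rho>(6 := t, 7 := i)) C) \<and>
     (\<forall>C \<in> set (accept_clauses M). clause_sat \<beta> \<rho> C))"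

lemma inst_sat:
  "(\<forall>C \<in> set (inst \<rho> Cs). \<exists>(s, v) \<in> set C. \<alpha> v = s) \<longleftrightarrow>
     (\<forall>C \<in> set Cs. clause_sat (\<lambda>g t i. \<alpha> [to_nat g, t, i]) \<rho> C)"
proof -
  have "(case inst_lit \<rho> l of (s, v) \<Rightarrow> \<alpha> v = s) = tlit_sat (\<lambda>g t i. \<alpha> [to_nat g, t, i]) \<rho> l" for l
  proof -
    obtain s g te ie where l: "l = (s, g, te, ie)" by (cases l)
    then show ?thesis by (cases s) (simp_all add: inst_lit_def)
  qed
  then show ?thesis by (simp add: inst_def clause_sat_def list_ex_iff)
qed

lemma ball_less: "(\<forall>i \<in> {0..<n :: nat}. P i) \<longleftrightarrow> (\<forall>i < n. P i)"
  by auto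

text \<open>Keeping \<open>P\<close> abstract lets the quantifier be distributed over the
  concatenations before the meaning of a clause is unfolded.\<close>

lemma tableau_ball:
  assumes "\<And>\<rho> Cs. (\<forall>C \<in> set (inst \<rho> Cs). P C) \<longleftrightarrow> (\<forall>C \<in> set Cs. clause_sat \<beta> \<rho> C)"
  shows "(\<forall>C \<in> set (tableau M x p b). P C) \<longleftrightarrow> tableau_sat M x p b \<beta>"
  unfolding tableau_def tableau_sat_def Let_def
  by (simp add: ball_Un assms ball_less all_conj_distrib imp_conjR conj_assoc del: fun_upd_apply)

lemma cnf_sat_tableau: "cnf_sat (tableau M x p b) \<longleftrightarrow> (\<exists>\<beta>. tableau_sat M x p b \<beta>)"
proof -
  have *: "(\<forall>C \<in> set (tableau M x p b). \<exists>(s, v) \<in> set C. \<alpha> v = s) \<longleftrightarrow>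
      tableau_sat M x p b (\<lambda>g t i. \<alpha> [to_nat g, t, i])" for \<alpha>
    by (rule tableau_ball) (rule inst_sat)
  show ?thesis
  proof
    assume "cnf_sat (tableau M x p b)"
    then show "\<exists>\<beta>. tableau_sat M x p b \<beta>" unfolding cnf_sat_def * by (elim exE) (rule exI)
  next
    assume "\<exists>\<beta>. tableau_sat M x p b \<beta>"
    then obtain \<beta> where \<beta>: "tableau_sat M x p b \<beta>" ..
    \<comment> \<open>The name of a tableau variable consists of tag, time and cell, which are read
      off again here.\<close>
    define \<alpha> where "\<alpha> v = \<beta> (from_nat (v ! 0)) (v ! 1) (v ! 2)" for v
    have "(\<lambda>g t i. \<alpha> [to_nat g, t, i]) = \<beta>" by (simp add: \<alpha>_def)
    with \<beta> have "\<forall>C \<in> set (tableau M x p b). \<exists>(s, v) \<in> set C. \<alpha> v = s" unfolding * by simp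
    then show "cnf_sat (tableau M x p b)" unfolding cnf_sat_def by (rule exI[of _ \<alpha>])
  qed
qed

lemma nonempty_tableau: "[] \<notin> set (tableau M x p b)"
proof -
  have *: "[] \<in> set (inst \<rho> Cs) \<longleftrightarrow> [] \<in> set Cs" for \<rho> Cs by (auto simp: inst_def)
  have "[] \<notin> set (head_rules M q ss j)" "[] \<notin> set (cell_rules M q ss j s)" for q ss j s
    by (auto simp: head_rules_def cell_rules_def implication_def Let_def split: prod.splits move.splits)
  then show ?thesis
    unfolding tableau_def Let_def
    by (auto simp: * input_clause_def start_clause_def blank_clauses_def guess_clauses_def time_clauses_def
      control_rules_def cell_clauses_def accept_clauses_def implication_def)
qed

lemma nexp_val_simps [simp]: "nexp_val \<rho> (c, ks) = c + sum_list (map \<rho> ks)"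
  by (simp add: nexp_val_def)

lemma counters_simps [simp]:
  "counters n p b 2 = n" "counters n p b 3 = p" "counters n p b 5 = b"
  by (simp_all add: counters_def)

section \<open>Meaning of the clauses\<close>

definition head_sem :: "tm \<Rightarrow> (tag \<Rightarrow> nat \<Rightarrow> nat \<Rightarrow> bool) \<Rightarrow> nat \<Rightarrow> nat \<Rightarrow> nat list \<Rightarrow> nat \<Rightarrow> bool" where
  "head_sem M \<beta> t q ss j \<longleftrightarrow> (\<beta> (TA q ss) t 0 \<longrightarrow> (case snd (next_actions M q ss) ! j of (w, m) \<Rightarrow> (case m of
     Stay \<Rightarrow> \<beta> (TR j w) (Suc t) 0
   | MoveRight \<Rightarrow> \<beta> (TL j w) (Suc t) 0
   | MoveLeft \<Rightarrow> \<beta> (TR j w) (Suc t) 1 \<and> (\<forall>s < num_symbols M. \<beta> (TL j s) t 0 \<longrightarrow> \<beta> (TR j s) (Suc t) 0))))"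

definition cell_sem :: "tm \<Rightarrow> (tag \<Rightarrow> nat \<Rightarrow> nat \<Rightarrow> bool) \<Rightarrow> nat \<Rightarrow> nat \<Rightarrow> nat \<Rightarrow> nat list \<Rightarrow> nat \<Rightarrow> nat \<Rightarrow> bool" where
  "cell_sem M \<beta> t i q ss j s \<longleftrightarrow> (\<beta> (TA q ss) t 0 \<longrightarrow> (case snd (snd (next_actions M q ss) ! j) of
     Stay \<Rightarrow> (\<beta> (TR j s) t (Suc i) \<longrightarrow> \<beta> (TR j s) (Suc t) (Suc i)) \<and> (\<beta> (TL j s) t i \<longrightarrow> \<beta> (TL j s) (Suc t) i)
   | MoveRight \<Rightarrow> (\<beta> (TR j s) t (Suc i) \<longrightarrow> \<beta> (TR j s) (Suc t) i) \<and> (\<beta> (TL j s) t i \<longrightarrow> \<beta> (TL j s) (Suc t) (Suc i))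
   | MoveLeft \<Rightarrow> (\<beta> (TR j s) t (Suc i) \<longrightarrow> \<beta> (TR j s) (Suc t) (Suc (Suc i))) \<and> (\<beta> (TL j s) t (Suc i) \<longrightarrow> \<beta> (TL j s) (Suc t) i)))"

lemma head_rules_sat:
  "(\<forall>C \<in> set (head_rules M q ss j). clause_sat \<beta> \<rho> C) \<longleftrightarrow> head_sem M \<beta> (\<rho> 6) q ss j"
proof (cases "snd (next_actions M q ss) ! j")
  case (Pair w m)
  then show ?thesis
    by (cases m) (auto simp: head_rules_def head_sem_def clause_sat_implication Let_def)
qed

lemma cell_rules_sat:
  "(\<forall>C \<in> set (cell_rules M q ss j s). clause_sat \<beta> \<rho> C) \<longleftrightarrow> cell_sem M \<beta> (\<rho> 6) (\<rho> 7) q ss j s"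
  by (cases "snd (snd (next_actions M q ss) ! j)") (auto simp: cell_rules_def cell_sem_def clause_sat_implication Let_def)

lemma control_rules_sat:
  "(\<forall>C \<in> set (control_rules M q ss). clause_sat \<beta> \<rho> C) \<longleftrightarrow>
     (\<beta> (TQ q) (\<rho> 6) 0 \<and> (\<forall>j < num_tapes M. \<beta> (TR j (ss ! j)) (\<rho> 6) 0) \<longrightarrow> \<beta> (TA q ss) (\<rho> 6) 0) \<and>
     (\<beta> (TA q ss) (\<rho> 6) 0 \<longrightarrow> \<beta> (TQ (fst (next_actions M q ss))) (Suc (\<rho> 6)) 0) \<and>
     (\<forall>j < num_tapes M. head_sem M \<beta> (\<rho> 6) q ss j)"
  unfolding control_rules_def list.set ball_simps set_concat set_map ball_UN head_rules_sat
  by (simp add: clause_sat_implication ball_less)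

lemma set_control:
  "set (control M) = {(q, ss). q < num_states M \<and> length ss = num_tapes M \<and> set ss \<subseteq> {..<num_symbols M}}"
  by (auto simp: control_def set_n_lists)

lemma time_clauses_sat:
  "(\<forall>C \<in> set (time_clauses M). clause_sat \<beta> \<rho> C) \<longleftrightarrow> (\<forall>(q, ss) \<in> set (control M).
     \<forall>C \<in> set (control_rules M q ss). clause_sat \<beta> \<rho> C)"
  by (auto simp: time_clauses_def)

lemma cell_clauses_sat:
  "(\<forall>C \<in> set (cell_clauses M). clause_sat \<beta> \<rho> C) \<longleftrightarrow> (\<forall>(q, ss) \<in> set (control M).
     \<forall>j < num_tapes M. \<forall>s < num_symbols M. cell_sem M \<beta> (\<rho> 6) (\<rho> 7) q ss j s)"
  by (simp add: cell_clauses_def split_beta ball_less cell_rules_sat)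

lemma blank_clauses_sat:
  "(\<forall>C \<in> set (blank_clauses k). clause_sat \<beta> (\<rho>(7 := i)) C) \<longleftrightarrow>
     (\<forall>j < k. \<beta> (TL j 0) 0 i) \<and> \<beta> (TR 0 0) 0 (\<rho> 2 + i) \<and> \<beta> (TR 1 0) 0 (\<rho> 3 + i) \<and>
     (\<forall>j. 2 \<le> j \<and> j < k \<longrightarrow> \<beta> (TR j 0) 0 i)"
  by (auto simp: blank_clauses_def clause_sat_def ball_Un)

lemma guess_clauses_sat:
  "(\<forall>C \<in> set guess_clauses. clause_sat \<beta> (\<rho>(7 := i)) C) \<longleftrightarrow>
     (\<beta> (TR 1 0) 0 i \<or> \<beta> (TR 1 1) 0 i \<or> \<beta> (TR 1 2) 0 i) \<and> (\<beta> (TR 1 0) 0 i \<longrightarrow> \<beta> (TR 1 0) 0 (Suc i))"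
  by (simp add: guess_clauses_def clause_sat_def implication_def)

lemma accept_clauses_sat:
  "(\<forall>C \<in> set (accept_clauses M). clause_sat \<beta> \<rho> C) \<longleftrightarrow>
     (\<forall>q < num_states M. q \<noteq> accept M \<longrightarrow> \<not> \<beta> (TQ q) (\<rho> 5) 0)"
  by (auto simp: accept_clauses_def clause_sat_def)

text \<open>Removes templates and counters: both directions of the correctness proof argue about
  \<open>\<beta>\<close> at explicit times and cells only.\<close>

lemma tableau_sat_iff:
  "tableau_sat M x p b \<beta> \<longleftrightarrow>
     (\<forall>i < length x. \<beta> (TR 0 (if x ! i then 2 else 1)) 0 i) \<and> \<beta> (TQ (start M)) 0 0 \<and>
     (\<forall>i < b. (\<forall>j < num_tapes M. \<beta> (TL j 0) 0 i) \<and> \<beta> (TR 0 0) 0 (length x + i) \<and> \<beta> (TR 1 0) 0 (p + i) \<and>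
       (\<forall>j. 2 \<le> j \<and> j < num_tapes M \<longrightarrow> \<beta> (TR j 0) 0 i)) \<and>
     (\<forall>i < p. (\<beta> (TR 1 0) 0 i \<or> \<beta> (TR 1 1) 0 i \<or> \<beta> (TR 1 2) 0 i) \<and>
       (\<beta> (TR 1 0) 0 i \<longrightarrow> \<beta> (TR 1 0) 0 (Suc i))) \<and>
     (\<forall>t < b. \<forall>(q, ss) \<in> set (control M).
       (\<beta> (TQ q) t 0 \<and> (\<forall>j < num_tapes M. \<beta> (TR j (ss ! j)) t 0) \<longrightarrow> \<beta> (TA q ss) t 0) \<and>
       (\<beta> (TA q ss) t 0 \<longrightarrow> \<beta> (TQ (fst (next_actions M q ss))) (Suc t) 0) \<and>
       (\<forall>j < num_tapes M. head_sem M \<beta> t q ss j)) \<and>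
     (\<forall>t < b. \<forall>i < b. \<forall>(q, ss) \<in> set (control M).
       \<forall>j < num_tapes M. \<forall>s < num_symbols M. cell_sem M \<beta> t i q ss j s) \<and>
     (\<forall>q < num_states M. q \<noteq> accept M \<longrightarrow> \<not> \<beta> (TQ q) b 0)"
  unfolding tableau_sat_def Let_def time_clauses_sat control_rules_sat cell_clauses_sat blank_clauses_sat
    guess_clauses_sat accept_clauses_sat
  by (simp add: input_clause_def start_clause_def clause_sat_def)

section \<open>Runs of the verifier against the tableau\<close>

definition valid_config :: "tm \<Rightarrow> config \<Rightarrow> bool" where
  "valid_config M cf \<longleftrightarrow> fst cf < num_states M \<and> length (snd cf) = num_tapes M \<and>
     (\<forall>j < num_tapes M. \<forall>i. fst (snd cf ! j) i < num_symbols M)"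

text \<open>Rules exist only for states and symbols in range; this guarantees one for every
  configuration that a run reaches.\<close>

lemma set_scanned:
  assumes "valid_config M (q, ts)"
  shows "(q, map scanned ts) \<in> set (control M)"
proof -
  have "scanned (ts ! i) < num_symbols M" if "i < num_tapes M" for i
    using assms that by (simp add: valid_config_def scanned_def)
  moreover have "q < num_states M" "length ts = num_tapes M" using assms by (simp_all add: valid_config_def)
  ultimately have "\<forall>s \<in> set (map scanned ts). s < num_symbols M" by (simp add: all_set_conv_all_nth)
  then show ?thesis using \<open>q < num_states M\<close> \<open>length ts = num_tapes M\<close> by (auto simp: set_control)
qed

lemma next_actions_wf:
  assumes "wf_tm M" "(q, ss) \<in> set (control M)"
  shows "fst (next_actions M q ss) < num_states M" "length (snd (next_actions M q ss)) = num_tapes M"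
    "j < num_tapes M \<Longrightarrow> fst (snd (next_actions M q ss) ! j) < num_symbols M"
proof -
  have q: "q < num_states M" "length ss = num_tapes M" "set ss \<subseteq> {..<num_symbols M}"
    using assms(2) by (auto simp: set_control)
  then have "case delta M q ss of (q', acts) \<Rightarrow> q' < num_states M \<and> length acts = num_tapes M \<and>
      fst ` set acts \<subseteq> {..<num_symbols M}"
    using assms(1) by (auto simp: wf_tm_def)
  then obtain q' acts where d: "delta M q ss = (q', acts)" "q' < num_states M" "length acts = num_tapes M"
      "fst ` set acts \<subseteq> {..<num_symbols M}" by (auto split: prod.splits)
  show "fst (next_actions M q ss) < num_states M" "length (snd (next_actions M q ss)) = num_tapes M"
    using q d by (auto simp: next_actions_def)
  show "fst (snd (next_actions M q ss) ! j) < num_symbols M" if "j < num_tapes M"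
  proof (cases "q = accept M \<or> q = reject M")
    case True
    have "ss ! j \<in> set ss" using q(2) that by simp
    then have "ss ! j < num_symbols M" using q(3) by auto
    then show ?thesis using True q that by (auto simp: next_actions_def)
  next
    case False
    have "acts ! j \<in> set acts" using d(3) that by simp
    then show ?thesis using False d by (auto simp: next_actions_def)
  qed
qed

lemma step_next_actions:
  assumes "length ts = num_tapes M"
  shows "step M (q, ts) = (fst (next_actions M q (map scanned ts)), map2 act (snd (next_actions M q (map scanned ts))) ts)"
proof -
  have "act (scanned \<tau>, Stay) \<tau> = \<tau>" for \<tau> by (cases \<tau>) (simp add: scanned_def)
  then have "map2 act (map (\<lambda>s. (s, Stay)) (map scanned ts)) ts = ts"
    by (intro nth_equalityI) simp_all
  then show ?thesis by (auto simp: next_actions_def split: prod.splits)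
qed

lemma valid_config_step:
  assumes "wf_tm M" "valid_config M cf"
  shows "valid_config M (step M cf)"
proof -
  obtain q ts where cf: "cf = (q, ts)" by fastforce
  have len: "length ts = num_tapes M" using assms(2) by (simp add: cf valid_config_def)
  note wf = next_actions_wf[OF assms(1) set_scanned[OF assms(2)[unfolded cf]]]
  have "fst (act a \<tau>) i < num_symbols M"
    if "fst a < num_symbols M" "fst \<tau> i < num_symbols M" for a \<tau> i
    using that by (cases a; cases \<tau>) auto
  then show ?thesis
    using assms(2) wf len unfolding cf step_next_actions[OF len] valid_config_def by simp
qed

lemma valid_config_run:
  assumes "wf_tm M"
  shows "valid_config M (run M ws t)"
proof (induction t)
  case 0
  show ?case using assms by (auto simp: run_def init_def valid_config_def wf_tm_def word_contents_def)
qed (simp add: run_def valid_config_step[OF assms])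

lemma init_cells:
  assumes "2 \<le> num_tapes M" "j < num_tapes M"
  shows "left_cell (snd (run M [x, y] 0) ! j) i = 0"
    "right_cell (snd (run M [x, y] 0) ! j) i = word_contents (if j = 0 then x else if j = 1 then y else []) (int i)"
  using assms by (auto simp: run_def init_def left_cell_def right_cell_def word_contents_def less_2_cases_iff)

lemma run_Suc_conv:
  assumes "wf_tm M" and cf_def: "cf = run M ws t"
  shows "fst (run M ws (Suc t)) = fst (next_actions M (fst cf) (map scanned (snd cf)))"
    "j < num_tapes M \<Longrightarrow> snd (run M ws (Suc t)) ! j =
       act (snd (next_actions M (fst cf) (map scanned (snd cf))) ! j) (snd cf ! j)"
proof -
  obtain q ts where cf: "cf = (q, ts)" by fastforce
  have v: "valid_config M (q, ts)" using valid_config_run[OF assms(1), of ws t] cf by (simp add: cf_def)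
  then have len: "length ts = num_tapes M" by (simp add: valid_config_def)
  have "run M ws (Suc t) = step M (q, ts)" using cf by (simp add: run_def cf_def)
  then show "fst (run M ws (Suc t)) = fst (next_actions M (fst cf) (map scanned (snd cf)))"
    "j < num_tapes M \<Longrightarrow> snd (run M ws (Suc t)) ! j =
       act (snd (next_actions M (fst cf) (map scanned (snd cf))) ! j) (snd cf ! j)"
    using next_actions_wf(2)[OF assms(1) set_scanned[OF v]] len
    unfolding step_next_actions[OF len] cf by simp_all
qed

text \<open>The cells beyond \<open>b\<close> are not constrained. They influence one more cell in each step, so at time
  \<open>t\<close> the cells \<open>i\<close> with \<open>t + i < b\<close> are still right; this suffices for the scanned cells.\<close>

lemma accepting_if_tableau_sat:
  assumes wf: "wf_tm M" and two: "2 \<le> num_tapes M" and sat: "tableau_sat M x p b \<beta>"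
  shows "\<exists>y. length y \<le> p \<and> fst (run M [x, y] b) = accept M"
proof -
  note sat' = sat[unfolded tableau_sat_iff]
  have blank: "\<beta> (TL j 0) 0 i" "\<beta> (TR 0 0) 0 (length x + i)" "\<beta> (TR 1 0) 0 (p + i)" "2 \<le> j \<Longrightarrow> \<beta> (TR j 0) 0 i"
    if "i < b" "j < num_tapes M" for i j
    using sat' that by blast+
  \<comment> \<open>The certificate ends at the first cell of tape 1 that is claimed to be blank, at
    the latest at \<open>p\<close>.\<close>
  define len where "len = (LEAST i. i = p \<or> \<beta> (TR 1 0) 0 i)"
  have len: "len \<le> p" unfolding len_def by (rule Least_le) simp
  have len_end: "len = p \<or> \<beta> (TR 1 0) 0 len" unfolding len_def by (rule LeastI[of _ p]) simp
  have before: "\<not> \<beta> (TR 1 0) 0 i" if "i < len" for i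
    using not_less_Least[of i "\<lambda>i. i = p \<or> \<beta> (TR 1 0) 0 i"] that unfolding len_def by blast
  have after: "\<beta> (TR 1 0) 0 i" if "len \<le> i" "i < p" for i
    using that
  proof (induction i rule: dec_induct)
    case base
    then show ?case using len_end by auto
  next
    case (step i)
    then show ?case using sat' by simp
  qed
  \<comment> \<open>\<open>\<beta>\<close> may claim both bits for one cell. Preferring
    \<open>True\<close> is arbitrary, since either choice is backed by a claim.\<close>
  define y where "y = map (\<lambda>i. \<beta> (TR 1 2) 0 i) [0..<len]"
  have len_y: "length y = len" by (simp add: y_def)
  define q where "q t = fst (run M [x, y] t)" for t
  define ts where "ts t = snd (run M [x, y] t)" for t
  have ctrl: "(q t, map scanned (ts t)) \<in> set (control M)" for t
    using set_scanned valid_config_run[OF wf, of "[x, y]" t] by (simp add: q_def ts_def)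
  have len_ts: "length (ts t) = num_tapes M" for t
    using valid_config_run[OF wf, of "[x, y]" t] by (simp add: valid_config_def ts_def)
  have sym: "left_cell (ts t ! j) i < num_symbols M" "right_cell (ts t ! j) i < num_symbols M"
    if "j < num_tapes M" for t j i
    using valid_config_run[OF wf, of "[x, y]" t] that
    by (auto simp: valid_config_def ts_def left_cell_def right_cell_def)
  have "\<beta> (TQ (q t)) t 0 \<and> (\<forall>j < num_tapes M. \<forall>i. t + i < b \<longrightarrow>
      \<beta> (TL j (left_cell (ts t ! j) i)) t i \<and> \<beta> (TR j (right_cell (ts t ! j) i)) t i)"
    if "t \<le> b" for t
    using that
  proof (induction t)
    case 0
    have "\<beta> (TR j (right_cell (ts 0 ! j) i)) 0 i" if j: "j < num_tapes M" and i: "i < b" for i j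
    proof -
      consider "j = 0" | "j = 1" | "2 \<le> j" by linarith
      then show ?thesis
      proof cases
        case 1
        show ?thesis
        proof (cases "i < length x")
          case True
          then show ?thesis using sat' init_cells(2)[OF two j, of x y i] 1
            by (auto simp: ts_def word_contents_def)
        next
          case False
          then have "\<beta> (TR 0 0) 0 i" using blank(2)[of "i - length x" j] i j by simp
          then show ?thesis using False init_cells(2)[OF two j, of x y i] 1
            by (auto simp: ts_def word_contents_def)
        qed
      next
        case 2
        have r: "right_cell (ts 0 ! j) i = word_contents y (int i)"
          using init_cells(2)[OF two j, of x y i] 2 by (simp add: ts_def)
        consider "i < len" | "len \<le> i" "i < p" | "p \<le> i" by linarith
        then show ?thesis
        proof cases
          case a: 1
          then have "i < p" using len by simp
          then have "\<beta> (TR 1 1) 0 i \<or> \<beta> (TR 1 2) 0 i" using sat' before[OF a] by blast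
          moreover have "word_contents y (int i) = (if \<beta> (TR 1 2) 0 i then 2 else 1)"
            using a by (simp add: word_contents_def len_y) (simp add: y_def)
          ultimately show ?thesis using 2 r by auto
        next
          case a: 2
          then show ?thesis using after r 2 by (simp add: word_contents_def len_y)
        next
          case a: 3
          then have "\<beta> (TR 1 0) 0 i" using blank(3)[of "i - p" j] i j by simp
          then show ?thesis using a r 2 len by (simp add: word_contents_def len_y)
        qed
      next
        case 3
        then have "right_cell (ts 0 ! j) i = 0"
          using init_cells(2)[OF two j, of x y i] by (simp add: ts_def word_contents_def)
        then show ?thesis using blank(4)[of i j] 3 i j by simp
      qed
    qed
    moreover have "\<beta> (TL j (left_cell (ts 0 ! j) i)) 0 i" if j: "j < num_tapes M" and i: "i < b" for i j
      using blank(1) init_cells(1)[OF two j, of x y i] i j by (simp add: ts_def)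
    moreover have "\<beta> (TQ (q 0)) 0 0" using sat' by (simp add: q_def run_def init_def)
    ultimately show ?case by simp
  next
    case (Suc t)
    let ?ss = "map scanned (ts t)"
    have t: "t < b" using Suc.prems by simp
    note IH = Suc.IH[OF less_imp_le[OF t]]
    have rules: "(\<beta> (TQ (q t)) t 0 \<and> (\<forall>j < num_tapes M. \<beta> (TR j (?ss ! j)) t 0) \<longrightarrow> \<beta> (TA (q t) ?ss) t 0) \<and>
       (\<beta> (TA (q t) ?ss) t 0 \<longrightarrow> \<beta> (TQ (fst (next_actions M (q t) ?ss))) (Suc t) 0) \<and>
       (\<forall>j < num_tapes M. head_sem M \<beta> t (q t) ?ss j)"
      using sat' t ctrl[of t] by blast
    have cell: "cell_sem M \<beta> t i (q t) ?ss j s" if "i < b" "j < num_tapes M" "s < num_symbols M" for i j s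
      using sat' t ctrl[of t] that by blast
    have "\<beta> (TR j (?ss ! j)) t 0" if "j < num_tapes M" for j
      using IH that t len_ts[of t] by (simp add: scanned_right_cell)
    then have A: "\<beta> (TA (q t) ?ss) t 0" using rules IH by blast
    have "\<beta> (TL j (left_cell (ts (Suc t) ! j) i)) (Suc t) i \<and> \<beta> (TR j (right_cell (ts (Suc t) ! j) i)) (Suc t) i"
      if j: "j < num_tapes M" and i: "Suc t + i < b" for i j
    proof -
      have head: "head_sem M \<beta> t (q t) ?ss j" using rules j by blast
      obtain w m where wm: "snd (next_actions M (q t) ?ss) ! j = (w, m)" by fastforce
      have nxt: "ts (Suc t) ! j = act (w, m) (ts t ! j)"
        using run_Suc_conv(2)[OF wf refl j, of "[x, y]" t] wm by (simp add: ts_def q_def)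
      have IHL: "\<beta> (TL j (left_cell (ts t ! j) i)) t i" if "t + i < b" for i using IH j that by blast
      have IHR: "\<beta> (TR j (right_cell (ts t ! j) i)) t i" if "t + i < b" for i using IH j that by blast
      have cellL: "cell_sem M \<beta> t i' (q t) ?ss j (left_cell (ts t ! j) i'')" if "i' < b" for i' i''
        using cell[OF that j sym(1)[OF j]] .
      have cellR: "cell_sem M \<beta> t i' (q t) ?ss j (right_cell (ts t ! j) i'')" if "i' < b" for i' i''
        using cell[OF that j sym(2)[OF j]] .
      show ?thesis
      proof (cases m)
        case MoveLeft
        have "\<beta> (TL j (left_cell (ts t ! j) (Suc i))) (Suc t) i"
          using cellL[of i "Suc i"] IHL[of "Suc i"] A i wm MoveLeft by (simp add: cell_sem_def)
        moreover have "\<beta> (TR j (right_cell (ts (Suc t) ! j) i)) (Suc t) i"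
        proof -
          \<comment> \<open>After a left move the right cells 0 and 1 are governed by
            \<open>head_rules\<close>, all later ones by \<open>cell_rules\<close>.\<close>
          consider "i = 0" | "i = Suc 0" | i' where "i = Suc (Suc i')" by (metis not0_implies_Suc)
          then show ?thesis
          proof cases
            case 1
            then show ?thesis using head A IHL[of 0] t sym(1)[OF j, of t 0] wm MoveLeft
              by (simp add: head_sem_def nxt cells_act_MoveLeft)
          next
            case 2
            then show ?thesis using head A wm MoveLeft
              by (simp add: head_sem_def nxt cells_act_MoveLeft)
          next
            case 3
            then show ?thesis using cellR[of i' "Suc i'"] IHR[of "Suc i'"] A i wm MoveLeft
              by (simp add: cell_sem_def nxt cells_act_MoveLeft)
          qed
        qed
        ultimately show ?thesis using MoveLeft by (simp add: nxt cells_act_MoveLeft)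
      next
        case Stay
        have "\<beta> (TL j (left_cell (ts t ! j) i)) (Suc t) i"
          using cellL[of i i] IHL[of i] A i wm Stay by (simp add: cell_sem_def)
        moreover have "\<beta> (TR j (right_cell (ts (Suc t) ! j) i)) (Suc t) i"
        proof (cases i)
          case 0
          then show ?thesis using head A wm Stay by (simp add: head_sem_def nxt cells_act_Stay)
        next
          case (Suc i')
          then show ?thesis using cellR[of i' i] IHR[of i] A i wm Stay
            by (simp add: cell_sem_def nxt cells_act_Stay)
        qed
        ultimately show ?thesis using Stay by (simp add: nxt cells_act_Stay)
      next
        case MoveRight
        have "\<beta> (TR j (right_cell (ts t ! j) (Suc i))) (Suc t) i"
          using cellR[of i "Suc i"] IHR[of "Suc i"] A i wm MoveRight by (simp add: cell_sem_def)
        moreover have "\<beta> (TL j (left_cell (ts (Suc t) ! j) i)) (Suc t) i"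
        proof (cases i)
          case 0
          then show ?thesis using head A wm MoveRight by (simp add: head_sem_def nxt cells_act_MoveRight)
        next
          case (Suc i')
          then show ?thesis using cellL[of i' i'] IHL[of i'] A i wm MoveRight
            by (simp add: cell_sem_def nxt cells_act_MoveRight)
        qed
        ultimately show ?thesis using MoveRight by (simp add: nxt cells_act_MoveRight)
      qed
    qed
    moreover have "\<beta> (TQ (q (Suc t))) (Suc t) 0"
      using rules A run_Suc_conv(1)[OF wf refl, of "[x, y]" t] by (simp add: q_def ts_def)
    ultimately show ?case by blast
  qed
  \<comment> \<open>At time \<open>b\<close> no cell satisfies \<open>t + i < b\<close>; the state
    is what remains, and the accept clauses speak of nothing else.\<close>
  from this[of b] have "\<beta> (TQ (q b)) b 0" by simp
  moreover have "q b < num_states M" using valid_config_run[OF wf, of "[x, y]" b] by (simp add: q_def valid_config_def)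
  ultimately have "q b = accept M" using sat' by blast
  then show ?thesis using len len_y by (auto simp: q_def)
qed

text \<open>\<open>\<beta>\<close> is what is true in the run, at all times and in all cells, so
  each rule is a fact about one step. The certificate bound enters only in the blanks of tape 1,
  acceptance only in the last clauses.\<close>

lemma tableau_sat_if_accepting:
  assumes wf: "wf_tm M" and two: "2 \<le> num_tapes M" and len: "length y \<le> p"
    and acc: "fst (run M [x, y] b) = accept M"
  shows "\<exists>\<beta>. tableau_sat M x p b \<beta>"
proof -
  define q where "q t = fst (run M [x, y] t)" for t
  define ts where "ts t = snd (run M [x, y] t)" for t
  define \<beta> where "\<beta> g t i = (case g of TQ q' \<Rightarrow> q' = q t | TA q' ss \<Rightarrow> q' = q t \<and> ss = map scanned (ts t)
    | TL j s \<Rightarrow> s = left_cell (ts t ! j) i | TR j s \<Rightarrow> s = right_cell (ts t ! j) i)" for g t i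
  have \<beta>: "\<beta> (TQ q') t i \<longleftrightarrow> q' = q t" "\<beta> (TA q' ss) t i \<longleftrightarrow> q' = q t \<and> ss = map scanned (ts t)"
      "\<beta> (TL j s) t i \<longleftrightarrow> s = left_cell (ts t ! j) i" "\<beta> (TR j s) t i \<longleftrightarrow> s = right_cell (ts t ! j) i"
    for q' ss j s t i by (simp_all add: \<beta>_def)
  have len_ts: "length (ts t) = num_tapes M" for t
    using valid_config_run[OF wf, of "[x, y]" t] by (simp add: valid_config_def ts_def)
  have nxt: "ts (Suc t) ! j = act (snd (next_actions M (q t) (map scanned (ts t))) ! j) (ts t ! j)"
    if "j < num_tapes M" for t j
    using run_Suc_conv(2)[OF wf refl that, of "[x, y]" t] by (simp add: ts_def q_def)
  have init: "left_cell (ts 0 ! j) i = 0"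
      "right_cell (ts 0 ! j) i = word_contents (if j = 0 then x else if j = 1 then y else []) (int i)"
    if "j < num_tapes M" for j i
    using init_cells[OF two that, of x y i] by (simp_all add: ts_def)
  have head: "head_sem M \<beta> t q' ss j" if j: "j < num_tapes M" for t q' ss j
  proof -
    obtain w m where wm: "snd (next_actions M q' ss) ! j = (w, m)" by fastforce
    then show ?thesis using nxt[OF j, of t]
      by (cases m) (auto simp: head_sem_def \<beta> cells_act_Stay cells_act_MoveLeft cells_act_MoveRight)
  qed
  have cell: "cell_sem M \<beta> t i q' ss j s" if j: "j < num_tapes M" for t q' ss j i s
  proof -
    obtain w m where wm: "snd (next_actions M q' ss) ! j = (w, m)" by fastforce
    then show ?thesis using nxt[OF j, of t]
      by (cases m) (auto simp: cell_sem_def \<beta> cells_act_Stay cells_act_MoveLeft cells_act_MoveRight)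
  qed
  have control: "(\<beta> (TQ q') t 0 \<and> (\<forall>j < num_tapes M. \<beta> (TR j (ss ! j)) t 0) \<longrightarrow> \<beta> (TA q' ss) t 0) \<and>
      (\<beta> (TA q' ss) t 0 \<longrightarrow> \<beta> (TQ (fst (next_actions M q' ss))) (Suc t) 0)"
    if "(q', ss) \<in> set (control M)" for q' ss t
  proof -
    have "ss = map scanned (ts t)" if "\<forall>j < num_tapes M. ss ! j = right_cell (ts t ! j) 0"
      using that \<open>(q', ss) \<in> set (control M)\<close> len_ts[of t]
      by (auto simp: set_control scanned_right_cell intro!: nth_equalityI)
    then show ?thesis using run_Suc_conv(1)[OF wf refl, of "[x, y]" t] by (auto simp: \<beta> q_def ts_def)
  qed
  have "tableau_sat M x p b \<beta>"
    unfolding tableau_sat_iff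
  proof (intro conjI)
    show "\<forall>i < length x. \<beta> (TR 0 (if x ! i then 2 else 1)) 0 i"
      using two by (auto simp: \<beta> init word_contents_def)
    show "\<beta> (TQ (start M)) 0 0" by (simp add: \<beta> q_def run_def init_def)
    show "\<forall>i < b. (\<forall>j < num_tapes M. \<beta> (TL j 0) 0 i) \<and> \<beta> (TR 0 0) 0 (length x + i) \<and> \<beta> (TR 1 0) 0 (p + i) \<and>
       (\<forall>j. 2 \<le> j \<and> j < num_tapes M \<longrightarrow> \<beta> (TR j 0) 0 i)"
      using two len by (auto simp: \<beta> init word_contents_def)
    show "\<forall>i < p. (\<beta> (TR 1 0) 0 i \<or> \<beta> (TR 1 1) 0 i \<or> \<beta> (TR 1 2) 0 i) \<and>
       (\<beta> (TR 1 0) 0 i \<longrightarrow> \<beta> (TR 1 0) 0 (Suc i))"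
      using two by (auto simp: \<beta> init word_contents_def split: if_splits)
    show "\<forall>q' < num_states M. q' \<noteq> accept M \<longrightarrow> \<not> \<beta> (TQ q') b 0"
      using acc by (simp add: \<beta> q_def)
  qed (use head cell control in blast)+
  then show ?thesis by (rule exI[of _ \<beta>])
qed

theorem cnf_sat_tableau_iff:
  assumes "wf_tm M" "2 \<le> num_tapes M"
  shows "cnf_sat (tableau M x p b) \<longleftrightarrow> (\<exists>y. length y \<le> p \<and> fst (run M [x, y] b) = accept M)"
  unfolding cnf_sat_tableau using accepting_if_tableau_sat[OF assms] tableau_sat_if_accepting[OF assms] by blast

section \<open>Counter programs\<close>

text \<open>Domination by a polynomial instead of equality: costs can be added and nested as plain
  functions, and a polynomial is chosen once at the end.\<close>

definition poly_bounded :: "(nat \<Rightarrow> nat) \<Rightarrow> bool" where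
  "poly_bounded f \<longleftrightarrow> (\<exists>q :: nat poly. \<forall>n. f n \<le> poly q n)"

lemma poly_mono_nat: "x \<le> y \<Longrightarrow> poly (p :: nat poly) x \<le> poly p y"
  by (induction p) (auto intro: add_mono mult_mono)

lemma poly_bounded_poly: "poly_bounded (poly q)"
  unfolding poly_bounded_def by blast

lemma poly_bounded_const: "poly_bounded (\<lambda>_. c)"
  unfolding poly_bounded_def by (rule exI[of _ "[:c:]"]) simp

lemma poly_bounded_id: "poly_bounded (\<lambda>n. n)"
  unfolding poly_bounded_def by (rule exI[of _ "[:0, 1:]"]) simp

lemma poly_bounded_add: "poly_bounded f \<Longrightarrow> poly_bounded g \<Longrightarrow> poly_bounded (\<lambda>n. f n + g n)"
  unfolding poly_bounded_def by (metis add_mono poly_add)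

lemma poly_bounded_mult: "poly_bounded f \<Longrightarrow> poly_bounded g \<Longrightarrow> poly_bounded (\<lambda>n. f n * g n)"
  unfolding poly_bounded_def by (metis mult_le_mono poly_mult)

text \<open>Upper bounds compose because polynomials with natural coefficients are monotone.\<close>

lemma poly_bounded_compose: "poly_bounded f \<Longrightarrow> poly_bounded g \<Longrightarrow> poly_bounded (\<lambda>n. f (g n))"
proof -
  assume "poly_bounded f" "poly_bounded g"
  then obtain p q where "\<And>n. f n \<le> poly p n" "\<And>n. g n \<le> poly q n"
    unfolding poly_bounded_def by blast
  then have "f (g n) \<le> poly (pcompose p q) n" for n
    unfolding poly_pcompose by (meson order_trans poly_mono_nat)
  then show ?thesis unfolding poly_bounded_def by blast
qed

lemmas poly_bounded_intros =
  poly_bounded_const poly_bounded_id poly_bounded_add poly_bounded_mult poly_bounded_poly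

lemma concat_map_Nil [simp]: "concat (map (\<lambda>_. []) xs) = []"
  by (induction xs) simp_all

section \<open>Programs on unary counters\<close>

definition unary :: "(nat \<Rightarrow> nat) \<Rightarrow> bool list \<Rightarrow> bool store" where
  "unary \<rho> x = (\<lambda>j. if j = 0 then x else replicate (\<rho> j) True)"

text \<open>The input on stack 0 is arbitrary and remains unchanged.\<close>

definition cnt :: "bool cmd \<Rightarrow> (nat \<Rightarrow> nat) \<Rightarrow> nat \<Rightarrow> (nat \<Rightarrow> nat) \<Rightarrow> bool list \<Rightarrow> bool" where
  "cnt e \<rho> N \<rho>' s \<longleftrightarrow> (\<forall>x out. exec e (unary \<rho> x) out N (unary \<rho>' x) (out @ s))"

lemma tops_unary: "tops (unary \<rho> x) 0 = (case x of [] \<Rightarrow> None | b # _ \<Rightarrow> Some b)"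
  "j \<noteq> 0 \<Longrightarrow> tops (unary \<rho> x) j = (if \<rho> j = 0 then None else Some True)"
  by (auto simp: tops_def unary_def split: nat.splits) (cases "\<rho> j"; simp)+

lemma cnt_mono: "cnt e \<rho> M \<rho>' s \<Longrightarrow> M \<le> N \<Longrightarrow> cnt e \<rho> N \<rho>' s"
  unfolding cnt_def by (blast intro: exec_mono)

abbreviation incr :: "nat \<Rightarrow> bool cmd" where "incr j \<equiv> Push j (\<lambda>_. True)"

lemma cnt_incr: "j \<noteq> 0 \<Longrightarrow> \<rho>' = \<rho>(j := Suc (\<rho> j)) \<Longrightarrow> cnt (incr j) \<rho> 2 \<rho>' []"
  unfolding cnt_def by (auto intro!: exec_push simp: unary_def fun_eq_iff)

lemma cnt_Pop: "j \<noteq> 0 \<Longrightarrow> \<rho>' = \<rho>(j := \<rho> j - 1) \<Longrightarrow> cnt (Pop j) \<rho> 1 \<rho>' []"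
  unfolding cnt_def by (auto intro!: exec_pop simp: unary_def fun_eq_iff)

lemma cnt_Emit: "cnt (Emit b) \<rho> 1 \<rho> [b]"
  unfolding cnt_def by (auto intro!: exec_emit)

lemma cnt_Seq: "cnt c \<rho> m \<rho>' s \<Longrightarrow> cnt d \<rho>' n \<rho>'' s' \<Longrightarrow> N = m + n + 1 \<Longrightarrow> s'' = s @ s' \<Longrightarrow> cnt (c ;; d) \<rho> N \<rho>'' s''"
  unfolding cnt_def by (metis append_assoc exec_seq order_refl)

definition skip :: "'a cmd" where "skip = While (\<lambda>_. False) (Pop 0)"

lemma exec_skip: "exec skip \<sigma> out 1 \<sigma> out"
  unfolding skip_def by (rule exec_while_end) auto

lemma cnt_skip: "cnt skip \<rho> 1 \<rho> []"
  unfolding cnt_def append_Nil2 by (intro allI exec_skip)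

definition loop :: "nat \<Rightarrow> bool cmd \<Rightarrow> bool cmd" where
  "loop j c = While (\<lambda>t. t j \<noteq> None) (Pop j ;; c)"

text \<open>\<open>R v\<close> is the store after \<open>v\<close> rounds, with counter
  \<open>j\<close> overridden since the loop itself consumes it. The three further steps of a round
  are the test, the pop and the sequencing.\<close>

lemma cnt_loop:
  assumes "j \<noteq> 0" and "\<And>v. v < n \<Longrightarrow> cnt c ((R v)(j := n - Suc v)) N ((R (Suc v))(j := n - Suc v)) (s v)"
  shows "cnt (loop j c) ((R 0)(j := n)) (n * (N + 3) + 1) ((R n)(j := 0)) (concat (map s [0..<n]))"
  using assms(2)
proof (induction n arbitrary: R s)
  case 0
  show ?case unfolding cnt_def loop_def using \<open>j \<noteq> 0\<close> by (auto intro!: exec_while_end simp: tops_unary)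
next
  case (Suc n)
  have rest: "cnt (loop j c) ((R (Suc 0))(j := n)) (n * (N + 3) + 1) ((R (Suc n))(j := 0))
      (concat (map (\<lambda>v. s (Suc v)) [0..<n]))"
  proof (rule Suc.IH[where R = "\<lambda>v. R (Suc v)" and s = "\<lambda>v. s (Suc v)"])
    fix v assume "v < n"
    then show "cnt c ((R (Suc v))(j := n - Suc v)) N ((R (Suc (Suc v)))(j := n - Suc v)) (s (Suc v))"
      using Suc.prems[of "Suc v"] by (simp only: diff_Suc_Suc Suc_less_eq simp_thms)
  qed
  have body: "cnt (Pop j ;; c) ((R 0)(j := Suc n)) (N + 2) ((R (Suc 0))(j := n)) (s 0)"
  proof (rule cnt_Seq)
    show "cnt (Pop j) ((R 0)(j := Suc n)) 1 ((R 0)(j := n)) []"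
      by (rule cnt_Pop[OF \<open>j \<noteq> 0\<close>]) auto
    show "cnt c ((R 0)(j := n)) N ((R (Suc 0))(j := n)) (s 0)"
      using Suc.prems[OF zero_less_Suc] unfolding diff_Suc_Suc minus_nat.diff_0 .
  qed simp_all
  have split: "concat (map s [0..<Suc n]) = s 0 @ concat (map (\<lambda>v. s (Suc v)) [0..<n])"
    by (subst upt_conv_Cons) (auto simp: map_Suc_upt[symmetric] comp_def simp del: upt_Suc)
  show ?case
    unfolding cnt_def loop_def
  proof (intro allI)
    fix x out
    show "exec (While (\<lambda>t. t j \<noteq> None) (Pop j ;; c)) (unary ((R 0)(j := Suc n)) x) out (Suc n * (N + 3) + 1)
        (unary ((R (Suc n))(j := 0)) x) (out @ concat (map s [0..<Suc n]))"
      unfolding split append_assoc[symmetric]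
    proof (rule exec_while)
      show "exec (Pop j ;; c) (unary ((R 0)(j := Suc n)) x) out (N + 2) (unary ((R (Suc 0))(j := n)) x) (out @ s 0)"
        using body unfolding cnt_def by blast
      show "exec (While (\<lambda>t. t j \<noteq> None) (Pop j ;; c)) (unary ((R (Suc 0))(j := n)) x) (out @ s 0) (n * (N + 3) + 1)
          (unary ((R (Suc n))(j := 0)) x) ((out @ s 0) @ concat (map (\<lambda>v. s (Suc v)) [0..<n]))"
        using rest unfolding cnt_def loop_def by blast
    qed (use \<open>j \<noteq> 0\<close> in \<open>simp_all add: tops_unary\<close>)
  qed
qed

definition move_to :: "nat \<Rightarrow> nat \<Rightarrow> bool cmd" where "move_to a b = loop a (incr b)"

lemma cnt_move_to:
  assumes "a \<noteq> 0" "b \<noteq> 0" "a \<noteq> b"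
  shows "cnt (move_to a b) \<rho> (5 * \<rho> a + 1) (\<rho>(a := 0, b := \<rho> b + \<rho> a)) []"
proof -
  have "cnt (loop a (incr b)) ((\<rho>(b := \<rho> b + 0))(a := \<rho> a)) (\<rho> a * (2 + 3) + 1)
      ((\<rho>(b := \<rho> b + \<rho> a))(a := 0)) (concat (map (\<lambda>_. []) [0..<\<rho> a]))"
    using assms by (intro cnt_loop cnt_incr) (auto simp: fun_eq_iff)
  moreover have "(\<rho>(b := \<rho> b + 0))(a := \<rho> a) = \<rho>" by auto
  ultimately show ?thesis using assms by (simp add: move_to_def fun_upd_twist mult.commute)
qed

text \<open>Stack 8 is the scratch counter of the basic subroutines.\<close>

definition add_copy :: "nat \<Rightarrow> nat \<Rightarrow> bool cmd" where
  "add_copy c d = move_to c 8 ;; loop 8 (incr c ;; incr d)"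

lemma cnt_add_copy:
  assumes "c \<noteq> 0" "d \<noteq> 0" "c \<noteq> d" "c \<noteq> 8" "d \<noteq> 8" "\<rho> 8 = 0"
  shows "cnt (add_copy c d) \<rho> (13 * \<rho> c + 3) (\<rho>(d := \<rho> d + \<rho> c)) []"
proof -
  define n where "n = \<rho> c"
  define R where "R v = \<rho>(c := v, d := \<rho> d + v)" for v
  have "cnt (loop 8 (incr c ;; incr d)) ((R 0)(8 := n)) (n * (5 + 3) + 1) ((R n)(8 := 0))
      (concat (map (\<lambda>_. []) [0..<n]))"
  proof (rule cnt_loop)
    fix v
    show "cnt (incr c ;; incr d) ((R v)(8 := n - Suc v)) 5 ((R (Suc v))(8 := n - Suc v)) []"
      using assms by (intro cnt_Seq[OF cnt_incr[OF _ refl] cnt_incr]) (auto simp: R_def fun_eq_iff)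
  qed simp
  moreover have "(R 0)(8 := n) = \<rho>(c := 0, 8 := \<rho> 8 + \<rho> c)" "(R n)(8 := 0) = \<rho>(d := \<rho> d + \<rho> c)"
    using assms by (auto simp: R_def n_def fun_eq_iff)
  ultimately show ?thesis
    unfolding add_copy_def using assms
    by (intro cnt_Seq[OF cnt_move_to, where n = "n * (5 + 3) + 1"]) (auto simp: n_def)
qed

text \<open>A copy of the bound is counted down in \<open>d\<close> while \<open>i\<close> counts up
  as the index seen by the body. Both end at zero, so later loops can use them again.\<close>

definition for_loop :: "nat \<Rightarrow> nat \<Rightarrow> nat \<Rightarrow> bool cmd \<Rightarrow> bool cmd" where
  "for_loop c d i body = add_copy c d ;; loop d (body ;; incr i) ;; loop i skip"

lemma cnt_for_loop:
  assumes dist: "distinct [0, 8, c, d, i]" and zero: "\<rho> 8 = 0" "\<rho> d = 0" "\<rho> i = 0"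
    and body: "\<And>v. v < \<rho> c \<Longrightarrow> cnt body (\<rho>(d := \<rho> c - Suc v, i := v)) N (\<rho>(d := \<rho> c - Suc v, i := v)) (s v)"
  shows "cnt (for_loop c d i body) \<rho> (\<rho> c * (N + 30) + 10) \<rho> (concat (map s [0..<\<rho> c]))"
proof -
  define n where "n = \<rho> c"
  have 1: "cnt (add_copy c d) \<rho> (13 * n + 3) (\<rho>(d := n)) []"
    using cnt_add_copy[of c d \<rho>] assms by (simp add: n_def)
  have "cnt (loop d (body ;; incr i)) ((\<rho>(i := 0))(d := n)) (n * ((N + 3) + 3) + 1) ((\<rho>(i := n))(d := 0)) (concat (map s [0..<n]))"
  proof (rule cnt_loop)
    fix v assume "v < n"
    then have "cnt body ((\<rho>(i := v))(d := n - Suc v)) N ((\<rho>(i := v))(d := n - Suc v)) (s v)"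
      using body[of v] dist by (simp add: n_def fun_upd_twist)
    then show "cnt (body ;; incr i) ((\<rho>(i := v))(d := n - Suc v)) (N + 3) ((\<rho>(i := Suc v))(d := n - Suc v)) (s v)"
      using dist by (rule_tac cnt_Seq[OF _ cnt_incr]) (auto simp: fun_eq_iff)
  qed (use dist in auto)
  moreover have "\<rho>(i := 0) = \<rho>" using zero by auto
  moreover have "(\<rho>(i := n))(d := 0) = \<rho>(i := n)" using zero dist by auto
  ultimately have 2: "cnt (loop d (body ;; incr i)) (\<rho>(d := n)) (n * (N + 6) + 1) (\<rho>(i := n)) (concat (map s [0..<n]))"
    by (simp add: add.commute)
  have "cnt (loop i skip) (\<rho>(i := n)) (n * (1 + 3) + 1) (\<rho>(i := 0)) (concat (map (\<lambda>_. []) [0..<n]))"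
    using dist by (intro cnt_loop cnt_skip) auto
  then have 3: "cnt (loop i skip) (\<rho>(i := n)) (n * 4 + 1) \<rho> []"
    using \<open>\<rho>(i := 0) = \<rho>\<close> by simp
  \<comment> \<open>The exact sum is \<open>n * (N + 23) + 7\<close>; the claim rounds it
    up.\<close>
  have "cnt (for_loop c d i body) \<rho> (13 * n + 3 + (n * (N + 6) + 1 + (n * 4 + 1) + 1) + 1) \<rho> (concat (map s [0..<n]))"
    unfolding for_loop_def by (rule cnt_Seq[OF 1 cnt_Seq[OF 2 3 refl refl] refl]) simp
  then show ?thesis unfolding n_def[symmetric] by (rule cnt_mono) (simp add: algebra_simps)
qed

text \<open>Two bits per unit: in \<open>encode_var\<close> every letter is preceded by a
  continuation bit \<open>True\<close>, and the letters of a unary number are \<open>True\<close> as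
  well.\<close>

definition print :: "nat \<Rightarrow> bool cmd" where
  "print c = loop c (incr 8 ;; Emit True ;; Emit True) ;; move_to 8 c"

lemma cnt_print:
  assumes "c \<noteq> 0" "c \<noteq> 8" "\<rho> 8 = 0"
  shows "cnt (print c) \<rho> (14 * \<rho> c + 3) \<rho> (replicate (2 * \<rho> c) True)"
proof -
  define n where "n = \<rho> c"
  have "cnt (loop c (incr 8 ;; Emit True ;; Emit True)) ((\<rho>(8 := 0))(c := n)) (n * (6 + 3) + 1) ((\<rho>(8 := n))(c := 0))
      (concat (map (\<lambda>_. [True, True]) [0..<n]))"
  proof (rule cnt_loop[where R = "\<lambda>v. \<rho>(8 := v)"])
    fix v
    have "(\<rho>(8 := Suc v))(c := n - Suc v) = ((\<rho>(8 := v))(c := n - Suc v))(8 := Suc (((\<rho>(8 := v))(c := n - Suc v)) 8))"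
      using assms by (auto simp: fun_eq_iff)
    then show "cnt (incr 8 ;; Emit True ;; Emit True) ((\<rho>(8 := v))(c := n - Suc v)) 6 ((\<rho>(8 := Suc v))(c := n - Suc v)) [True, True]"
      by (intro cnt_Seq[OF cnt_incr cnt_Seq[OF cnt_Emit cnt_Emit refl refl]]) simp_all
  qed (use assms in simp)
  moreover have "concat (map (\<lambda>_. [True, True]) [0..<n]) = replicate (2 * n) True" 
  proof (induction n)
    case (Suc n)
    have "replicate (2 * n) True @ [True, True] = replicate (2 * n + 2) True"
      by (subst replicate_add) (simp add: numeral_2_eq_2)
    then show ?case using Suc.IH by simp
  qed simp
  moreover have "(\<rho>(8 := 0))(c := n) = \<rho>" using assms by (auto simp: n_def)
  ultimately have 1: "cnt (loop c (incr 8 ;; Emit True ;; Emit True)) \<rho> (9 * n + 1) (\<rho>(8 := n, c := 0)) (replicate (2 * n) True)"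
    by (simp add: mult.commute)
  have "\<rho>(8 := n, c := 0, 8 := 0, c := n) = \<rho>" using assms by (auto simp: n_def fun_eq_iff)
  then have 2: "cnt (move_to 8 c) (\<rho>(8 := n, c := 0)) (5 * n + 1) \<rho> []"
    using cnt_move_to[of 8 c "\<rho>(8 := n, c := 0)"] assms by simp
  show ?thesis unfolding print_def n_def[symmetric] by (rule cnt_Seq[OF 1 2]) simp_all
qed

section \<open>Printing programs with polynomial cost\<close>

fun seqs :: "'a cmd list \<Rightarrow> 'a cmd" where
  "seqs [] = skip"
| "seqs (e # es) = e ;; seqs es"

text \<open>The counters in \<open>Z\<close> have to be zero; all counters are restored.\<close>

definition runs_within :: "nat set \<Rightarrow> bool cmd \<Rightarrow> ((nat \<Rightarrow> nat) \<Rightarrow> bool list) \<Rightarrow> (nat \<Rightarrow> nat) \<Rightarrow> bool" where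
  "runs_within Z e F f \<longleftrightarrow>
     (\<forall>\<rho> m. (\<forall>z \<in> Z. \<rho> z = 0) \<longrightarrow> (\<forall>k. \<rho> k \<le> m) \<longrightarrow> cnt e \<rho> (f m) \<rho> (F \<rho>))"

definition efficient :: "nat set \<Rightarrow> bool cmd \<Rightarrow> ((nat \<Rightarrow> nat) \<Rightarrow> bool list) \<Rightarrow> bool" where
  "efficient Z e F \<longleftrightarrow> (\<exists>f. poly_bounded f \<and> runs_within Z e F f)"

lemma runs_withinD:
  "runs_within Z e F f \<Longrightarrow> (\<And>z. z \<in> Z \<Longrightarrow> \<rho> z = 0) \<Longrightarrow> (\<And>k. \<rho> k \<le> m) \<Longrightarrow> cnt e \<rho> (f m) \<rho> (F \<rho>)"
  unfolding runs_within_def by simp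

lemma efficientI:
  assumes "poly_bounded f" "\<And>\<rho> m. (\<And>z. z \<in> Z \<Longrightarrow> \<rho> z = 0) \<Longrightarrow> (\<And>k. \<rho> k \<le> m) \<Longrightarrow> cnt e \<rho> (f m) \<rho> (F \<rho>)"
  shows "efficient Z e F"
  unfolding efficient_def runs_within_def by (intro exI[of _ f] conjI allI impI) (use assms in simp_all)

lemma efficient_weaken: "efficient Z e F \<Longrightarrow> Z \<subseteq> Z' \<Longrightarrow> efficient Z' e F"
  unfolding efficient_def runs_within_def by (meson subsetD)

lemma efficient_skip: "efficient Z skip (\<lambda>_. [])"
  by (rule efficientI[OF poly_bounded_const cnt_skip])

lemma efficient_Emit: "efficient Z (Emit b) (\<lambda>_. [b])"
  by (rule efficientI[OF poly_bounded_const cnt_Emit])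

lemma efficient_Seq:
  assumes "efficient Z c F" "efficient Z d G" "\<And>\<rho>. H \<rho> = F \<rho> @ G \<rho>"
  shows "efficient Z (c ;; d) H"
proof -
  obtain f where f: "poly_bounded f" "runs_within Z c F f"
    using assms(1) unfolding efficient_def by blast
  obtain g where g: "poly_bounded g" "runs_within Z d G g"
    using assms(2) unfolding efficient_def by blast
  show ?thesis
  proof (rule efficientI)
    show "poly_bounded (\<lambda>m. f m + g m + 1)" using f(1) g(1) by (intro poly_bounded_intros)
    fix \<rho> :: "nat \<Rightarrow> nat" and m assume *: "\<And>z. z \<in> Z \<Longrightarrow> \<rho> z = 0" "\<And>k. \<rho> k \<le> m"
    show "cnt (c ;; d) \<rho> (f m + g m + 1) \<rho> (H \<rho>)"
      by (rule cnt_Seq[OF runs_withinD[OF f(2) *] runs_withinD[OF g(2) *] refl assms(3)])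
  qed
qed

lemma efficient_seqs:
  assumes "\<And>x. x \<in> set xs \<Longrightarrow> efficient Z (g x) (F x)"
  shows "efficient Z (seqs (map g xs)) (\<lambda>\<rho>. concat (map (\<lambda>x. F x \<rho>) xs))"
  using assms
proof (induction xs)
  case Nil
  then show ?case by (simp add: efficient_skip)
next
  case (Cons x xs)
  then show ?case by (auto intro!: efficient_Seq)
qed

lemma efficient_print: "c \<noteq> 0 \<Longrightarrow> c \<noteq> 8 \<Longrightarrow> 8 \<in> Z \<Longrightarrow> efficient Z (print c) (\<lambda>\<rho>. replicate (2 * \<rho> c) True)"
proof (rule efficientI)
  show "poly_bounded (\<lambda>m. 14 * m + 3)" by (intro poly_bounded_intros)
  fix \<rho> :: "nat \<Rightarrow> nat" and m assume "c \<noteq> 0" "c \<noteq> 8" "8 \<in> Z" "\<And>z. z \<in> Z \<Longrightarrow> \<rho> z = 0" "\<And>k. \<rho> k \<le> m"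
  then show "cnt (print c) \<rho> (14 * m + 3) \<rho> (replicate (2 * \<rho> c) True)"
    by (intro cnt_mono[OF cnt_print]) auto
qed

text \<open>Inside the loop \<open>d\<close> and \<open>i\<close> never exceed counter
  \<open>c\<close>, so one bound \<open>m\<close> serves the loop and its body. Both are nonzero
  there at times, so the body may not require them to be zero; the output may depend on
  \<open>i\<close> but not on the countdown.\<close>

lemma efficient_for_loop:
  assumes "efficient Z body F" and dist: "distinct [0, 8, c, d, i]" and "d \<notin> Z" "i \<notin> Z" "insert 8 (insert d (insert i Z)) \<subseteq> Z'"
    and indep: "\<And>\<rho> r. F (\<rho>(d := r)) = F \<rho>"
  shows "efficient Z' (for_loop c d i body) (\<lambda>\<rho>. concat (map (\<lambda>v. F (\<rho>(i := v))) [0..<\<rho> c]))"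
proof -
  obtain f where f: "poly_bounded f" "runs_within Z body F f"
    using assms(1) unfolding efficient_def by blast
  show ?thesis
  proof (rule efficientI)
    show "poly_bounded (\<lambda>m. m * (f m + 30) + 10)" using f(1) by (intro poly_bounded_intros)
    fix \<rho> :: "nat \<Rightarrow> nat" and m assume z: "\<And>z. z \<in> Z' \<Longrightarrow> \<rho> z = 0" and m: "\<And>k. \<rho> k \<le> m"
    have "cnt (for_loop c d i body) \<rho> (\<rho> c * (f m + 30) + 10) \<rho> (concat (map (\<lambda>v. F (\<rho>(i := v))) [0..<\<rho> c]))"
    proof (rule cnt_for_loop[OF dist])
      fix v assume v: "v < \<rho> c"
      have "cnt body (\<rho>(d := \<rho> c - Suc v, i := v)) (f m) (\<rho>(d := \<rho> c - Suc v, i := v)) (F (\<rho>(d := \<rho> c - Suc v, i := v)))"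
      proof (rule runs_withinD[OF f(2)])
        fix k show "(\<rho>(d := \<rho> c - Suc v, i := v)) k \<le> m" using m[of k] m[of c] v by auto
      qed (use z assms in auto)
      moreover have "\<rho>(d := \<rho> c - Suc v, i := v) = (\<rho>(i := v))(d := \<rho> c - Suc v)"
        using dist by (auto simp: fun_eq_iff)
      then have "F (\<rho>(d := \<rho> c - Suc v, i := v)) = F (\<rho>(i := v))" by (simp only: indep)
      ultimately show "cnt body (\<rho>(d := \<rho> c - Suc v, i := v)) (f m) (\<rho>(d := \<rho> c - Suc v, i := v)) (F (\<rho>(i := v)))"
        by simp
    qed (use z assms in auto)
    then show "cnt (for_loop c d i body) \<rho> (m * (f m + 30) + 10) \<rho> (concat (map (\<lambda>v. F (\<rho>(i := v))) [0..<\<rho> c]))"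
      by (rule cnt_mono) (simp add: m)
  qed
qed

text \<open>Counter 11 is scratch space.\<close>

fun horner :: "nat \<Rightarrow> nat \<Rightarrow> nat list \<Rightarrow> bool cmd" where
  "horner a d [] = skip"
| "horner a d (c # cs) = horner a d cs ;; move_to d 11 ;; loop 11 (add_copy a d) ;; seqs (replicate c (incr d))"

lemma cnt_incrs: "d \<noteq> 0 \<Longrightarrow> cnt (seqs (replicate c (incr d))) \<rho> (3 * c + 1) (\<rho>(d := \<rho> d + c)) []"
proof (induction c arbitrary: \<rho>)
  case 0
  then show ?case using cnt_skip[of \<rho>] by (simp add: fun_upd_idem)
next
  case (Suc c)
  have "cnt (seqs (replicate c (incr d))) (\<rho>(d := Suc (\<rho> d))) (3 * c + 1) (\<rho>(d := \<rho> d + Suc c)) []"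
    using Suc.IH[OF Suc.prems, of "\<rho>(d := Suc (\<rho> d))"]
    by (simp only: fun_upd_same fun_upd_upd add_Suc add_Suc_right)
  then have "cnt (seqs (replicate (Suc c) (incr d))) \<rho> (3 * Suc c + 1) (\<rho>(d := \<rho> d + Suc c)) []"
    unfolding replicate_Suc seqs.simps by (rule cnt_Seq[OF cnt_incr[OF Suc.prems refl]]) simp_all
  then show ?case .
qed

text \<open>The intermediate results are themselves values of polynomials at
  \<open>\<rho> a\<close>, which keeps the cost polynomially bounded in
  \<open>\<rho> a\<close>.\<close>

lemma cnt_horner:
  assumes dist: "distinct [0, 8, 11, a, d]"
  shows "\<exists>f. poly_bounded f \<and> (\<forall>\<rho>. \<rho> 8 = 0 \<longrightarrow> \<rho> 11 = 0 \<longrightarrow> \<rho> d = 0 \<longrightarrow>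
     cnt (horner a d cs) \<rho> (f (\<rho> a)) (\<rho>(d := poly (Poly cs) (\<rho> a))) [])"
proof (induction cs)
  case Nil
  have "cnt skip \<rho> 1 (\<rho>(d := 0)) []" if "\<rho> d = 0" for \<rho>
    using cnt_skip[of \<rho>] fun_upd_idem[of \<rho> d 0] that by simp
  then have "cnt (horner a d []) \<rho> 1 (\<rho>(d := poly (Poly []) (\<rho> a))) []" if "\<rho> d = 0" for \<rho>
    using that by (simp only: horner.simps Poly.simps poly_0)
  then show ?case using poly_bounded_const[of 1] by blast
next
  case (Cons c cs)
  then obtain f where f: "poly_bounded f" and IH: "\<And>\<rho>. \<rho> 8 = 0 \<Longrightarrow> \<rho> 11 = 0 \<Longrightarrow> \<rho> d = 0 \<Longrightarrow>
     cnt (horner a d cs) \<rho> (f (\<rho> a)) (\<rho>(d := poly (Poly cs) (\<rho> a))) []" by blast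
  let ?v = "poly (Poly cs)"
  define g where "g A = f A + ((5 * ?v A + 1) + ((?v A * (13 * A + 3 + 3) + 1) + (3 * c + 1) + 1) + 1) + 1" for A
  have "poly_bounded g" unfolding g_def using f by (intro poly_bounded_intros)
  moreover have "cnt (horner a d (c # cs)) \<rho> (g (\<rho> a)) (\<rho>(d := poly (Poly (c # cs)) (\<rho> a))) []"
    if z: "\<rho> 8 = 0" "\<rho> 11 = 0" "\<rho> d = 0" for \<rho>
  proof -
    define A where "A = \<rho> a"
    have 1: "cnt (horner a d cs) \<rho> (f A) (\<rho>(d := ?v A)) []" using IH[OF z] by (simp add: A_def)
    have "\<rho>(d := ?v A, d := 0, 11 := 0 + ?v A) = \<rho>(11 := ?v A)"
      using dist z by (auto simp: fun_eq_iff)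
    then have 2: "cnt (move_to d 11) (\<rho>(d := ?v A)) (5 * ?v A + 1) (\<rho>(11 := ?v A)) []"
      using cnt_move_to[of d 11 "\<rho>(d := ?v A)"] dist z by simp
    \<comment> \<open>Multiplication by \<open>A\<close>: the old value, moved to counter 11, counts
      the additions of \<open>A\<close> to \<open>d\<close>.\<close>
    have "cnt (loop 11 (add_copy a d)) ((\<rho>(d := 0 * A))(11 := ?v A)) (?v A * (13 * A + 3 + 3) + 1)
        ((\<rho>(d := ?v A * A))(11 := 0)) (concat (map (\<lambda>_. []) [0..<?v A]))"
    proof (rule cnt_loop)
      fix u
      have "cnt (add_copy a d) ((\<rho>(d := u * A))(11 := ?v A - Suc u)) (13 * A + 3)
          (((\<rho>(d := u * A))(11 := ?v A - Suc u))(d := u * A + A)) []"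
        using cnt_add_copy[of a d "(\<rho>(d := u * A))(11 := ?v A - Suc u)"] dist z by (auto simp: A_def)
      moreover have "((\<rho>(d := u * A))(11 := ?v A - Suc u))(d := u * A + A) = (\<rho>(d := Suc u * A))(11 := ?v A - Suc u)"
        using dist by (auto simp: fun_eq_iff)
      ultimately show "cnt (add_copy a d) ((\<rho>(d := u * A))(11 := ?v A - Suc u)) (13 * A + 3)
          ((\<rho>(d := Suc u * A))(11 := ?v A - Suc u)) []" by simp
    qed simp
    moreover have "(\<rho>(d := 0 * A))(11 := ?v A) = \<rho>(11 := ?v A)" "(\<rho>(d := ?v A * A))(11 := 0) = \<rho>(d := ?v A * A)"
      using dist z by (auto simp: fun_eq_iff)
    ultimately have 3: "cnt (loop 11 (add_copy a d)) (\<rho>(11 := ?v A)) (?v A * (13 * A + 3 + 3) + 1) (\<rho>(d := ?v A * A)) []"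
      by simp
    have 4: "cnt (seqs (replicate c (incr d))) (\<rho>(d := ?v A * A)) (3 * c + 1) (\<rho>(d := ?v A * A + c)) []"
      using cnt_incrs[of d c "\<rho>(d := ?v A * A)"] dist by simp
    have "cnt (horner a d (c # cs)) \<rho> (g A) (\<rho>(d := ?v A * A + c)) []"
      unfolding horner.simps g_def
      by (rule cnt_Seq[OF 1 cnt_Seq[OF 2 cnt_Seq[OF 3 4 refl refl] refl refl] refl]) simp
    then show ?thesis by (simp add: A_def algebra_simps)
  qed
  ultimately show ?case by blast
qed

section \<open>Computing the reduction\<close>

text \<open>The six bits are the tags of \<open>And\<close> and \<open>Dia\<close>. In prefix
  notation a right-nested conjunction is just a sequence of such strings followed by its last
  member, so it can be printed one conjunct at a time.\<close>

definition psi_str :: "nat lit list \<Rightarrow> bool list" where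
  "psi_str P = [False, True, False, True, False, True] @ encode (conj_form P)"

definition clause_str :: "nat lit list \<Rightarrow> bool list" where
  "clause_str C = concat (map psi_str (block num C))"

lemma encode_dias_form:
  "encode (dias_form Ps) = concat (map psi_str Ps) @ encode (Dia (Pos (name_word [0])))"
  by (induction Ps) (auto simp: psi_str_def)

lemma encode_cnf_form:
  "encode (cnf_form Cs) = concat (map psi_str palette) @ concat (map clause_str Cs) @
     encode (Dia (Pos (name_word [0])))"
proof -
  have "concat (map psi_str (concat (map (block num) Cs))) = concat (map clause_str Cs)"
    by (induction Cs) (auto simp: clause_str_def)
  then show ?thesis unfolding cnf_form_def encode_dias_form by simp
qed

section \<open>Blocks over symbolic numbers\<close>

definition nconst :: "nat \<Rightarrow> nexp" where "nconst c = (c, [])"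

definition eval_lit :: "(nat \<Rightarrow> nat) \<Rightarrow> nexp lit \<Rightarrow> nat lit" where
  "eval_lit \<rho> l = (fst l, map (nexp_val \<rho>) (snd l))"

definition sym_lit :: "tlit \<Rightarrow> nexp lit" where
  "sym_lit = (\<lambda>(s, g, te, ie). (s, [nconst (to_nat g), te, ie]))"

lemma nexp_val_nconst [simp]: "nexp_val \<rho> (nconst c) = c"
  by (simp add: nconst_def)

lemma eval_sym_lit: "eval_lit \<rho> (sym_lit l) = inst_lit \<rho> l"
  by (cases l) (simp add: eval_lit_def sym_lit_def inst_lit_def)

lemma map_flat: "map (nexp_val \<rho>) (flat nconst ls) = flat num (map (eval_lit \<rho>) ls)"
  by (induction ls) (auto simp: flat_def eval_lit_def)

lemma map_lit_name: "map (nexp_val \<rho>) (lit_name nconst l) = lit_name num (eval_lit \<rho> l)"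
  by (cases l) (simp add: eval_lit_def)

lemma map_or_name: "map (nexp_val \<rho>) (or_name nconst ls) = or_name num (map (eval_lit \<rho>) ls)"
proof (cases "\<exists>l. ls = [l]")
  case True
  then show ?thesis by (auto simp: map_lit_name simp del: lit_name.simps)
next
  case False
  then have "or_name nconst ls = nconst 6 # flat nconst ls"
      "or_name num (map (eval_lit \<rho>) ls) = 6 # flat num (map (eval_lit \<rho>) ls)"
    by (cases ls rule: remdups_adj.cases; simp)+
  then show ?thesis by (simp add: map_flat)
qed

lemma map_gadget:
  "map (map (eval_lit \<rho>)) (gadget nconst pre l) = gadget num (map (eval_lit \<rho>) pre) (eval_lit \<rho> l)"
  using map_or_name[of \<rho> "pre @ [l]"] map_flat[of \<rho> "pre @ [l]"]
  by (simp add: gadget_def Let_def eval_lit_def[of _ "(_, _)"] map_or_name map_lit_name)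

lemma map_chain:
  "map (map (eval_lit \<rho>)) (chain nconst pre ls) = chain num (map (eval_lit \<rho>) pre) (map (eval_lit \<rho>) ls)"
  by (induction ls arbitrary: pre) (simp_all add: map_gadget)

text \<open>\<open>block\<close> looks at signs and at lengths of lists, never at the numbers in a
  name, so it commutes with their evaluation. The block of a clause template is therefore fixed
  together with the verifier, and only its numbers are printed at run time.\<close>

lemma map_block:
  assumes "C \<noteq> []"
  shows "map (map (eval_lit \<rho>)) (block nconst C) = block num (map (eval_lit \<rho>) C)"
proof -
  have "map (map (eval_lit \<rho>)) (declare_var nconst v) = declare_var num (map (nexp_val \<rho>) v)" for v
    by (simp add: declare_var_def eval_lit_def)
  then have "map (map (eval_lit \<rho>)) (concat (map (\<lambda>l. declare_var nconst (snd l)) C)) =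
      concat (map (\<lambda>l. declare_var num (snd l)) (map (eval_lit \<rho>) C))"
    by (induction C) (simp_all add: eval_lit_def)
  moreover have "[hd (map (eval_lit \<rho>) C)] = map (eval_lit \<rho>) [hd C]" "tl (map (eval_lit \<rho>) C) = map (eval_lit \<rho>) (tl C)"
    using assms by (simp_all add: hd_map map_tl)
  ultimately show ?thesis
    unfolding block_def by (simp add: map_chain eval_lit_def[of _ "(_, _)"] map_or_name)
qed

definition uses_counters :: "nat set \<Rightarrow> nexp lit \<Rightarrow> bool" where
  "uses_counters K l \<longleftrightarrow> (\<forall>e \<in> set (snd l). set (snd e) \<subseteq> K)"

lemma uses_counters_flat: "\<forall>l \<in> set ls. uses_counters K l \<Longrightarrow> e \<in> set (flat nconst ls) \<Longrightarrow> set (snd e) \<subseteq> K"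
  by (induction ls) (auto simp: flat_def uses_counters_def nconst_def split: prod.splits)

lemma uses_counters_or_name:
  assumes "\<forall>l \<in> set ls. uses_counters K l" "e \<in> set (or_name nconst ls)"
  shows "set (snd e) \<subseteq> K"
proof (cases "\<exists>s v. ls = [(s, v)]")
  case True
  then obtain s v where ls: "ls = [(s, v)]" by blast
  then have "e = nconst (if s then 2 else 3) \<or> e \<in> set v" using assms(2) by simp
  then show ?thesis using assms(1) ls by (auto simp: uses_counters_def nconst_def)
next
  case False
  then have "or_name nconst ls = nconst 6 # flat nconst ls"
    by (cases ls rule: remdups_adj.cases) auto
  then show ?thesis using assms(2) uses_counters_flat[OF assms(1), of e] by (auto simp: nconst_def)
qed

lemma uses_counters_gadget:
  assumes "\<forall>l \<in> set pre. uses_counters K l" "uses_counters K l" "P \<in> set (gadget nconst pre l)" "l' \<in> set P"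
  shows "uses_counters K l'"
proof -
  let ?f = "flat nconst (pre @ [l])"
  have all: "\<forall>l \<in> set (pre @ [l]). uses_counters K l" using assms by auto
  have "uses_counters K (s, lit_name nconst l)" for s
    using assms(2) by (cases l) (simp add: uses_counters_def nconst_def)
  moreover have "uses_counters K (s, or_name nconst pre)" "uses_counters K (s, or_name nconst (pre @ [l]))"
    "uses_counters K (s, nconst c # ?f)" for s c
    using uses_counters_or_name[OF assms(1)] uses_counters_or_name[OF all] uses_counters_flat[OF all]
    unfolding uses_counters_def snd_conv list.set by (blast, blast, simp add: nconst_def)
  moreover have "\<exists>s. l' = (s, lit_name nconst l) \<or> l' = (s, or_name nconst pre) \<or> l' = (s, or_name nconst (pre @ [l])) \<or>
      l' = (s, nconst 4 # ?f) \<or> l' = (s, nconst 5 # ?f)"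
    using assms(3,4) unfolding gadget_def Let_def by auto
  ultimately show ?thesis by blast
qed

text \<open>Knowing which counters occur serves three ends: printing keeps off the input stack and
  the scratch counter, loop bodies do not depend on the countdown, and all tapes are in
  range.\<close>

lemma uses_counters_block:
  assumes C: "\<forall>l \<in> set C. uses_counters K l" "C \<noteq> []" and "P \<in> set (block nconst C)" "l \<in> set P"
  shows "uses_counters K l"
proof -
  have ch: "\<forall>l \<in> set pre. uses_counters K l \<Longrightarrow> \<forall>l \<in> set ls. uses_counters K l \<Longrightarrow> P \<in> set (chain nconst pre ls) \<Longrightarrow>
      uses_counters K l" for pre ls
  proof (induction ls arbitrary: pre)
    case (Cons l' ls)
    then show ?case using uses_counters_gadget[of pre K l' P l] assms(4) Cons.IH[of "pre @ [l']"] by auto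
  qed simp
  from assms(3) consider l' where "l' \<in> set C" "P \<in> set (declare_var nconst (snd l'))"
    | "P \<in> set (chain nconst [hd C] (tl C))" | "P = [(False, [nconst 0]), (False, [nconst 1]), (False, or_name nconst C)]"
    unfolding block_def by auto
  then show ?thesis
  proof cases
    case 1
    have "\<forall>e \<in> set (snd l'). set (snd e) \<subseteq> K" using 1 C(1) unfolding uses_counters_def by blast
    moreover have "set (snd l) \<subseteq> {nconst 0, nconst 2, nconst 3} \<union> set (snd l')"
      using 1 assms(4) by (auto simp: declare_var_def)
    moreover have "\<forall>e \<in> {nconst 0, nconst 2, nconst 3}. set (snd e) \<subseteq> K" by (simp add: nconst_def)
    ultimately show ?thesis unfolding uses_counters_def by blast
  next
    case 2
    show ?thesis
    proof (rule ch[OF _ _ 2])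
      show "\<forall>l \<in> set [hd C]. uses_counters K l" "\<forall>l \<in> set (tl C). uses_counters K l"
        using C by (auto dest: list.set_sel(2))
    qed
  next
    case 3
    then have "l = (False, [nconst 0]) \<or> l = (False, [nconst 1]) \<or> l = (False, or_name nconst C)"
      using assms(4) by auto
    then show ?thesis using uses_counters_or_name[OF C(1)] unfolding uses_counters_def
      by (elim disjE) (simp_all add: nconst_def)
  qed
qed

definition emit_word :: "bool list \<Rightarrow> bool cmd" where
  "emit_word w = seqs (map Emit w)"

text \<open>In unary a sum is a concatenation: the summands are printed one after the other and the
  terminator once, without any addition.\<close>

definition emit_num :: "nexp \<Rightarrow> bool cmd" where
  "emit_num e = emit_word (replicate (2 * fst e) True) ;; seqs (map print (snd e)) ;; emit_word [True, False]"

definition emit_lit :: "nexp lit \<Rightarrow> bool cmd" where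
  "emit_lit l = emit_word (if fst l then [False, False, False] else [False, False, True]) ;;
     seqs (map emit_num (snd l)) ;; emit_word [False]"

fun emit_conj :: "nexp lit list \<Rightarrow> bool cmd" where
  "emit_conj [l] = emit_lit l"
| "emit_conj (l # ls) = emit_word [False, True, False] ;; emit_lit l ;; emit_conj ls"
| "emit_conj [] = skip"

definition emit_psi :: "nexp lit list \<Rightarrow> bool cmd" where
  "emit_psi P = emit_word [False, True, False, True, False, True] ;; emit_conj P"

definition emit_clause :: "tlit list \<Rightarrow> bool cmd" where
  "emit_clause C = seqs (map emit_psi (block nconst (map sym_lit C)))"

definition emit_clauses :: "tlit list list \<Rightarrow> bool cmd" where
  "emit_clauses Cs = seqs (map emit_clause Cs)"

lemma efficient_emit_word: "efficient Z (emit_word w) (\<lambda>_. w)"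
  using efficient_seqs[of w Z Emit "\<lambda>b _. [b]"] efficient_Emit by (simp add: emit_word_def)

definition num_str :: "nat \<Rightarrow> bool list" where
  "num_str m = replicate (2 * m) True @ [True, False]"

lemma encode_name_word: "encode_var (name_word ms) = concat (map num_str ms) @ [False]"
proof (induction ms)
  case (Cons m ms)
  have "encode_var (replicate m True @ False # w) = num_str m @ encode_var w" for w
    by (induction m) (auto simp: num_str_def)
  then show ?case using Cons by simp
qed simp

lemma efficient_emit_num:
  assumes "set (snd e) \<inter> {0, 8} = {}"
  shows "efficient {8} (emit_num e) (\<lambda>\<rho>. num_str (nexp_val \<rho> e))"
proof -
  have 1: "efficient {8} (seqs (map print (snd e))) (\<lambda>\<rho>. concat (map (\<lambda>c. replicate (2 * \<rho> c) True) (snd e)))"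
  proof (rule efficient_seqs)
    fix c assume "c \<in> set (snd e)"
    then have "c \<notin> {0, 8}" using assms unfolding disjoint_iff by simp
    then have "c \<noteq> 0" "c \<noteq> 8" by simp_all
    then show "efficient {8} (print c) (\<lambda>\<rho>. replicate (2 * \<rho> c) True)" by (rule efficient_print) simp
  qed
  have 2: "concat (map (\<lambda>c. replicate (2 * \<rho> c) True) cs) = replicate (2 * sum_list (map \<rho> cs)) True" for cs \<rho>
    by (induction cs) (simp_all add: replicate_add distrib_left)
  show ?thesis
    unfolding emit_num_def
    by (rule efficient_Seq[OF efficient_emit_word efficient_Seq[OF 1 efficient_emit_word refl]])
      (simp add: 2 num_str_def nexp_val_def replicate_add distrib_left)
qed

lemma efficient_emit_lit:
  assumes "uses_counters K l" "K \<inter> {0, 8} = {}"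
  shows "efficient {8} (emit_lit l) (\<lambda>\<rho>. encode (lit_form (eval_lit \<rho> l)))"
proof -
  have 1: "efficient {8} (seqs (map emit_num (snd l))) (\<lambda>\<rho>. concat (map (\<lambda>e. num_str (nexp_val \<rho> e)) (snd l)))"
  proof (rule efficient_seqs, rule efficient_emit_num)
    fix e assume "e \<in> set (snd l)"
    then show "set (snd e) \<inter> {0, 8} = {}" using assms unfolding uses_counters_def by blast
  qed
  show ?thesis
    unfolding emit_lit_def
    by (rule efficient_Seq[OF efficient_emit_word efficient_Seq[OF 1 efficient_emit_word refl]])
      (simp add: eval_lit_def encode_name_word comp_def)
qed

lemma efficient_emit_conj:
  assumes "\<forall>l \<in> set P. uses_counters K l" "K \<inter> {0, 8} = {}" "P \<noteq> []"
  shows "efficient {8} (emit_conj P) (\<lambda>\<rho>. encode (conj_form (map (eval_lit \<rho>) P)))"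
  using assms(1,3)
proof (induction P rule: emit_conj.induct)
  case (1 l)
  then show ?case using efficient_emit_lit[OF _ assms(2)] by simp
next
  case (2 l l' ls)
  show ?case
    unfolding emit_conj.simps
    by (rule efficient_Seq[OF efficient_emit_word efficient_Seq[OF efficient_emit_lit[OF _ assms(2)] "2.IH" refl]])
      (use "2.prems" in simp_all)
qed simp

lemma efficient_emit_psi:
  assumes "\<forall>l \<in> set P. uses_counters K l" "K \<inter> {0, 8} = {}" "P \<noteq> []"
  shows "efficient {8} (emit_psi P) (\<lambda>\<rho>. psi_str (map (eval_lit \<rho>) P))"
  unfolding emit_psi_def
  by (rule efficient_Seq[OF efficient_emit_word efficient_emit_conj[OF assms]]) (simp add: psi_str_def)

definition clause_uses :: "nat set \<Rightarrow> tlit list \<Rightarrow> bool" where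
  "clause_uses K C \<longleftrightarrow> C \<noteq> [] \<and> (\<forall>(s, g, te, ie) \<in> set C. set (snd te) \<subseteq> K \<and> set (snd ie) \<subseteq> K)"

lemma clause_usesD:
  "clause_uses K C \<Longrightarrow> (s, g, te, ie) \<in> set C \<Longrightarrow> set (snd te) \<subseteq> K \<and> set (snd ie) \<subseteq> K"
  unfolding clause_uses_def by fast

lemma clause_uses_sym:
  assumes "clause_uses K C"
  shows "\<forall>l \<in> set (map sym_lit C). uses_counters K l"
proof
  fix l assume "l \<in> set (map sym_lit C)"
  then obtain s g te ie where l: "(s, g, te, ie) \<in> set C" "l = (s, [nconst (to_nat g), te, ie])"
    by (auto simp: sym_lit_def)
  then show "uses_counters K l"
    using clause_usesD[OF assms l(1)] by (simp add: uses_counters_def nconst_def)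
qed

lemma efficient_emit_clause:
  assumes "clause_uses K C" "K \<inter> {0, 8} = {}"
  shows "efficient {8} (emit_clause C) (\<lambda>\<rho>. clause_str (map (inst_lit \<rho>) C))"
proof -
  have ne: "map sym_lit C \<noteq> []" using assms(1) by (simp add: clause_uses_def)
  have "efficient {8} (emit_clause C) (\<lambda>\<rho>. concat (map (\<lambda>P. psi_str (map (eval_lit \<rho>) P)) (block nconst (map sym_lit C))))"
    unfolding emit_clause_def
  proof (rule efficient_seqs, rule efficient_emit_psi[OF _ assms(2)])
    fix P assume P: "P \<in> set (block nconst (map sym_lit C))"
    show "\<forall>l \<in> set P. uses_counters K l"
      using uses_counters_block[OF clause_uses_sym[OF assms(1)] ne P] by blast
    show "P \<noteq> []" using P nonempty_block[of nconst "map sym_lit C"] by metis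
  qed
  moreover have "concat (map (\<lambda>P. psi_str (map (eval_lit \<rho>) P)) (block nconst (map sym_lit C))) = clause_str (map (inst_lit \<rho>) C)" for \<rho>
  proof -
    have "block num (map (inst_lit \<rho>) C) = map (map (eval_lit \<rho>)) (block nconst (map sym_lit C))"
      unfolding map_block[OF ne] by (simp add: comp_def eval_sym_lit)
    then show ?thesis by (simp add: clause_str_def comp_def)
  qed
  ultimately show ?thesis by simp
qed

text \<open>Counters 9 and 10, on which the loops count down, are outside this set;
  \<open>inst_indep\<close> then applies to them.\<close>

abbreviation "tableau_counters \<equiv> {2, 3, 5, 6, 7 :: nat}"

lemma efficient_emit_clauses:
  assumes "\<forall>C \<in> set Cs. clause_uses tableau_counters C"
  shows "efficient {8} (emit_clauses Cs) (\<lambda>\<rho>. concat (map clause_str (inst \<rho> Cs)))"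
proof -
  have "efficient {8} (emit_clauses Cs) (\<lambda>\<rho>. concat (map (\<lambda>C. clause_str (map (inst_lit \<rho>) C)) Cs))"
    unfolding emit_clauses_def
    by (rule efficient_seqs, rule efficient_emit_clause[where K = tableau_counters]) (use assms in auto)
  then show ?thesis by (simp add: inst_def comp_def)
qed

lemma inst_indep:
  assumes "\<forall>C \<in> set Cs. clause_uses K C" "d \<notin> K"
  shows "inst (\<rho>(d := v)) Cs = inst \<rho> Cs"
proof -
  have val: "nexp_val (\<rho>(d := v)) e = nexp_val \<rho> e" if "set (snd e) \<subseteq> K" for e
  proof -
    have "map (\<rho>(d := v)) (snd e) = map \<rho> (snd e)" using that assms(2) by (intro map_cong) auto
    then show ?thesis by (simp only: nexp_val_def)
  qed
  show ?thesis unfolding inst_def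
  proof (intro map_cong refl)
    fix C l assume C: "C \<in> set Cs" and l: "l \<in> set C"
    obtain s g te ie where "l = (s, g, te, ie)" by (cases l)
    then show "inst_lit (\<rho>(d := v)) l = inst_lit \<rho> l"
      using clause_usesD[OF bspec[OF assms(1) C]] l val unfolding inst_lit_def by simp
  qed
qed

lemma clause_uses_implication:
  "clause_uses K (implication Ps c) \<longleftrightarrow> (\<forall>(g, te, ie) \<in> set (c # Ps). set (snd te) \<subseteq> K \<and> set (snd ie) \<subseteq> K)"
  by (auto simp: clause_uses_def implication_def split: prod.splits)

lemma clause_uses_tableau:
  "clause_uses tableau_counters (input_clause b)"
  "clause_uses tableau_counters (start_clause M)"
  "\<forall>C \<in> set (blank_clauses k). clause_uses tableau_counters C"
  "\<forall>C \<in> set guess_clauses. clause_uses tableau_counters C"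
  "\<forall>C \<in> set (accept_clauses M). clause_uses tableau_counters C"
  "\<forall>C \<in> set (time_clauses M). clause_uses tableau_counters C"
  "\<forall>C \<in> set (cell_clauses M). clause_uses tableau_counters C"
proof -
  show "clause_uses tableau_counters (input_clause b)" "clause_uses tableau_counters (start_clause M)"
    by (simp_all add: input_clause_def start_clause_def clause_uses_def)
  show "\<forall>C \<in> set (blank_clauses k). clause_uses tableau_counters C"
    by (auto simp: blank_clauses_def clause_uses_def)
  show "\<forall>C \<in> set guess_clauses. clause_uses tableau_counters C"
    by (simp add: guess_clauses_def clause_uses_implication) (simp add: clause_uses_def)
  show "\<forall>C \<in> set (accept_clauses M). clause_uses tableau_counters C"
    by (auto simp: accept_clauses_def clause_uses_def)
  have "\<forall>C \<in> set (head_rules M q ss j). clause_uses tableau_counters C" for q ss j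
  proof (cases "snd (next_actions M q ss) ! j")
    case (Pair w m)
    then show ?thesis by (cases m) (auto simp: head_rules_def clause_uses_implication Let_def)
  qed
  then show "\<forall>C \<in> set (time_clauses M). clause_uses tableau_counters C"
    by (auto simp: time_clauses_def control_rules_def clause_uses_implication)
  have "\<forall>C \<in> set (cell_rules M q ss j s). clause_uses tableau_counters C" for q ss j s
    by (cases "snd (snd (next_actions M q ss) ! j)") (simp_all add: cell_rules_def clause_uses_implication Let_def)
  then show "\<forall>C \<in> set (cell_clauses M). clause_uses tableau_counters C"
    by (auto simp: cell_clauses_def)
qed

section \<open>The program of the reduction\<close>

definition read_input :: "bool cmd" where
  "read_input = While (\<lambda>t. t 0 \<noteq> None)
     (Ite (\<lambda>t. t 0 = Some True) (emit_clauses [input_clause True]) (emit_clauses [input_clause False]) ;;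
      Pop 0 ;; incr 2)"

definition emit_tableau :: "tm \<Rightarrow> bool cmd" where
  "emit_tableau M = emit_clauses [start_clause M] ;;
     for_loop 5 10 7 (emit_clauses (blank_clauses (num_tapes M))) ;;
     for_loop 3 10 7 (emit_clauses guess_clauses) ;;
     for_loop 5 9 6 (emit_clauses (time_clauses M) ;; for_loop 5 10 7 (emit_clauses (cell_clauses M))) ;;
     emit_clauses (accept_clauses M) ;;
     emit_word (encode (Dia (Pos (name_word [0]))))"

definition reduction :: "tm \<Rightarrow> nat poly \<Rightarrow> nat poly \<Rightarrow> bool cmd" where
  "reduction M p T = emit_word (concat (map psi_str palette)) ;; read_input ;;
     horner 2 3 (coeffs p) ;; add_copy 2 4 ;; add_copy 3 4 ;; horner 4 5 (coeffs T) ;; emit_tableau M"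

lemma concat_map_concat:
  "concat (map f (concat xss)) = concat (map (\<lambda>xs. concat (map f xs)) xss)"
  by (induction xss) simp_all

definition tableau_tail :: "tm \<Rightarrow> (nat \<Rightarrow> nat) \<Rightarrow> nat lit list list" where
  "tableau_tail M \<rho> = inst \<rho> [start_clause M] @
     concat (map (\<lambda>i. inst (\<rho>(7 := i)) (blank_clauses (num_tapes M))) [0..<\<rho> 5]) @
     concat (map (\<lambda>i. inst (\<rho>(7 := i)) guess_clauses) [0..<\<rho> 3]) @
     concat (map (\<lambda>t. inst (\<rho>(6 := t)) (time_clauses M) @
       concat (map (\<lambda>i. inst (\<rho>(6 := t, 7 := i)) (cell_clauses M)) [0..<\<rho> 5])) [0..<\<rho> 5]) @
     inst \<rho> (accept_clauses M)"

lemma tableau_split: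
  "tableau M x p b = concat (map (\<lambda>i. inst ((\<lambda>_. 0)(2 := i)) [input_clause (x ! i)]) [0..<length x]) @
     tableau_tail M (counters (length x) p b)"
  by (simp add: tableau_def tableau_tail_def Let_def)

lemma efficient_tableau_loop:
  assumes "\<forall>C \<in> set Cs. clause_uses tableau_counters C" "c = 3 \<or> c = 5" "{7, 8, 10} \<subseteq> Z"
  shows "efficient Z (for_loop c 10 7 (emit_clauses Cs))
     (\<lambda>\<rho>. concat (map clause_str (concat (map (\<lambda>i. inst (\<rho>(7 := i)) Cs) [0..<\<rho> c]))))"
proof -
  have "efficient Z (for_loop c 10 7 (emit_clauses Cs))
     (\<lambda>\<rho>. concat (map (\<lambda>i. concat (map clause_str (inst (\<rho>(7 := i)) Cs))) [0..<\<rho> c]))"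
  proof (rule efficient_for_loop[OF efficient_emit_clauses[OF assms(1)]])
    show "concat (map clause_str (inst (\<rho>(10 := r)) Cs)) = concat (map clause_str (inst \<rho> Cs))" for \<rho> r
      using inst_indep[OF assms(1), of 10 \<rho> r] by simp
  qed (use assms(2,3) in auto)
  then show ?thesis by (simp only: concat_map_concat map_map comp_def)
qed

text \<open>The body of the time loop requires only 7, 8 and 10 to be zero, which leaves 6 and 9 to
  the loop itself.\<close>

lemma efficient_emit_tableau:
  "efficient {6, 7, 8, 9, 10} (emit_tableau M)
     (\<lambda>\<rho>. concat (map clause_str (tableau_tail M \<rho>)) @ encode (Dia (Pos (name_word [0]))))"
proof -
  let ?Z = "{6, 7, 8, 9, 10 :: nat}"
  let ?s = "\<lambda>Cs. concat (map clause_str Cs)"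
  have emit: "efficient Z (emit_clauses Cs) (\<lambda>\<rho>. ?s (inst \<rho> Cs))"
    if "\<forall>C \<in> set Cs. clause_uses tableau_counters C" "8 \<in> Z" for Cs Z
    using that by (intro efficient_weaken[OF efficient_emit_clauses]) auto
  have start: "\<forall>C \<in> set [start_clause M]. clause_uses tableau_counters C" using clause_uses_tableau(2) by simp
  define G where "G \<rho> = inst \<rho> (time_clauses M) @ concat (map (\<lambda>i. inst (\<rho>(7 := i)) (cell_clauses M)) [0..<\<rho> 5])" for \<rho>
  have body: "efficient {7, 8, 10} (emit_clauses (time_clauses M) ;; for_loop 5 10 7 (emit_clauses (cell_clauses M))) (\<lambda>\<rho>. ?s (G \<rho>))"
    by (rule efficient_Seq[OF emit[OF clause_uses_tableau(6)] efficient_tableau_loop[OF clause_uses_tableau(7)]])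
      (simp_all add: G_def)
  have indep: "G (\<rho>(9 := r)) = G \<rho>" for \<rho> r
  proof -
    have "inst (\<rho>(9 := r, 7 := i)) (cell_clauses M) = inst (\<rho>(7 := i)) (cell_clauses M)" for i
      using inst_indep[OF clause_uses_tableau(7), of 9 "\<rho>(7 := i)" r M] by (simp add: fun_upd_twist)
    then show ?thesis using inst_indep[OF clause_uses_tableau(6), of 9 \<rho> r M] by (simp add: G_def)
  qed
  have time: "efficient ?Z (for_loop 5 9 6 (emit_clauses (time_clauses M) ;; for_loop 5 10 7 (emit_clauses (cell_clauses M))))
     (\<lambda>\<rho>. concat (map (\<lambda>t. ?s (G (\<rho>(6 := t)))) [0..<\<rho> 5]))"
    by (rule efficient_for_loop[OF body]) (use indep in auto)
  have eq: "?s (tableau_tail M \<rho>) @ w = ?s (inst \<rho> [start_clause M]) @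
      (?s (concat (map (\<lambda>i. inst (\<rho>(7 := i)) (blank_clauses (num_tapes M))) [0..<\<rho> 5])) @
      (?s (concat (map (\<lambda>i. inst (\<rho>(7 := i)) guess_clauses) [0..<\<rho> 3])) @
      (concat (map (\<lambda>t. ?s (G (\<rho>(6 := t)))) [0..<\<rho> 5]) @ (?s (inst \<rho> (accept_clauses M)) @ w))))" for \<rho> w
  proof -
    have "concat (map (\<lambda>t. ?s (G (\<rho>(6 := t)))) [0..<\<rho> 5]) = ?s (concat (map (\<lambda>t. G (\<rho>(6 := t))) [0..<\<rho> 5]))"
      by (simp only: concat_map_concat map_map comp_def)
    moreover have "tableau_tail M \<rho> = inst \<rho> [start_clause M] @
      (concat (map (\<lambda>i. inst (\<rho>(7 := i)) (blank_clauses (num_tapes M))) [0..<\<rho> 5]) @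
      (concat (map (\<lambda>i. inst (\<rho>(7 := i)) guess_clauses) [0..<\<rho> 3]) @
      (concat (map (\<lambda>t. G (\<rho>(6 := t))) [0..<\<rho> 5]) @ inst \<rho> (accept_clauses M))))"
      by (simp add: tableau_tail_def G_def)
    ultimately show ?thesis by (simp only: map_append concat_append append_assoc)
  qed
  show ?thesis
    unfolding emit_tableau_def
    by (rule efficient_Seq[OF emit[OF start] efficient_Seq[OF efficient_tableau_loop[OF clause_uses_tableau(3)]
        efficient_Seq[OF efficient_tableau_loop[OF clause_uses_tableau(4)] efficient_Seq[OF time
        efficient_Seq[OF emit[OF clause_uses_tableau(5)] efficient_emit_word refl] refl] refl] refl] eq]) auto
qed

text \<open>Stated for \<open>exec\<close>, because \<open>cnt\<close> presupposes that stack 0 is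
  unchanged. The offset \<open>i\<close> counts the bits already read.\<close>

lemma exec_read_input:
  assumes "\<And>b v. v \<le> m \<Longrightarrow> cnt (emit_clauses [input_clause b]) ((\<lambda>_. 0)(2 := v)) N ((\<lambda>_. 0)(2 := v))
      (concat (map clause_str (inst ((\<lambda>_. 0)(2 := v)) [input_clause b])))"
  shows "i + length x \<le> m \<Longrightarrow> exec read_input (unary ((\<lambda>_. 0)(2 := i)) x) out (length x * (N + 7) + 1) (unary ((\<lambda>_. 0)(2 := i + length x)) [])
     (out @ concat (map (\<lambda>j. concat (map clause_str (inst ((\<lambda>_. 0)(2 := i + j)) [input_clause (x ! j)]))) [0..<length x]))"
proof (induction x arbitrary: i out)
  case Nil
  then show ?case unfolding read_input_def by (auto intro!: exec_while_end simp: tops_unary)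
next
  case (Cons b x)
  let ?\<rho> = "\<lambda>i. (\<lambda>_. 0 :: nat)(2 := i)"
  let ?s = "\<lambda>i b. concat (map clause_str (inst (?\<rho> i) [input_clause b]))"
  let ?e = "Ite (\<lambda>t. t 0 = Some True) (emit_clauses [input_clause True]) (emit_clauses [input_clause False])"
  have 1: "exec ?e (unary (?\<rho> i) (b # x)) out (N + 1) (unary (?\<rho> i) (b # x)) (out @ ?s i b)"
  proof (rule exec_ite[where m = N])
    have *: "exec (emit_clauses [input_clause b]) (unary (?\<rho> i) (b # x)) out N (unary (?\<rho> i) (b # x)) (out @ ?s i b)"
      using assms[of i b] Cons.prems unfolding cnt_def by simp
    { assume "tops (unary (?\<rho> i) (b # x)) 0 = Some True"
      then have b by (simp add: tops_unary)
      then show "exec (emit_clauses [input_clause True]) (unary (?\<rho> i) (b # x)) out N (unary (?\<rho> i) (b # x)) (out @ ?s i b)"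
        using * by simp }
    { assume "\<not> tops (unary (?\<rho> i) (b # x)) 0 = Some True"
      then have "\<not> b" by (simp add: tops_unary)
      then show "exec (emit_clauses [input_clause False]) (unary (?\<rho> i) (b # x)) out N (unary (?\<rho> i) (b # x)) (out @ ?s i b)"
        using * by simp }
  qed simp
  have 2: "exec (Pop 0) (unary (?\<rho> i) (b # x)) out' 1 (unary (?\<rho> i) x) out'" for out'
    by (rule exec_pop) (auto simp: unary_def fun_eq_iff)
  have 3: "exec (incr 2) (unary (?\<rho> i) x) out' 2 (unary (?\<rho> (Suc i)) x) out'" for out'
    by (rule exec_push) (auto simp: unary_def fun_eq_iff)
  have body: "exec (?e ;; Pop 0 ;; incr 2) (unary (?\<rho> i) (b # x)) out (N + 6) (unary (?\<rho> (Suc i)) x) (out @ ?s i b)"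
    by (rule exec_seq[OF 1 exec_seq[OF 2 3 order_refl]]) simp
  have rest: "exec read_input (unary (?\<rho> (Suc i)) x) (out @ ?s i b) (length x * (N + 7) + 1) (unary (?\<rho> (Suc i + length x)) [])
      ((out @ ?s i b) @ concat (map (\<lambda>j. ?s (Suc i + j) (x ! j)) [0..<length x]))"
    by (rule Cons.IH) (use Cons.prems in simp)
  have split: "concat (map (\<lambda>j. ?s (i + j) ((b # x) ! j)) [0..<length (b # x)]) =
      ?s i b @ concat (map (\<lambda>j. ?s (Suc i + j) (x ! j)) [0..<length x])"
  proof -
    have "[0..<length (b # x)] = 0 # map Suc [0..<length x]"
      by (simp add: upt_conv_Cons map_Suc_upt del: upt_Suc)
    then show ?thesis by (simp only: list.map map_map concat.simps comp_def nth_Cons_0 nth_Cons_Suc add_0_right add_Suc_right add_Suc)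
  qed
  have len: "i + length (b # x) = Suc i + length x" by simp
  show ?case
    unfolding split len append_assoc[symmetric]
  proof (subst read_input_def, rule exec_while[OF _ body rest[unfolded read_input_def]])
    show "tops (unary (?\<rho> i) (b # x)) 0 \<noteq> None" by (simp add: tops_unary)
  qed simp
qed

section \<open>Tapes used by the reduction\<close>

lemma uses_skip [simp]: "uses_tapes k om skip \<longleftrightarrow> 0 < k"
  by (simp add: skip_def)

lemma uses_seqs: "0 < k \<Longrightarrow> uses_tapes k om (seqs es) \<longleftrightarrow> (\<forall>e \<in> set es. uses_tapes k om e)"
  by (induction es) auto

lemma uses_emit_word: "0 < k \<Longrightarrow> uses_tapes k True (emit_word w)"
  by (auto simp: emit_word_def uses_seqs)

lemma uses_basic:
  "uses_tapes k True (loop j c) \<longleftrightarrow> j < k \<and> j \<noteq> 1 \<and> uses_tapes k True c"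
  "uses_tapes k True (move_to a b) \<longleftrightarrow> a < k \<and> a \<noteq> 1 \<and> b < k \<and> b \<noteq> 1"
  "uses_tapes k True (add_copy a b) \<longleftrightarrow> a < k \<and> a \<noteq> 1 \<and> b < k \<and> b \<noteq> 1 \<and> 8 < k"
  "uses_tapes k True (print a) \<longleftrightarrow> a < k \<and> a \<noteq> 1 \<and> 8 < k"
  by (auto simp: loop_def move_to_def add_copy_def print_def)

lemma uses_for_loop:
  "uses_tapes k True (for_loop c d i e) \<longleftrightarrow>
     c < k \<and> c \<noteq> 1 \<and> d < k \<and> d \<noteq> 1 \<and> i < k \<and> i \<noteq> 1 \<and> 8 < k \<and> uses_tapes k True e"
  by (auto simp: for_loop_def uses_basic)

lemma uses_emit_lit:
  assumes "uses_counters tableau_counters l"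
  shows "uses_tapes 12 True (emit_lit l)"
proof -
  have "uses_tapes 12 True (emit_num e)" if "e \<in> set (snd l)" for e
  proof -
    have "set (snd e) \<subseteq> tableau_counters" using assms that unfolding uses_counters_def by blast
    then have "\<forall>c \<in> set (snd e). uses_tapes 12 True (print c)" unfolding uses_basic by auto
    then show ?thesis by (simp add: emit_num_def uses_seqs uses_emit_word)
  qed
  then show ?thesis by (simp add: emit_lit_def uses_seqs uses_emit_word)
qed

lemma uses_emit_clauses:
  assumes "\<forall>C \<in> set Cs. clause_uses tableau_counters C"
  shows "uses_tapes 12 True (emit_clauses Cs)"
proof -
  have conj: "uses_tapes 12 True (emit_conj P)" if "\<forall>l \<in> set P. uses_counters tableau_counters l" for P
    using that by (induction P rule: emit_conj.induct) (simp_all add: uses_emit_lit uses_emit_word)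
  have "uses_tapes 12 True (emit_clause C)" if "C \<in> set Cs" for C
  proof -
    have C: "clause_uses tableau_counters C" using assms that by blast
    then have ne: "map sym_lit C \<noteq> []" by (simp add: clause_uses_def)
    have "uses_tapes 12 True (emit_psi P)" if "P \<in> set (block nconst (map sym_lit C))" for P
      using conj uses_counters_block[OF clause_uses_sym[OF C] ne that] by (simp add: emit_psi_def uses_emit_word)
    then show ?thesis by (simp add: emit_clause_def uses_seqs)
  qed
  then show ?thesis by (simp add: emit_clauses_def uses_seqs)
qed

lemma uses_horner:
  "a < 12 \<Longrightarrow> a \<noteq> 1 \<Longrightarrow> d < 12 \<Longrightarrow> d \<noteq> 1 \<Longrightarrow> uses_tapes 12 True (horner a d cs)"
  by (induction cs) (auto simp: uses_seqs uses_basic)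

lemma uses_reduction: "uses_tapes 12 True (reduction M p T)"
proof -
  have "uses_tapes 12 True (emit_clauses [input_clause b])" for b
    by (rule uses_emit_clauses) (simp add: clause_uses_tableau)
  then have "uses_tapes 12 True read_input" by (simp add: read_input_def)
  moreover have "uses_tapes 12 True (emit_clauses [start_clause M])"
    by (rule uses_emit_clauses) (simp add: clause_uses_tableau)
  then have "uses_tapes 12 True (emit_tableau M)"
    by (simp add: emit_tableau_def uses_for_loop uses_emit_clauses clause_uses_tableau uses_emit_word)
  ultimately show ?thesis
    by (simp add: reduction_def uses_emit_word uses_horner uses_basic)
qed

theorem poly_time_reduction:
  "poly_time_computable (\<lambda>x. encode (cnf_form (tableau M x (poly p (length x)) (poly T (length x + poly p (length x))))))"
proof -
  define b where "b n = poly T (n + poly p n)" for n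
  \<comment> \<open>A common bound of all counters while the clauses are printed: the summands are
    counters 2, 3, 4 and 5.\<close>
  define m where "m n = n + poly p n + (n + poly p n) + b n" for n
  have b: "poly_bounded b" unfolding b_def
    by (rule poly_bounded_compose[OF poly_bounded_poly]) (intro poly_bounded_intros)
  then have m: "poly_bounded m" unfolding m_def by (intro poly_bounded_intros)
  let ?s = "\<lambda>Cs. concat (map clause_str Cs)"
  let ?pal = "concat (map psi_str palette)" and ?fin = "encode (Dia (Pos (name_word [0])))"
  have "efficient {8} (emit_clauses [input_clause c]) (\<lambda>\<rho>. ?s (inst \<rho> [input_clause c]))" for c
    by (rule efficient_emit_clauses) (simp add: clause_uses_tableau)
  then obtain g where g: "\<And>c. poly_bounded (g c)"
      "\<And>c. runs_within {8} (emit_clauses [input_clause c]) (\<lambda>\<rho>. ?s (inst \<rho> [input_clause c])) (g c)"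
    unfolding efficient_def by metis
  \<comment> \<open>The clauses for the two bits come from different programs; the sum covers
    both.\<close>
  define N where "N n = g True n + g False n" for n
  have N: "poly_bounded N" unfolding N_def using g(1) by (intro poly_bounded_intros)
  have input: "cnt (emit_clauses [input_clause c]) ((\<lambda>_. 0)(2 := v)) (N n) ((\<lambda>_. 0)(2 := v))
      (?s (inst ((\<lambda>_. 0)(2 := v)) [input_clause c]))" if "v \<le> n" for c v n
  proof (rule cnt_mono)
    show "cnt (emit_clauses [input_clause c]) ((\<lambda>_. 0)(2 := v)) (g c n) ((\<lambda>_. 0)(2 := v))
      (?s (inst ((\<lambda>_. 0)(2 := v)) [input_clause c]))"
      by (rule runs_withinD[OF g(2)]) (use that in auto)
    show "g c n \<le> N n" by (cases c) (simp_all add: N_def)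
  qed
  \<comment> \<open>The palette is printed while all counters are zero, so its cost
    \<open>f0 0\<close> is a constant.\<close>
  obtain f0 where f0: "runs_within {} (emit_word ?pal) (\<lambda>_. ?pal) f0"
    using efficient_emit_word[of "{}" ?pal] unfolding efficient_def by blast
  obtain f3 where f3: "poly_bounded f3" "\<And>\<rho>. \<rho> 8 = 0 \<Longrightarrow> \<rho> 11 = 0 \<Longrightarrow> \<rho> 3 = 0 \<Longrightarrow>
     cnt (horner 2 3 (coeffs p)) \<rho> (f3 (\<rho> 2)) (\<rho>(3 := poly p (\<rho> 2))) []"
    using cnt_horner[of 2 3 "coeffs p"] unfolding Poly_coeffs by auto
  obtain f6 where f6: "poly_bounded f6" "\<And>\<rho>. \<rho> 8 = 0 \<Longrightarrow> \<rho> 11 = 0 \<Longrightarrow> \<rho> 5 = 0 \<Longrightarrow>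
     cnt (horner 4 5 (coeffs T)) \<rho> (f6 (\<rho> 4)) (\<rho>(5 := poly T (\<rho> 4))) []"
    using cnt_horner[of 4 5 "coeffs T"] unfolding Poly_coeffs by auto
  obtain f7 where f7: "poly_bounded f7"
      "runs_within {6, 7, 8, 9, 10} (emit_tableau M) (\<lambda>\<rho>. ?s (tableau_tail M \<rho>) @ ?fin) f7"
    using efficient_emit_tableau[of M] unfolding efficient_def by blast
  define rest where "rest n = f3 n + ((13 * n + 3) + ((13 * poly p n + 3) + (f6 (n + poly p n) + f7 (m n) + 1) + 1) + 1) + 1" for n
  define total where "total n = f0 0 + ((n * (N n + 7) + 1) + rest n + 1) + 1" for n
  have "poly_bounded (\<lambda>n. f7 (m n))" "poly_bounded (\<lambda>n. f6 (n + poly p n))"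
    by (rule poly_bounded_compose[OF f7(1) m], rule poly_bounded_compose[OF f6(1)]) (intro poly_bounded_intros)
  then have "poly_bounded rest" unfolding rest_def using f3(1) by (intro poly_bounded_intros)
  then have "poly_bounded total" unfolding total_def using N by (intro poly_bounded_intros)
  then obtain q :: "nat poly" where q: "\<And>n. total n \<le> poly q n" unfolding poly_bounded_def by blast
  show ?thesis
  proof (rule poly_time_computableI[OF _ uses_reduction[of M p T]])
    fix x :: "bool list"
    define n where "n = length x"
    define P where "P = poly p n"
    let ?\<rho> = "(\<lambda>_. 0 :: nat)(2 := n)"
    let ?rest = "horner 2 3 (coeffs p) ;; add_copy 2 4 ;; add_copy 3 4 ;; horner 4 5 (coeffs T) ;; emit_tableau M"
    let ?c = "counters n P (b n)"
    have 3: "cnt (horner 2 3 (coeffs p)) ?\<rho> (f3 n) (?\<rho>(3 := P)) []"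
      using f3(2)[of ?\<rho>] by (simp add: P_def)
    have 4: "cnt (add_copy 2 4) (?\<rho>(3 := P)) (13 * n + 3) (?\<rho>(3 := P, 4 := n)) []"
      using cnt_add_copy[of 2 4 "?\<rho>(3 := P)"] by simp
    have 5: "cnt (add_copy 3 4) (?\<rho>(3 := P, 4 := n)) (13 * P + 3) (?\<rho>(3 := P, 4 := n + P)) []"
      using cnt_add_copy[of 3 4 "?\<rho>(3 := P, 4 := n)"] by simp
    have 6: "cnt (horner 4 5 (coeffs T)) (?\<rho>(3 := P, 4 := n + P)) (f6 (n + P)) ?c []"
      using f6(2)[of "?\<rho>(3 := P, 4 := n + P)"] by (simp add: counters_def b_def P_def)
    have 7: "cnt (emit_tableau M) ?c (f7 (m n)) ?c (?s (tableau_tail M ?c) @ ?fin)"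
    proof (rule runs_withinD[OF f7(2)])
      show "?c k \<le> m n" for k by (auto simp: counters_def m_def P_def)
    qed (auto simp: counters_def)
    have r: "cnt ?rest
        ?\<rho> (rest n) ?c (?s (tableau_tail M ?c) @ ?fin)"
      unfolding rest_def P_def[symmetric]
      by (rule cnt_Seq[OF 3 cnt_Seq[OF 4 cnt_Seq[OF 5 cnt_Seq[OF 6 7 refl refl] refl refl] refl refl] refl]) simp
    let ?in = "concat (map (\<lambda>j. ?s (inst ((\<lambda>_. 0)(2 := 0 + j)) [input_clause (x ! j)])) [0..<n])"
    have zero: "(\<lambda>_. [])(0 := x) = unary ((\<lambda>_. 0)(2 := 0)) x"
      by (auto simp: unary_def fun_eq_iff)
    have 2: "exec read_input (unary ((\<lambda>_. 0)(2 := 0)) x) ?pal (n * (N n + 7) + 1) (unary ?\<rho> []) (?pal @ ?in)"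
      using exec_read_input[where m = n and N = "N n" and i = 0 and x = x and out = ?pal, OF input] by (simp add: n_def)
    have "cnt (emit_word ?pal) ((\<lambda>_. 0)(2 := 0)) (f0 0) ((\<lambda>_. 0)(2 := 0)) ?pal"
      by (rule runs_withinD[OF f0]) auto
    then have 1: "exec (emit_word ?pal) (unary ((\<lambda>_. 0)(2 := 0)) x) [] (f0 0) (unary ((\<lambda>_. 0)(2 := 0)) x) ?pal"
      unfolding cnt_def by (metis append_Nil)
    have r': "exec ?rest
        (unary ?\<rho> []) (?pal @ ?in) (rest n) (unary ?c []) ((?pal @ ?in) @ (?s (tableau_tail M ?c) @ ?fin))"
      using r unfolding cnt_def by blast
    have "exec (reduction M p T) ((\<lambda>_. [])(0 := x)) [] (total n) (unary ?c []) ((?pal @ ?in) @ (?s (tableau_tail M ?c) @ ?fin))"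
      unfolding zero reduction_def total_def by (rule exec_seq[OF 1 exec_seq[OF 2 r' order_refl] order_refl])
    moreover have "(?pal @ ?in) @ (?s (tableau_tail M ?c) @ ?fin) = encode (cnf_form (tableau M x P (b n)))"
    proof -
      have "?in = ?s (concat (map (\<lambda>j. inst ((\<lambda>_. 0)(2 := j)) [input_clause (x ! j)]) [0..<n]))"
        by (simp only: concat_map_concat map_map comp_def add_0)
      then show ?thesis unfolding encode_cnf_form tableau_split n_def[symmetric]
        by (simp only: map_append concat_append append_assoc)
    qed
    ultimately have "exec (reduction M p T) ((\<lambda>_. [])(0 := x)) [] (poly q n) (unary ?c []) (encode (cnf_form (tableau M x P (b n))))"
      using exec_mono[OF _ q] by simp
    then show "\<exists>\<sigma>'. exec (reduction M p T) ((\<lambda>_. [])(0 := x)) [] (poly q (length x)) \<sigma>'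
        (encode (cnf_form (tableau M x (poly p (length x)) (poly T (length x + poly p (length x))))))"
      unfolding P_def b_def n_def by blast
  qed simp
qed

section \<open>NP-hardness of both problems\<close>

lemma run_halted:
  assumes "fst (run M ws t) = accept M \<or> fst (run M ws t) = reject M" "t \<le> t'"
  shows "run M ws t' = run M ws t"
  using assms(2)
proof (induction t' rule: dec_induct)
  case (step n)
  obtain q ts where "run M ws t = (q, ts)" by fastforce
  then show ?case using step.IH assms(1) by (auto simp: run_def)
qed simp

text \<open>The reduction produces poor man's formulas only, and on those the two languages agree;
  hence \<open>L\<close> may be either of them.\<close>

theorem NP_hard_if:
  assumes L: "\<And>\<phi>. poor_man \<phi> \<Longrightarrow> encode \<phi> \<in> L \<longleftrightarrow> satisfiable_in F3 \<phi>"
  shows "NP_hard L"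
  unfolding NP_hard_def
proof
  fix K assume "K \<in> NP"
  then obtain V and p :: "nat poly" where V: "poly_time_decidable2 V"
    and K: "\<And>x. x \<in> K \<longleftrightarrow> (\<exists>y. length y \<le> poly p (length x) \<and> V x y)"
    unfolding NP_def by blast
  then obtain M and T :: "nat poly" where M: "wf_tm M" "num_tapes M \<ge> 2"
    and run: "\<And>x y. fst (run M [x, y] (poly T (length x + length y))) = (if V x y then accept M else reject M)"
    unfolding poly_time_decidable2_def by blast
  let ?t = "\<lambda>x. tableau M x (poly p (length x)) (poly T (length x + poly p (length x)))"
  have "x \<in> K \<longleftrightarrow> encode (cnf_form (?t x)) \<in> L" for x
  proof -
    have "V x y \<longleftrightarrow> fst (run M [x, y] (poly T (length x + poly p (length x)))) = accept M"
      if "length y \<le> poly p (length x)" for y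
    proof -
      \<comment> \<open>The verifier has halted within the time for the actual \<open>y\<close>.
        Letting it run for the time of a longest certificate changes nothing, so one
        \<open>b\<close> serves all \<open>y\<close>.\<close>
      have "run M [x, y] (poly T (length x + poly p (length x))) = run M [x, y] (poly T (length x + length y))"
        using that run[of x y] by (intro run_halted poly_mono_nat) auto
      then show ?thesis using run[of x y] M(1) by (auto simp: wf_tm_def)
    qed
    then have "x \<in> K \<longleftrightarrow> cnf_sat (?t x)"
      unfolding K cnf_sat_tableau_iff[OF M] by blast
    also have "\<dots> \<longleftrightarrow> satisfiable_in F3 (cnf_form (?t x))"
      using cnf_sat_if_satisfiable satisfiable_if_cnf_sat nonempty_tableau by metis
    also have "\<dots> \<longleftrightarrow> encode (cnf_form (?t x)) \<in> L"
      using L[OF poor_man_cnf_form] by simp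
    finally show ?thesis .
  qed
  then show "poly_reducible K L"
    unfolding poly_reducible_def using poly_time_reduction[of M p T] by blast
qed

section \<open>The verifier\<close>

instance world :: finite
proof
  have "(UNIV :: world set) \<subseteq> {world.r, world.a, world.b, world.c}"
  proof
    fix w :: world
    show "w \<in> {world.r, world.a, world.b, world.c}" by (cases w) simp_all
  qed
  then show "finite (UNIV :: world set)" by (rule finite_subset) simp
qed

text \<open>Symbols of the evaluation stack (operators, and binary operators with the value of their first
  argument), control states of the parser, and a register for the search in the certificate: the
  pending bit of a pair, whether the name matches so far, the current world, and the result.\<close>

datatype vsym = Bit bool | AndS | OrS | BoxS | DiaS | AndV "world set" | OrV "world set"
  | Tag0 | Tag1 bool | Tag2 bool bool | Name bool bool | Val "world set" | Err
  | Reg "bool option" bool world "world set"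

instance vsym :: finite
proof
  let ?U = "range Bit \<union> {AndS, OrS, BoxS, DiaS, Tag0, Err} \<union> range AndV \<union> range OrV \<union> range Tag1 \<union>
    range (\<lambda>(x, y). Tag2 x y) \<union> range (\<lambda>(x, y). Name x y) \<union> range Val \<union> range (\<lambda>(h, ok, w, S). Reg h ok w S)"
  have "k \<in> ?U" for k by (cases k) (auto simp: image_iff)
  then have "(UNIV :: vsym set) \<subseteq> ?U" by blast
  then show "finite (UNIV :: vsym set)" by (rule finite_subset) simp
qed

fun next_world :: "world \<Rightarrow> world" where
  "next_world world.r = world.a"
| "next_world world.a = world.b"
| "next_world world.b = world.c"
| "next_world world.c = world.r"

type_synonym lstate = "vsym \<times> bool list \<times> bool list"

abbreviation "reg0 S \<equiv> Reg None True world.r S"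

text \<open>The certificate is read in pairs of bits: \<open>1 x\<close> is the letter \<open>x\<close> of a variable name, \<open>0 0\<close>
  advances the current world, and \<open>0 1\<close> completes the claim that the variable holds at the current
  world. The second component is the part of the name still to be matched, the third the part
  already matched, in reverse.\<close>

fun lstep :: "lstate \<Rightarrow> bool \<Rightarrow> lstate" where
  "lstep (Reg None ok w S, rm, dn) s = (Reg (Some s) ok w S, rm, dn)"
| "lstep (Reg (Some True) ok w S, rm, dn) s =
     (if ok \<and> rm \<noteq> [] \<and> hd rm = s then (Reg None True w S, tl rm, s # dn) else (Reg None False w S, rm, dn))"
| "lstep (Reg (Some False) ok w S, rm, dn) s =
     (if s then (reg0 (if ok \<and> rm = [] then insert w S else S), rev dn @ rm, [])
      else (Reg None ok (next_world w) S, rm, dn))"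
| "lstep q s = q"

fun reg_set :: "vsym \<Rightarrow> world set" where
  "reg_set (Reg h ok w S) = S"
| "reg_set _ = {}"

text \<open>Defined for every word: a malformed certificate still denotes a valuation, so its form
  never has to be checked.\<close>

definition lookup :: "bool list \<Rightarrow> var \<Rightarrow> world set" where
  "lookup y p = reg_set (fst (foldl lstep (reg0 {}, p, []) y))"

fun combine :: "vsym \<Rightarrow> world set \<Rightarrow> world set" where
  "combine (AndV U) S = U \<inter> S"
| "combine (OrV U) S = U \<union> S"
| "combine BoxS S = {w. \<forall>v. (w, v) \<in> rel F3 \<longrightarrow> v \<in> S}"
| "combine DiaS S = {w. \<exists>v. (w, v) \<in> rel F3 \<and> v \<in> S}"
| "combine _ S = S"

fun hold_left :: "vsym \<Rightarrow> world set \<Rightarrow> vsym option" where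
  "hold_left AndS S = Some (AndV S)"
| "hold_left OrS S = Some (OrV S)"
| "hold_left _ S = None"

text \<open>A finished value runs through the operators that it completes and stops at a binary one
  that still lacks its second argument, whose parsing begins in \<open>Tag0\<close>.\<close>

fun return :: "vsym list \<Rightarrow> world set \<Rightarrow> vsym \<times> vsym list" where
  "return [] S = (Val S, [])"
| "return (k # K) S = (case hold_left k S of Some k' \<Rightarrow> (Tag0, k' # K) | None \<Rightarrow> return K (combine k S))"

fun op_sym :: "bool \<Rightarrow> bool \<Rightarrow> bool \<Rightarrow> bool \<Rightarrow> vsym option" where
  "op_sym pm False True False = Some AndS"
| "op_sym pm False True True = (if pm then None else Some OrS)"
| "op_sym pm True False False = Some BoxS"
| "op_sym pm True False True = Some DiaS"
| "op_sym pm _ _ _ = None"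

text \<open>The transition is divided into functions of the control symbol and one input bit, since
  a program sees only the tops of its stacks.\<close>

fun ctl_step :: "bool \<Rightarrow> vsym \<Rightarrow> bool \<Rightarrow> vsym" where
  "ctl_step pm Tag0 s = Tag1 s"
| "ctl_step pm (Tag1 x) s = Tag2 x s"
| "ctl_step pm (Tag2 x x') s =
     (if op_sym pm x x' s \<noteq> None then Tag0 else if \<not> x \<and> \<not> x' then Name s False else Err)"
| "ctl_step pm (Name n False) s = Name n True"
| "ctl_step pm (Name n True) s = Name n False"
| "ctl_step pm _ s = Err"

fun pushed_op :: "bool \<Rightarrow> vsym \<Rightarrow> bool \<Rightarrow> vsym option" where
  "pushed_op pm (Tag2 x x') s = op_sym pm x x' s"
| "pushed_op pm _ s = None"

fun in_letter :: "vsym \<Rightarrow> bool" where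
  "in_letter (Name n True) = True"
| "in_letter _ = False"

fun name_end :: "vsym \<Rightarrow> bool \<Rightarrow> bool" where
  "name_end (Name n False) False = True"
| "name_end _ _ = False"

fun signed :: "vsym \<Rightarrow> world set \<Rightarrow> world set" where
  "signed (Name n m) S = (if n then - S else S)"
| "signed _ S = S"

type_synonym mstate = "vsym \<times> vsym list \<times> bool list"

text \<open>With \<open>pm\<close> set, disjunctions are rejected.\<close>

fun mstep :: "bool \<Rightarrow> bool list \<Rightarrow> mstate \<Rightarrow> bool \<Rightarrow> mstate" where
  "mstep pm y (c, K, nm) s =
     (if name_end c s then (case return K (signed c (lookup y (rev nm))) of (c', K') \<Rightarrow> (c', K', []))
      else (ctl_step pm c s, (case pushed_op pm c s of Some k \<Rightarrow> k # K | None \<Rightarrow> K),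
        if in_letter c then s # nm else nm))"

definition verifies :: "bool \<Rightarrow> bool list \<Rightarrow> bool list \<Rightarrow> bool" where
  "verifies pm x y \<longleftrightarrow> (\<exists>S. fst (foldl (mstep pm y) (Tag0, [], []) x) = Val S \<and> S \<noteq> {})"

section \<open>Correctness of the evaluation\<close>

definition truth_set :: "bool list \<Rightarrow> form \<Rightarrow> world set" where
  "truth_set y \<phi> = {w. holds F3 (lookup y) w \<phi>}"

lemma foldl_encode_var:
  "foldl (mstep pm y) (Name n False, K, nm) (encode_var p) =
     (case return K (if n then - lookup y (rev nm @ p) else lookup y (rev nm @ p)) of (c, K') \<Rightarrow> (c, K', []))"
  by (induction p arbitrary: nm) simp_all

text \<open>\<open>K\<close> is arbitrary because a subformula is parsed underneath the operators
  that wait for its value.\<close>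

lemma foldl_encode:
  assumes "pm \<longrightarrow> poor_man \<phi>"
  shows "foldl (mstep pm y) (Tag0, K, []) (encode \<phi>) = (case return K (truth_set y \<phi>) of (c, K') \<Rightarrow> (c, K', []))"
  using assms
proof (induction \<phi> arbitrary: K)
  case (Pos p)
  have "truth_set y (Pos p) = lookup y p" by (simp add: truth_set_def)
  then show ?case by (simp add: foldl_encode_var)
next
  case (Neg p)
  have "truth_set y (Neg p) = - lookup y p" by (auto simp: truth_set_def)
  then show ?case by (simp add: foldl_encode_var)
next
  case (And \<phi> \<psi>)
  have "truth_set y (And \<phi> \<psi>) = truth_set y \<phi> \<inter> truth_set y \<psi>" by (auto simp: truth_set_def)
  then show ?case using And by simp
next
  case (Or \<phi> \<psi>)
  have "truth_set y (Or \<phi> \<psi>) = truth_set y \<phi> \<union> truth_set y \<psi>" by (auto simp: truth_set_def)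
  then show ?case using Or by simp
next
  case (Box \<phi>)
  have "truth_set y (Box \<phi>) = combine BoxS (truth_set y \<phi>)" by (simp add: truth_set_def)
  then show ?case using Box by simp
next
  case (Dia \<phi>)
  have "truth_set y (Dia \<phi>) = combine DiaS (truth_set y \<phi>)" by (simp add: truth_set_def)
  then show ?case using Dia by simp
qed

lemma foldl_Err: "fst (foldl (mstep pm y) (Err, K, nm) xs) = Err"
  by (induction xs arbitrary: K nm) simp_all

lemma foldl_name:
  assumes "fst (foldl (mstep pm y) (Name n False, K, nm) xs) = Val S"
  shows "\<exists>p xs'. xs = encode_var p @ xs'"
  using assms
\<comment> \<open>A letter of a name takes two bits, so the recursion skips one position.\<close>
proof (induction xs arbitrary: nm rule: length_induct)
  case (1 xs)
  show ?case
  proof (cases xs)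
    case Nil
    then show ?thesis using "1.prems" by simp
  next
    case (Cons s xs1)
    show ?thesis
    proof (cases s)
      case False
      then have "xs = encode_var [] @ xs1" using Cons by simp
      then show ?thesis by blast
    next
      case True
      show ?thesis
      proof (cases xs1)
        case Nil
        then show ?thesis using "1.prems" Cons True by simp
      next
        case (Cons s' xs2)
        have xs: "xs = True # s' # xs2" using Cons True \<open>xs = s # xs1\<close> by simp
        then have "fst (foldl (mstep pm y) (Name n False, K, s' # nm) xs2) = Val S" using "1.prems" by simp
        moreover have "length xs2 < length xs" using xs by simp
        ultimately obtain p xs' where "xs2 = encode_var p @ xs'" using "1.IH" by blast
        then have "xs = encode_var (s' # p) @ xs'" using xs by simp
        then show ?thesis by blast
      qed
    qed
  qed
qed

text \<open>Only the shape of the input is at stake. After the first argument of a binary operator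
  \<open>foldl_encode\<close> gives the state exactly; it is again \<open>Tag0\<close>, so the
  induction hypothesis yields the second argument.\<close>

lemma foldl_parse:
  assumes "fst (foldl (mstep pm y) (Tag0, K, []) xs) = Val S"
  shows "\<exists>\<phi> xs'. xs = encode \<phi> @ xs' \<and> (pm \<longrightarrow> poor_man \<phi>)"
  using assms
proof (induction xs arbitrary: K rule: length_induct)
  case (1 xs)
  obtain s1 s2 s3 xs3 where xs: "xs = s1 # s2 # s3 # xs3"
  proof (cases xs rule: remdups_adj.cases)
    case (3 s1 s2 zs)
    show ?thesis
    proof (cases zs)
      case Nil
      then show ?thesis using 3 "1.prems" by simp
    qed (use 3 that in simp)
  qed (use "1.prems" in simp_all)
  let ?st = "mstep pm y (Tag2 s1 s2, K, []) s3"
  have fold: "fst (foldl (mstep pm y) ?st xs3) = Val S" using "1.prems" xs by simp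
  have IH: "\<exists>\<phi> xs'. zs = encode \<phi> @ xs' \<and> (pm \<longrightarrow> poor_man \<phi>)"
    if "fst (foldl (mstep pm y) (Tag0, K', []) zs) = Val S" "length zs \<le> length xs3" for K' zs
    using "1.IH"[rule_format, of zs K'] that xs by simp
  show ?case
  proof (cases "op_sym pm s1 s2 s3")
    case None
    show ?thesis
    proof (cases "s1 \<or> s2")
      case True
      then have "fst (foldl (mstep pm y) (Err, K, []) xs3) = Val S" using fold None by auto
      then show ?thesis by (simp add: foldl_Err)
    next
      case False
      then have "fst (foldl (mstep pm y) (Name s3 False, K, []) xs3) = Val S" using fold None by simp
      then obtain p xs' where "xs3 = encode_var p @ xs'" using foldl_name by blast
      then have "xs = encode (if s3 then Neg p else Pos p) @ xs'" using xs False by simp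
      then show ?thesis by (metis poor_man.simps(1,2))
    qed
  next
    case (Some k)
    then have fold': "fst (foldl (mstep pm y) (Tag0, k # K, []) xs3) = Val S" using fold by simp
    then obtain \<phi> xs4 where \<phi>: "xs3 = encode \<phi> @ xs4" "pm \<longrightarrow> poor_man \<phi>" using IH by blast
    show ?thesis
    proof (cases s1)
      case True
      then have "\<not> s2" using Some by (cases s2) auto
      then have "xs = encode (if s3 then Dia \<phi> else Box \<phi>) @ xs4" using xs \<phi> True by simp
      then show ?thesis using \<phi>(2) by (metis poor_man.simps(5,6))
    next
      case False
      then have k: "s2" "k = (if s3 then OrS else AndS)" "s3 \<longrightarrow> \<not> pm"
        using Some by (cases s2; cases s3; auto split: if_splits)+
      then have "\<exists>k'. return (k # K) (truth_set y \<phi>) = (Tag0, k' # K)" by auto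
      then obtain k' where "return (k # K) (truth_set y \<phi>) = (Tag0, k' # K)" ..
      then have "fst (foldl (mstep pm y) (Tag0, k' # K, []) xs4) = Val S"
        using fold' foldl_encode[OF \<phi>(2), of y "k # K"] \<phi>(1) by simp
      then obtain \<psi> xs5 where \<psi>: "xs4 = encode \<psi> @ xs5" "pm \<longrightarrow> poor_man \<psi>" using IH \<phi>(1) by fastforce
      have "xs = encode (if s3 then Or \<phi> \<psi> else And \<phi> \<psi>) @ xs5" using xs \<phi>(1) \<psi>(1) False k by simp
      moreover have "pm \<longrightarrow> poor_man (if s3 then Or \<phi> \<psi> else And \<phi> \<psi>)" using \<phi>(2) \<psi>(2) k by simp
      ultimately show ?thesis by blast
    qed
  qed
qed

lemma verifies_iff:
  "verifies pm x y \<longleftrightarrow> (\<exists>\<phi>. x = encode \<phi> \<and> (pm \<longrightarrow> poor_man \<phi>) \<and> (\<exists>w. holds F3 (lookup y) w \<phi>))"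
proof
  assume "verifies pm x y"
  then obtain S where S: "fst (foldl (mstep pm y) (Tag0, [], []) x) = Val S" "S \<noteq> {}"
    unfolding verifies_def by blast
  then obtain \<phi> x' where \<phi>: "x = encode \<phi> @ x'" "pm \<longrightarrow> poor_man \<phi>" using foldl_parse by blast
  have fold: "fst (foldl (mstep pm y) (Val (truth_set y \<phi>), [], []) x') = Val S"
    using S foldl_encode[OF \<phi>(2), of y "[]"] \<phi>(1) by simp
  \<comment> \<open>Input behind a complete formula drives the control from \<open>Val\<close> into
    \<open>Err\<close>, which is never left.\<close>
  have "x' = []"
  proof (cases x')
    case (Cons s x'')
    then have "fst (foldl (mstep pm y) (Err, [], []) x'') = Val S" using fold by simp
    then show ?thesis by (simp add: foldl_Err)
  qed
  then have "truth_set y \<phi> \<noteq> {}" using fold S(2) by simp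
  then show "\<exists>\<phi>. x = encode \<phi> \<and> (pm \<longrightarrow> poor_man \<phi>) \<and> (\<exists>w. holds F3 (lookup y) w \<phi>)"
    using \<phi> \<open>x' = []\<close> by (auto simp: truth_set_def)
next
  assume "\<exists>\<phi>. x = encode \<phi> \<and> (pm \<longrightarrow> poor_man \<phi>) \<and> (\<exists>w. holds F3 (lookup y) w \<phi>)"
  then obtain \<phi> w where "x = encode \<phi>" and pm: "pm \<longrightarrow> poor_man \<phi>" and "holds F3 (lookup y) w \<phi>" by blast
  then have "truth_set y \<phi> \<noteq> {}" "fst (foldl (mstep pm y) (Tag0, [], []) x) = Val (truth_set y \<phi>)"
    using foldl_encode[OF pm, of y "[]"] by (auto simp: truth_set_def)
  then show "verifies pm x y" unfolding verifies_def by blast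
qed

section \<open>Certificates from valuations\<close>

fun world_index :: "world \<Rightarrow> nat" where
  "world_index world.r = 0"
| "world_index world.a = 1"
| "world_index world.b = 2"
| "world_index world.c = 3"

definition entry :: "var \<times> world \<Rightarrow> bool list" where
  "entry e = concat (map (\<lambda>x. [True, x]) (fst e)) @ concat (replicate (world_index (snd e)) [False, False]) @ [False, True]"

text \<open>\<open>rev dn @ rm\<close> stays the name even after a mismatch. This is what allows the
  name to be restored for the next entry without keeping a copy.\<close>

lemma foldl_name_digits:
  "\<exists>ok' rm' dn'. foldl lstep (Reg None ok w S, rm, dn) (concat (map (\<lambda>x. [True, x]) p)) = (Reg None ok' w S, rm', dn') \<and>
     rev dn' @ rm' = rev dn @ rm \<and> (ok' \<and> rm' = [] \<longleftrightarrow> ok \<and> rm = p)"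
proof (induction p arbitrary: ok rm dn)
  case (Cons x p)
  show ?case
  proof (cases "ok \<and> rm \<noteq> [] \<and> hd rm = x")
    case True
    then obtain rm1 where rm: "rm = x # rm1" by (cases rm) auto
    then show ?thesis using Cons.IH[of True rm1 "x # dn"] True by simp
  next
    case False
    then have "ok \<longrightarrow> rm \<noteq> x # p" by auto
    then show ?thesis using Cons.IH[of False rm dn] False by auto
  qed
qed simp

lemma foldl_worlds:
  "foldl lstep (Reg None ok world.r S, rm, dn) (concat (replicate (world_index w) [False, False])) = (Reg None ok w S, rm, dn)"
  by (cases w) (simp_all add: numeral_2_eq_2 numeral_3_eq_3)

lemma foldl_entry:
  "foldl lstep (reg0 S, p, []) (entry (p', w)) = (reg0 (S \<union> (if p = p' then {w} else {})), p, [])"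
proof -
  obtain ok' rm' dn' where f: "foldl lstep (reg0 S, p, []) (concat (map (\<lambda>x. [True, x]) p')) = (Reg None ok' world.r S, rm', dn')"
    "rev dn' @ rm' = p" "ok' \<and> rm' = [] \<longleftrightarrow> p = p'"
    using foldl_name_digits[of True world.r S p "[]" p'] by auto
  show ?thesis unfolding entry_def fst_conv snd_conv foldl_append f(1) foldl_worlds using f(2,3) by simp
qed

lemma lookup_table: "lookup (concat (map entry es)) p = {w. (p, w) \<in> set es}"
proof -
  have "foldl lstep (reg0 S, p, []) (concat (map entry es)) = (reg0 (S \<union> {w. (p, w) \<in> set es}), p, [])" for S
  proof (induction es arbitrary: S)
    case (Cons e es)
    obtain p' w where e: "e = (p', w)" by fastforce
    have "S \<union> (if p = p' then {w} else {}) \<union> {w. (p, w) \<in> set es} = S \<union> {w. (p, w) \<in> set (e # es)}"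
      using e by auto
    then show ?case using Cons.IH by (simp add: foldl_entry e)
  qed simp
  then show ?thesis by (simp add: lookup_def)
qed

fun form_vars :: "form \<Rightarrow> var list" where
  "form_vars (Pos p) = [p]"
| "form_vars (Neg p) = [p]"
| "form_vars (And \<phi> \<psi>) = form_vars \<phi> @ form_vars \<psi>"
| "form_vars (Or \<phi> \<psi>) = form_vars \<phi> @ form_vars \<psi>"
| "form_vars (Box \<phi>) = form_vars \<phi>"
| "form_vars (Dia \<phi>) = form_vars \<phi>"

lemma holds_cong: "(\<And>p. p \<in> set (form_vars \<phi>) \<Longrightarrow> \<pi> p = \<pi>' p) \<Longrightarrow> holds F \<pi> w \<phi> \<longleftrightarrow> holds F \<pi>' w \<phi>"
  by (induction \<phi> arbitrary: w) auto

definition table :: "(var \<Rightarrow> world set) \<Rightarrow> var list \<Rightarrow> bool list" where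
  "table \<pi> ps = concat (map entry (concat (map (\<lambda>p. map (Pair p) (filter (\<lambda>w. w \<in> \<pi> p)
     [world.r, world.a, world.b, world.c])) ps)))"

lemma lookup_table_eq:
  assumes "p \<in> set ps"
  shows "lookup (table \<pi> ps) p = \<pi> p"
proof -
  define ws where "ws = [world.r, world.a, world.b, world.c]"
  have "w \<in> set ws" for w by (cases w) (simp_all add: ws_def)
  then show ?thesis using assms unfolding table_def lookup_table ws_def[symmetric] by auto
qed

lemma length_entry: "length (entry (p, w)) \<le> 2 * length p + 8"
proof -
  have "length (concat (map (\<lambda>x. [True, x]) p)) = 2 * length p" by (induction p) simp_all
  moreover have "length (concat (replicate n [False, False])) = 2 * n" for n by (induction n) simp_all
  moreover have "world_index w \<le> 3" by (cases w) simp_all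
  ultimately show ?thesis unfolding entry_def fst_conv snd_conv length_append by simp
qed

lemma length_entries: "length (concat (map entry (map (Pair p) (filter Q ws)))) \<le> length ws * (2 * length p + 8)"
proof (induction ws)
  case (Cons w ws)
  show ?case
  proof (cases "Q w")
    case True
    then have "length (concat (map entry (map (Pair p) (filter Q (w # ws))))) =
        length (entry (p, w)) + length (concat (map entry (map (Pair p) (filter Q ws))))"
      by (simp only: filter.simps if_True list.map concat.simps length_append)
    also have "\<dots> \<le> (2 * length p + 8) + length ws * (2 * length p + 8)"
      by (rule add_mono[OF length_entry Cons.IH])
    finally show ?thesis by simp
  qed (use Cons.IH in simp)
qed simp

lemma length_table_single: "length (table \<pi> [p]) \<le> 4 * (2 * length p + 8)"
proof -
  define ws where "ws = [world.r, world.a, world.b, world.c]"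
  have "length ws = 4" by (simp add: ws_def)
  moreover have "table \<pi> [p] = concat (map entry (map (Pair p) (filter (\<lambda>w. w \<in> \<pi> p) ws)))"
    by (simp only: table_def ws_def list.map concat.simps append_Nil2)
  ultimately show ?thesis using length_entries[of p "\<lambda>w. w \<in> \<pi> p" ws] by (simp only:)
qed

text \<open>A generous factor: each occurrence of a variable \<open>p\<close> costs at most four
  entries of \<open>2 * length p + 8\<close> bits, while its literal alone has a code of
  \<open>2 * length p + 4\<close> bits.\<close>

lemma length_table: "length (table \<pi> (form_vars \<phi>)) \<le> 32 * length (encode \<phi>)"
proof (induction \<phi>)
  case (Pos p)
  have "length (encode_var p) = 2 * length p + 1" by (induction p) simp_all
  then show ?case using length_table_single[of \<pi> p] by simp
next
  case (Neg p)
  have "length (encode_var p) = 2 * length p + 1" by (induction p) simp_all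
  then show ?case using length_table_single[of \<pi> p] by simp
next
  case (And \<phi> \<psi>)
  have "length (table \<pi> (form_vars (And \<phi> \<psi>))) = length (table \<pi> (form_vars \<phi>)) + length (table \<pi> (form_vars \<psi>))"
    unfolding table_def form_vars.simps map_append concat_append length_append ..
  then show ?case using And by simp
next
  case (Or \<phi> \<psi>)
  have "length (table \<pi> (form_vars (Or \<phi> \<psi>))) = length (table \<pi> (form_vars \<phi>)) + length (table \<pi> (form_vars \<psi>))"
    unfolding table_def form_vars.simps map_append concat_append length_append ..
  then show ?case using Or by simp
qed simp_all

theorem in_NP_if_verifies:
  assumes V: "poly_time_decidable2 (verifies pm)"
  shows "{encode \<phi> |\<phi>. (pm \<longrightarrow> poor_man \<phi>) \<and> satisfiable_in F3 \<phi>} \<in> NP"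
proof -
  have "(x \<in> {encode \<phi> |\<phi>. (pm \<longrightarrow> poor_man \<phi>) \<and> satisfiable_in F3 \<phi>}) \<longleftrightarrow>
      (\<exists>y. length y \<le> poly [:0, 32:] (length x) \<and> verifies pm x y)" for x
  proof
    assume "x \<in> {encode \<phi> |\<phi>. (pm \<longrightarrow> poor_man \<phi>) \<and> satisfiable_in F3 \<phi>}"
    then obtain \<phi> \<pi> w where x: "x = encode \<phi>" "pm \<longrightarrow> poor_man \<phi>" and h: "holds F3 \<pi> w \<phi>"
      unfolding satisfiable_in_def by blast
    let ?y = "table \<pi> (form_vars \<phi>)"
    have "holds F3 (lookup ?y) w \<phi> \<longleftrightarrow> holds F3 \<pi> w \<phi>" by (rule holds_cong) (rule lookup_table_eq)
    then have "verifies pm x ?y" unfolding verifies_iff using x h by (intro exI[of _ \<phi>] exI[of _ w] conjI) simp_all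
    moreover have "length ?y \<le> poly [:0, 32:] (length x)" using length_table[of \<pi> \<phi>] x by (simp add: mult.commute)
    ultimately show "\<exists>y. length y \<le> poly [:0, 32:] (length x) \<and> verifies pm x y" by (intro exI[of _ ?y] conjI)
  next
    assume "\<exists>y. length y \<le> poly [:0, 32:] (length x) \<and> verifies pm x y"
    then obtain \<phi> y w where "x = encode \<phi>" "pm \<longrightarrow> poor_man \<phi>" "holds F3 (lookup y) w \<phi>"
      unfolding verifies_iff by blast
    then show "x \<in> {encode \<phi> |\<phi>. (pm \<longrightarrow> poor_man \<phi>) \<and> satisfiable_in F3 \<phi>}"
      unfolding satisfiable_in_def worlds_F3 by blast
  qed
  then show ?thesis unfolding NP_def
    by (intro CollectI exI[of _ "verifies pm"] exI[of _ "[:0, 32:]"] conjI allI V)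
qed

section \<open>The program of the verifier\<close>

definition mv :: "nat \<Rightarrow> nat \<Rightarrow> 'a cmd" where "mv a b = Push b (\<lambda>t. the (t a)) ;; Pop a"

definition drain :: "nat \<Rightarrow> nat \<Rightarrow> 'a cmd" where "drain a b = While (\<lambda>t. t a \<noteq> None) (mv a b)"

definition clear :: "nat \<Rightarrow> 'a cmd" where "clear a = While (\<lambda>t. t a \<noteq> None) (Pop a)"

text \<open>Replaces the top of stack \<open>j\<close>; the new symbol waits on stack 9, since it may depend on the
  symbol that is to be removed.\<close>

definition upd :: "nat \<Rightarrow> ((nat \<Rightarrow> 'a option) \<Rightarrow> 'a) \<Rightarrow> 'a cmd" where
  "upd j g = Push 9 g ;; Pop j ;; Push j (\<lambda>t. the (t 9)) ;; Pop 9"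

section \<open>Execution of the basic programs\<close>

lemma tops_None: "tops \<sigma> a = None \<longleftrightarrow> \<sigma> a = []"
  by (simp add: tops_def split: list.splits)

lemma tops_Cons: "\<sigma> a = x # xs \<Longrightarrow> tops \<sigma> a = Some x"
  by (simp add: tops_def)

lemma exec_mv:
  assumes "\<sigma> a = x # xs" "a \<noteq> b"
  shows "exec (mv a b) \<sigma> out 4 (\<sigma>(a := xs, b := x # \<sigma> b)) out"
  unfolding mv_def
proof (rule exec_seq[OF exec_push[OF refl order_refl] exec_pop[OF _ order_refl]])
  show "\<sigma>(a := xs, b := x # \<sigma> b) = (\<sigma>(b := the (tops \<sigma> a) # \<sigma> b))(a := tl ((\<sigma>(b := the (tops \<sigma> a) # \<sigma> b)) a))"
    using assms by (auto simp: fun_eq_iff tops_Cons)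
qed simp

lemma exec_drain:
  assumes "a \<noteq> b"
  shows "exec (drain a b) \<sigma> out (5 * length (\<sigma> a) + 1) (\<sigma>(a := [], b := rev (\<sigma> a) @ \<sigma> b)) out"
proof -
  have "exec (drain a b) \<sigma> out (5 * length xs + 1) (\<sigma>(a := [], b := rev xs @ \<sigma> b)) out" if "\<sigma> a = xs" for xs
    using that
  proof (induction xs arbitrary: \<sigma>)
    case Nil
    then have "\<sigma>(a := [], b := rev [] @ \<sigma> b) = \<sigma>" by (auto simp: fun_eq_iff)
    moreover have "exec (drain a b) \<sigma> out (5 * length [] + 1) \<sigma> out"
      unfolding drain_def by (rule exec_while_end) (use Nil in \<open>simp_all add: tops_None\<close>)
    ultimately show ?case by (simp only:)
  next
    case (Cons x xs)
    let ?\<sigma> = "\<sigma>(a := xs, b := x # \<sigma> b)"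
    have "exec (drain a b) ?\<sigma> out (5 * length xs + 1) (?\<sigma>(a := [], b := rev xs @ ?\<sigma> b)) out"
      using assms by (intro Cons.IH) simp
    moreover have "?\<sigma>(a := [], b := rev xs @ ?\<sigma> b) = \<sigma>(a := [], b := rev (x # xs) @ \<sigma> b)"
      using assms by (auto simp: fun_eq_iff)
    ultimately have rest: "exec (drain a b) ?\<sigma> out (5 * length xs + 1) (\<sigma>(a := [], b := rev (x # xs) @ \<sigma> b)) out"
      by (simp only:)
    show ?case unfolding drain_def
      by (rule exec_while[OF _ exec_mv[of \<sigma> a x xs b, OF Cons.prems assms] rest[unfolded drain_def]])
        (use Cons.prems in \<open>simp_all add: tops_None\<close>)
  qed
  then show ?thesis by blast
qed

lemma exec_clear: "exec (clear a) \<sigma> out (2 * length (\<sigma> a) + 1) (\<sigma>(a := [])) out"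
proof -
  have "exec (clear a) \<sigma> out (2 * length xs + 1) (\<sigma>(a := [])) out" if "\<sigma> a = xs" for xs
    using that
  proof (induction xs arbitrary: \<sigma>)
    case Nil
    then have "\<sigma>(a := []) = \<sigma>" by (auto simp: fun_eq_iff)
    moreover have "exec (clear a) \<sigma> out (2 * length [] + 1) \<sigma> out"
      unfolding clear_def by (rule exec_while_end) (use Nil in \<open>simp_all add: tops_None\<close>)
    ultimately show ?case by (simp only:)
  next
    case (Cons x xs)
    let ?\<sigma> = "\<sigma>(a := xs)"
    have pop: "exec (Pop a) \<sigma> out 1 ?\<sigma> out" by (rule exec_pop) (simp_all add: Cons.prems)
    have rest: "exec (clear a) ?\<sigma> out (2 * length xs + 1) (\<sigma>(a := [])) out"
      using Cons.IH[of ?\<sigma>] by (simp only: fun_upd_same fun_upd_upd)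
    show ?case unfolding clear_def
      by (rule exec_while[OF _ pop rest[unfolded clear_def]])
        (use Cons.prems in \<open>simp_all add: tops_None\<close>)
  qed
  then show ?thesis by blast
qed

lemma exec_upd:
  assumes "j \<noteq> 9" "\<sigma>' = \<sigma>(j := g (tops \<sigma>) # tl (\<sigma> j))"
  shows "exec (upd j g) \<sigma> out 9 \<sigma>' out"
  unfolding upd_def
proof (rule exec_seq[OF exec_push[OF refl order_refl]
    exec_seq[OF exec_pop[OF refl order_refl] exec_seq[OF exec_push[OF refl order_refl] exec_pop[OF _ order_refl] order_refl] order_refl]])
  let ?v = "g (tops \<sigma>)"
  let ?\<sigma>1 = "\<sigma>(9 := ?v # \<sigma> 9)"
  let ?\<sigma>2 = "?\<sigma>1(j := tl (?\<sigma>1 j))"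
  let ?\<sigma>3 = "?\<sigma>2(j := the (tops ?\<sigma>2 9) # ?\<sigma>2 j)"
  have "tops ?\<sigma>2 9 = Some ?v" using assms(1) by (simp add: tops_def)
  then show "\<sigma>' = ?\<sigma>3(9 := tl (?\<sigma>3 9))"
    using assms by (auto simp: fun_eq_iff)
qed simp

lemma exec_Ite_True: "b (tops \<sigma>) \<Longrightarrow> exec c \<sigma> out m \<sigma>' out' \<Longrightarrow> m + 1 \<le> N \<Longrightarrow> exec (Ite b c d) \<sigma> out N \<sigma>' out'"
  by (rule exec_ite) auto

lemma exec_Ite_False: "\<not> b (tops \<sigma>) \<Longrightarrow> exec d \<sigma> out m \<sigma>' out' \<Longrightarrow> m + 1 \<le> N \<Longrightarrow> exec (Ite b c d) \<sigma> out N \<sigma>' out'"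
  by (rule exec_ite) auto

text \<open>Formula, certificate and its part already read, evaluation stack, name still to be matched and
  matched, control state, search register.\<close>

definition vst :: "vsym list \<Rightarrow> vsym list \<Rightarrow> vsym list \<Rightarrow> vsym list \<Rightarrow> vsym list \<Rightarrow> vsym list \<Rightarrow> vsym \<Rightarrow> vsym \<Rightarrow> vsym store" where
  "vst x y z K rm dn c g = (\<lambda>_. [])(0 := x, 1 := y, 2 := z, 3 := K, 4 := rm, 5 := dn, 6 := [c], 7 := [g])"

abbreviation "vmain x y K nm c \<equiv> vst x (map Bit y) [] K [] (map Bit nm) c (reg0 {})"

lemma vst_nth:
  "vst x y z K rm dn c g 0 = x" "vst x y z K rm dn c g (Suc 0) = y" "vst x y z K rm dn c g 2 = z"
  "vst x y z K rm dn c g 3 = K" "vst x y z K rm dn c g 4 = rm" "vst x y z K rm dn c g 5 = dn"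
  "vst x y z K rm dn c g 6 = [c]" "vst x y z K rm dn c g 7 = [g]"
  by (simp_all add: vst_def)

lemma vst_upd:
  "(vst x y z K rm dn c g)(0 := x') = vst x' y z K rm dn c g"
  "(vst x y z K rm dn c g)(Suc 0 := y') = vst x y' z K rm dn c g"
  "(vst x y z K rm dn c g)(2 := z') = vst x y z' K rm dn c g"
  "(vst x y z K rm dn c g)(3 := K') = vst x y z K' rm dn c g"
  "(vst x y z K rm dn c g)(4 := rm') = vst x y z K rm' dn c g"
  "(vst x y z K rm dn c g)(5 := dn') = vst x y z K rm dn' c g"
  "(vst x y z K rm dn c g)(6 := [c']) = vst x y z K rm dn c' g"
  "(vst x y z K rm dn c g)(7 := [g']) = vst x y z K rm dn c g'"
  by (auto simp: vst_def fun_eq_iff)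

lemma tops_vst:
  "tops (vst x y z K rm dn c g) 6 = Some c" "tops (vst x y z K rm dn c g) 7 = Some g"
  "tops (vst x y z K rm dn c g) 0 = (case x of [] \<Rightarrow> None | s # _ \<Rightarrow> Some s)"
  "tops (vst x y z K rm dn c g) (Suc 0) = (case y of [] \<Rightarrow> None | s # _ \<Rightarrow> Some s)"
  "tops (vst x y z K rm dn c g) 3 = (case K of [] \<Rightarrow> None | s # _ \<Rightarrow> Some s)"
  "tops (vst x y z K rm dn c g) 4 = (case rm of [] \<Rightarrow> None | s # _ \<Rightarrow> Some s)"
  by (simp_all add: tops_def vst_nth)

section \<open>The search in the certificate\<close>

fun bit_of :: "vsym option \<Rightarrow> bool" where
  "bit_of (Some (Bit s)) = s"
| "bit_of _ = False"

fun first_bit :: "vsym option \<Rightarrow> bool list" where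
  "first_bit (Some (Bit s)) = [s]"
| "first_bit _ = []"

fun is_match :: "vsym \<Rightarrow> bool list \<Rightarrow> bool \<Rightarrow> bool" where
  "is_match (Reg (Some True) ok w S) rm s = (ok \<and> rm \<noteq> [] \<and> hd rm = s)"
| "is_match _ _ _ = False"

fun is_end :: "vsym \<Rightarrow> bool \<Rightarrow> bool" where
  "is_end (Reg (Some False) ok w S) s = s"
| "is_end _ _ = False"

text \<open>Only the top of the name stack is visible. By \<open>lstep_split\<close> the new
  register depends on the first letter of the remaining name alone, or on its absence.\<close>

definition reg_fun :: "(nat \<Rightarrow> vsym option) \<Rightarrow> vsym" where
  "reg_fun t = fst (lstep (the (t 7), first_bit (t 4), []) (bit_of (t 1)))"

definition lookup_step :: "vsym cmd" where
  "lookup_step = Ite (\<lambda>t. is_match (the (t 7)) (first_bit (t 4)) (bit_of (t 1))) (upd 7 reg_fun ;; mv 4 5)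
     (Ite (\<lambda>t. is_end (the (t 7)) (bit_of (t 1))) (upd 7 reg_fun ;; drain 5 4) (upd 7 reg_fun)) ;; mv 1 2"

lemma lstep_split:
  "lstep (g, rm, dn) s = (fst (lstep (g, (case rm of [] \<Rightarrow> [] | x # _ \<Rightarrow> [x]), []) s),
     if is_match g rm s then (tl rm, s # dn) else if is_end g s then (rev dn @ rm, []) else (rm, dn))"
  by (cases "((g, rm, dn), s)" rule: lstep.cases) (auto split: list.splits)

text \<open>Bounds the cost of the \<open>drain\<close> at the end of an entry by the length of the
  name.\<close>

lemma lstep_length:
  "lstep (g, rm, dn) s = (g', rm', dn') \<Longrightarrow> length rm' + length dn' = length rm + length dn"
  unfolding lstep_split[of g rm dn s]
  by (cases "((g, rm, dn), s)" rule: lstep.cases) (auto split: if_splits)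

lemma exec_lookup_step:
  assumes "lstep (g, rm, dn) s = (g', rm', dn')"
  shows "exec lookup_step (vst x (map Bit (s # y)) (map Bit z) K (map Bit rm) (map Bit dn) c g) out (5 * length dn + 30)
     (vst x (map Bit y) (map Bit (s # z)) K (map Bit rm') (map Bit dn') c g') out"
proof -
  let ?st = "\<lambda>y z rm dn. vst x (map Bit y) (map Bit z) K (map Bit rm) (map Bit dn) c"
  have fb: "first_bit (tops (?st (s # y) z rm dn g) 4) = (case rm of [] \<Rightarrow> [] | x # _ \<Rightarrow> [x])" for rm dn g
    by (cases rm) (simp_all add: tops_vst)
  have g': "g' = fst (lstep (g, (case rm of [] \<Rightarrow> [] | x # _ \<Rightarrow> [x]), []) s)"
    and rd: "(rm', dn') = (if is_match g rm s then (tl rm, s # dn) else if is_end g s then (rev dn @ rm, []) else (rm, dn))"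
    using assms unfolding lstep_split[of g rm dn s] by simp_all
  have upd: "exec (upd 7 reg_fun) (?st (s # y) z rm dn g) out 9 (?st (s # y) z rm dn g') out"
  proof (rule exec_upd)
    have "reg_fun (tops (?st (s # y) z rm dn g)) = g'"
      unfolding reg_fun_def fb g' by (simp add: tops_vst)
    then show "?st (s # y) z rm dn g' = (?st (s # y) z rm dn g)(7 := reg_fun (tops (?st (s # y) z rm dn g)) # tl (?st (s # y) z rm dn g 7))"
      by (simp add: vst_nth vst_upd)
  qed simp
  have match: "is_match g (first_bit (tops (?st (s # y) z rm dn g) 4)) s = is_match g rm s"
    unfolding fb by (cases "(g, rm, s)" rule: is_match.cases) (auto split: list.splits)
  have first: "exec (Ite (\<lambda>t. is_match (the (t 7)) (first_bit (t 4)) (bit_of (t 1))) (upd 7 reg_fun ;; mv 4 5)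
     (Ite (\<lambda>t. is_end (the (t 7)) (bit_of (t 1))) (upd 7 reg_fun ;; drain 5 4) (upd 7 reg_fun)))
     (?st (s # y) z rm dn g) out (5 * length dn + 20) (?st (s # y) z rm' dn' g') out"
  proof (cases "is_match g rm s")
    case True
    then obtain rm1 where rm: "rm = s # rm1" "rm' = rm1" "dn' = s # dn"
      using rd by (cases "(g, rm, s)" rule: is_match.cases; cases rm) auto
    have "exec (mv 4 5) (?st (s # y) z rm dn g') out 4 ((?st (s # y) z rm dn g')(4 := map Bit rm1, 5 := Bit s # ?st (s # y) z rm dn g' 5)) out"
      by (rule exec_mv) (simp_all add: vst_nth rm)
    then have mv: "exec (mv 4 5) (?st (s # y) z rm dn g') out 4 (?st (s # y) z rm' dn' g') out"
      by (simp add: vst_nth vst_upd rm)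
    show ?thesis
      by (rule exec_Ite_True[OF _ exec_seq[OF upd mv order_refl]]) (use match True in \<open>simp_all add: tops_vst\<close>)
  next
    case False
    have inner: "exec (Ite (\<lambda>t. is_end (the (t 7)) (bit_of (t 1))) (upd 7 reg_fun ;; drain 5 4) (upd 7 reg_fun))
      (?st (s # y) z rm dn g) out (5 * length dn + 12) (?st (s # y) z rm' dn' g') out"
    proof (cases "is_end g s")
      case True
      have "exec (drain 5 4) (?st (s # y) z rm dn g') out (5 * length (?st (s # y) z rm dn g' 5) + 1)
          ((?st (s # y) z rm dn g')(5 := [], 4 := rev (?st (s # y) z rm dn g' 5) @ ?st (s # y) z rm dn g' 4)) out"
        by (rule exec_drain) simp
      then have dr: "exec (drain 5 4) (?st (s # y) z rm dn g') out (5 * length dn + 1) (?st (s # y) z rm' dn' g') out"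
        using rd False True by (simp add: vst_nth vst_upd rev_map)
      show ?thesis
        by (rule exec_Ite_True[OF _ exec_seq[OF upd dr order_refl]]) (use True in \<open>simp_all add: tops_vst\<close>)
    next
      case end_False: False
      then have "rm' = rm" "dn' = dn" using rd False by simp_all
      with end_False show ?thesis
        by (simp only:) (rule exec_Ite_False[OF _ upd], simp_all add: tops_vst)
    qed
    show ?thesis
      by (rule exec_Ite_False[OF _ inner]) (use match False in \<open>simp_all add: tops_vst\<close>)
  qed
  have "exec (mv 1 2) (?st (s # y) z rm' dn' g') out 4 ((?st (s # y) z rm' dn' g')(1 := map Bit y, 2 := Bit s # ?st (s # y) z rm' dn' g' 2)) out"
    by (rule exec_mv) (simp_all add: vst_nth)
  then have last: "exec (mv 1 2) (?st (s # y) z rm' dn' g') out 4 (?st y (s # z) rm' dn' g') out"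
    by (simp add: vst_nth vst_upd)
  show ?thesis unfolding lookup_step_def by (rule exec_seq[OF first last]) simp
qed

lemma exec_lookup_loop:
  assumes "foldl lstep (g, rm, dn) y = (g', rm', dn')" "length rm + length dn \<le> l"
  shows "exec (While (\<lambda>t. t 1 \<noteq> None) lookup_step) (vst x (map Bit y) (map Bit z) K (map Bit rm) (map Bit dn) c g) out
     (length y * (5 * l + 31) + 1) (vst x [] (map Bit (rev y @ z)) K (map Bit rm') (map Bit dn') c g') out"
  using assms
proof (induction y arbitrary: g rm dn z)
  case Nil
  then show ?case by (auto intro!: exec_while_end simp: tops_vst)
next
  case (Cons s y)
  obtain g1 rm1 dn1 where 1: "lstep (g, rm, dn) s = (g1, rm1, dn1)" by (cases "lstep (g, rm, dn) s")
  have rest: "exec (While (\<lambda>t. t 1 \<noteq> None) lookup_step) (vst x (map Bit y) (map Bit (s # z)) K (map Bit rm1) (map Bit dn1) c g1) out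
     (length y * (5 * l + 31) + 1) (vst x [] (map Bit (rev y @ s # z)) K (map Bit rm') (map Bit dn') c g') out"
    by (rule Cons.IH) (use Cons.prems 1 lstep_length[OF 1] in simp_all)
  have "exec (While (\<lambda>t. t 1 \<noteq> None) lookup_step) (vst x (map Bit (s # y)) (map Bit z) K (map Bit rm) (map Bit dn) c g) out
     (length (s # y) * (5 * l + 31) + 1) (vst x [] (map Bit (rev y @ s # z)) K (map Bit rm') (map Bit dn') c g') out"
    by (rule exec_while[OF _ exec_lookup_step[OF 1] rest]) (use Cons.prems in \<open>simp_all add: tops_vst\<close>)
  then show ?case by simp
qed

text \<open>Reading moves the certificate to stack 2 in reverse; draining it back makes it available
  for the next variable.\<close>

definition lookup_prog :: "vsym cmd" where
  "lookup_prog = While (\<lambda>t. t 1 \<noteq> None) lookup_step ;; drain 2 1 ;; clear 4 ;; clear 5"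

lemma exec_lookup_prog:
  "\<exists>g'. reg_set g' = lookup y p \<and>
     exec lookup_prog (vst x (map Bit y) [] K (map Bit p) [] c (reg0 {})) out
       (length y * (5 * length p + 36) + 4 * length p + 10) (vst x (map Bit y) [] K [] [] c g') out"
proof -
  obtain g' rm' dn' where f: "foldl lstep (reg0 {}, p, []) y = (g', rm', dn')"
    by (cases "foldl lstep (reg0 {}, p, []) y")
  have len: "length rm' + length dn' = length p"
  proof -
    have "length rm' + length dn' = length rm + length dn" if "foldl lstep (g, rm, dn) y = (g', rm', dn')" for g rm dn
      using that
    proof (induction y arbitrary: g rm dn)
      case (Cons s y)
      obtain g1 rm1 dn1 where 1: "lstep (g, rm, dn) s = (g1, rm1, dn1)" by (cases "lstep (g, rm, dn) s")
      then show ?case using Cons lstep_length[OF 1] by simp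
    qed simp
    from this[OF f] show ?thesis by simp
  qed
  have loop: "exec (While (\<lambda>t. t 1 \<noteq> None) lookup_step) (vst x (map Bit y) [] K (map Bit p) [] c (reg0 {})) out
     (length y * (5 * length p + 31) + 1) (vst x [] (map Bit (rev y)) K (map Bit rm') (map Bit dn') c g') out"
    using exec_lookup_loop[OF f, of "length p" x "[]" K c out] by simp
  let ?s = "vst x [] (map Bit (rev y)) K (map Bit rm') (map Bit dn') c g'"
  have "exec (drain 2 1) ?s out (5 * length (?s 2) + 1) (?s(2 := [], 1 := rev (?s 2) @ ?s 1)) out"
    by (rule exec_drain) simp
  then have dr: "exec (drain 2 1) ?s out (5 * length y + 1) (vst x (map Bit y) [] K (map Bit rm') (map Bit dn') c g') out"
    by (simp add: vst_nth vst_upd rev_map)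
  have c4: "exec (clear 4) (vst x (map Bit y) [] K (map Bit rm') (map Bit dn') c g') out (2 * length rm' + 1)
      (vst x (map Bit y) [] K [] (map Bit dn') c g') out"
    using exec_clear[of 4 "vst x (map Bit y) [] K (map Bit rm') (map Bit dn') c g'" out] by (simp add: vst_nth vst_upd)
  have c5: "exec (clear 5) (vst x (map Bit y) [] K [] (map Bit dn') c g') out (2 * length dn' + 1)
      (vst x (map Bit y) [] K [] [] c g') out"
    using exec_clear[of 5 "vst x (map Bit y) [] K [] (map Bit dn') c g'" out] by (simp add: vst_nth vst_upd)
  have "exec lookup_prog (vst x (map Bit y) [] K (map Bit p) [] c (reg0 {})) out
       (length y * (5 * length p + 36) + 4 * length p + 10) (vst x (map Bit y) [] K [] [] c g') out"
    unfolding lookup_prog_def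
    by (rule exec_seq[OF loop exec_seq[OF dr exec_seq[OF c4 c5 order_refl] order_refl]]) (use len in \<open>simp add: algebra_simps\<close>)
  moreover have "reg_set g' = lookup y p" using f by (simp add: lookup_def)
  ultimately show ?thesis by blast
qed

section \<open>Returning values and processing one bit\<close>

fun is_val :: "vsym \<Rightarrow> bool" where
  "is_val (Val S) = True"
| "is_val _ = False"

fun val_set :: "vsym \<Rightarrow> world set" where
  "val_set (Val S) = S"
| "val_set _ = {}"

definition return_body :: "vsym cmd" where
  "return_body = Ite (\<lambda>t. hold_left (the (t 3)) (val_set (the (t 6))) \<noteq> None)
       (upd 3 (\<lambda>t. the (hold_left (the (t 3)) (val_set (the (t 6))))) ;; upd 6 (\<lambda>_. Tag0))
       (upd 6 (\<lambda>t. Val (combine (the (t 3)) (val_set (the (t 6))))) ;; Pop 3)"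

definition return_prog :: "vsym cmd" where
  "return_prog = While (\<lambda>t. is_val (the (t 6)) \<and> t 3 \<noteq> None) return_body"

text \<open>A completed operator costs 13 steps, and one that holds the value, which ends the loop,
  costs 22; 30 covers both.\<close>

lemma exec_return_prog:
  "return K S = (c', K') \<Longrightarrow> exec return_prog (vst x y z K rm dn (Val S) g) out (length K * 30 + 1) (vst x y z K' rm dn c' g) out"
proof (induction K arbitrary: S)
  case Nil
  then show ?case unfolding return_prog_def by (auto intro!: exec_while_end simp: tops_vst)
next
  case (Cons k K)
  let ?s = "vst x y z (k # K) rm dn (Val S) g"
  show ?case
  proof (cases "hold_left k S")
    case (Some k')
    then have res: "c' = Tag0" "K' = k' # K" using Cons.prems by simp_all
    have 1: "exec (upd 3 (\<lambda>t. the (hold_left (the (t 3)) (val_set (the (t 6)))))) ?s out 9 (vst x y z (k' # K) rm dn (Val S) g) out"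
      by (rule exec_upd) (simp_all add: tops_vst vst_nth vst_upd Some)
    have 2: "exec (upd 6 (\<lambda>_. Tag0)) (vst x y z (k' # K) rm dn (Val S) g) out 9 (vst x y z (k' # K) rm dn Tag0 g) out"
      by (rule exec_upd) (simp_all add: tops_vst vst_nth vst_upd)
    have body: "exec return_body ?s out 20 (vst x y z (k' # K) rm dn Tag0 g) out"
      unfolding return_body_def by (rule exec_Ite_True[OF _ exec_seq[OF 1 2 order_refl]]) (simp_all add: tops_vst Some)
    have rest: "exec return_prog (vst x y z (k' # K) rm dn Tag0 g) out 1 (vst x y z (k' # K) rm dn Tag0 g) out"
      unfolding return_prog_def by (rule exec_while_end) (simp_all add: tops_vst)
    show ?thesis unfolding return_prog_def res
      by (rule exec_while[OF _ body rest[unfolded return_prog_def]]) (simp add: tops_vst, simp)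
  next
    case None
    then have ret: "return K (combine k S) = (c', K')" using Cons.prems by simp
    have 1: "exec (upd 6 (\<lambda>t. Val (combine (the (t 3)) (val_set (the (t 6)))))) ?s out 9 (vst x y z (k # K) rm dn (Val (combine k S)) g) out"
      by (rule exec_upd) (simp_all add: tops_vst vst_nth vst_upd)
    have 2: "exec (Pop 3) (vst x y z (k # K) rm dn (Val (combine k S)) g) out 1 (vst x y z K rm dn (Val (combine k S)) g) out"
      by (rule exec_pop) (simp_all add: vst_nth vst_upd)
    have body: "exec return_body ?s out 12 (vst x y z K rm dn (Val (combine k S)) g) out"
      unfolding return_body_def by (rule exec_Ite_False[OF _ exec_seq[OF 1 2 order_refl]]) (simp_all add: tops_vst None)
    show ?thesis unfolding return_prog_def
      by (rule exec_while[OF _ body Cons.IH[OF ret, unfolded return_prog_def]]) (simp add: tops_vst, simp)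
  qed
qed

lemma length_return: "return K S = (c, K') \<Longrightarrow> length K' \<le> length K"
  by (induction K arbitrary: S) (fastforce split: option.splits)+

definition name_prog :: "vsym cmd" where
  "name_prog = drain 5 4 ;; lookup_prog ;;
     upd 6 (\<lambda>t. Val (signed (the (t 6)) (reg_set (the (t 7))))) ;; upd 7 (\<lambda>_. reg0 {}) ;; return_prog"

text \<open>The control symbol is replaced last because the two tests before it still read the old
  one.\<close>

definition step_body :: "bool \<Rightarrow> vsym cmd" where
  "step_body pm = Ite (\<lambda>t. name_end (the (t 6)) (bit_of (t 0))) name_prog
     (Ite (\<lambda>t. in_letter (the (t 6))) (Push 5 (\<lambda>t. the (t 0))) skip ;;
      Ite (\<lambda>t. pushed_op pm (the (t 6)) (bit_of (t 0)) \<noteq> None)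
        (Push 3 (\<lambda>t. the (pushed_op pm (the (t 6)) (bit_of (t 0))))) skip ;;
      upd 6 (\<lambda>t. ctl_step pm (the (t 6)) (bit_of (t 0))))"

text \<open>The product is the search in the certificate. Reversing the name, clearing it and
  returning through the stack add \<open>5 * m + 4 * m + 30 * m\<close>, and 60 leaves room for the
  constants.\<close>

definition step_cost :: "nat \<Rightarrow> nat" where
  "step_cost m = m * (5 * m + 36) + 40 * m + 60"

lemma exec_name_prog:
  assumes "return K (signed c (lookup y (rev nm))) = (c', K')" "length nm \<le> m" "length K \<le> m" "length y \<le> m"
  shows "exec name_prog (vst x (map Bit y) [] K [] (map Bit nm) c (reg0 {})) out (step_cost m - 10)
     (vst x (map Bit y) [] K' [] [] c' (reg0 {})) out"
proof -
  let ?s = "vst x (map Bit y) [] K [] (map Bit nm) c (reg0 {})"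
  have "exec (drain 5 4) ?s out (5 * length (?s 5) + 1) (?s(5 := [], 4 := rev (?s 5) @ ?s 4)) out"
    by (rule exec_drain) simp
  then have 1: "exec (drain 5 4) ?s out (5 * length nm + 1) (vst x (map Bit y) [] K (map Bit (rev nm)) [] c (reg0 {})) out"
    by (simp add: vst_nth vst_upd rev_map)
  obtain g' where g': "reg_set g' = lookup y (rev nm)"
    and 2: "exec lookup_prog (vst x (map Bit y) [] K (map Bit (rev nm)) [] c (reg0 {})) out
       (length y * (5 * length (rev nm) + 36) + 4 * length (rev nm) + 10) (vst x (map Bit y) [] K [] [] c g') out"
    using exec_lookup_prog by blast
  let ?S = "signed c (lookup y (rev nm))"
  have 3: "exec (upd 6 (\<lambda>t. Val (signed (the (t 6)) (reg_set (the (t 7)))))) (vst x (map Bit y) [] K [] [] c g') out 9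
      (vst x (map Bit y) [] K [] [] (Val ?S) g') out"
    by (rule exec_upd) (simp_all add: tops_vst vst_nth vst_upd g')
  have 4: "exec (upd 7 (\<lambda>_. reg0 {})) (vst x (map Bit y) [] K [] [] (Val ?S) g') out 9
      (vst x (map Bit y) [] K [] [] (Val ?S) (reg0 {})) out"
    by (rule exec_upd) (simp_all add: tops_vst vst_nth vst_upd)
  note 5 = exec_return_prog[OF assms(1), of x "map Bit y" "[]" "[]" "[]" "reg0 {}" out]
  have "length y * (5 * length (rev nm) + 36) \<le> m * (5 * m + 36)"
    using assms(2,4) by (intro mult_le_mono) simp_all
  then show ?thesis unfolding name_prog_def
    by (intro exec_seq[OF 1 exec_seq[OF 2 exec_seq[OF 3 exec_seq[OF 4 5 order_refl] order_refl] order_refl]])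
      (use assms(2,3) in \<open>simp add: step_cost_def\<close>)
qed

lemma exec_step:
  assumes step: "mstep pm y (c, K, nm) s = (c', K', nm')"
    and m: "length nm \<le> m" "length K \<le> m" "length y \<le> m"
  shows "exec (step_body pm ;; Pop 0) (vmain (map Bit (s # x)) y K nm c) out (step_cost m)
     (vmain (map Bit x) y K' nm' c') out"
proof -
  let ?st = "\<lambda>K nm c. vmain (map Bit (s # x)) y K nm c"
  have pop: "exec (Pop 0) (?st K' nm' c') out 1 (vmain (map Bit x) y K' nm' c') out"
    by (rule exec_pop) (simp_all add: vst_nth vst_upd)
  have cost: "60 \<le> step_cost m" by (simp add: step_cost_def)
  have "exec (step_body pm) (?st K nm c) out (step_cost m - 5) (?st K' nm' c') out"
  proof (cases "name_end c s")
    case True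
    then have ret: "return K (signed c (lookup y (rev nm))) = (c', K')" and nm': "nm' = []"
      using step by (auto split: prod.splits)
    have "exec name_prog (?st K nm c) out (step_cost m - 10) (?st K' [] c') out"
      using exec_name_prog[OF ret m, of "map Bit (s # x)" out] by simp
    then show ?thesis unfolding step_body_def nm'
      by (rule exec_Ite_True[rotated]) (use True cost in \<open>simp_all add: tops_vst\<close>)
  next
    case False
    then have c': "c' = ctl_step pm c s" and K': "K' = (case pushed_op pm c s of Some k \<Rightarrow> k # K | None \<Rightarrow> K)"
      and nm': "nm' = (if in_letter c then s # nm else nm)" using step by auto
    have 1: "exec (Ite (\<lambda>t. in_letter (the (t 6))) (Push 5 (\<lambda>t. the (t 0))) skip) (?st K nm c) out 3 (?st K nm' c) out"
    proof (cases "in_letter c")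
      case True
      have "exec (Push 5 (\<lambda>t. the (t 0))) (?st K nm c) out 2 (?st K nm' c) out"
        by (rule exec_push) (simp_all add: nm' True tops_vst vst_nth vst_upd)
      then show ?thesis by (rule exec_Ite_True[rotated]) (simp_all add: True tops_vst)
    next
      case False
      then have "nm' = nm" by (simp add: nm')
      then show ?thesis using exec_skip[of "?st K nm c" out]
        by (simp only:) (rule exec_Ite_False[rotated], assumption, simp_all add: False tops_vst)
    qed
    have 2: "exec (Ite (\<lambda>t. pushed_op pm (the (t 6)) (bit_of (t 0)) \<noteq> None)
        (Push 3 (\<lambda>t. the (pushed_op pm (the (t 6)) (bit_of (t 0))))) skip) (?st K nm' c) out 3 (?st K' nm' c) out"
    proof (cases "pushed_op pm c s")
      case (Some k)
      have "exec (Push 3 (\<lambda>t. the (pushed_op pm (the (t 6)) (bit_of (t 0))))) (?st K nm' c) out 2 (?st K' nm' c) out"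
        by (rule exec_push) (simp_all add: K' Some tops_vst vst_nth vst_upd)
      then show ?thesis by (rule exec_Ite_True[rotated]) (simp_all add: Some tops_vst)
    next
      case None
      then have "K' = K" by (simp add: K')
      then show ?thesis using exec_skip[of "?st K nm' c" out]
        by (simp only:) (rule exec_Ite_False[rotated], assumption, simp_all add: None tops_vst)
    qed
    have 3: "exec (upd 6 (\<lambda>t. ctl_step pm (the (t 6)) (bit_of (t 0)))) (?st K' nm' c) out 9 (?st K' nm' c') out"
      by (rule exec_upd) (simp_all add: c' tops_vst vst_nth vst_upd)
    show ?thesis unfolding step_body_def
      by (rule exec_Ite_False[OF _ exec_seq[OF 1 exec_seq[OF 2 3 order_refl] order_refl]]) (use False cost in \<open>simp_all add: tops_vst\<close>)
  qed
  then show ?thesis by (rule exec_seq[OF _ pop]) (use cost in simp)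
qed

text \<open>Stack and name gain at most one symbol per input bit, so the cost of a round at
  \<open>length x + length y\<close> bounds every round.\<close>

lemma mstep_length:
  assumes "mstep pm y (c, K, nm) s = (c', K', nm')"
  shows "length K' \<le> Suc (length K)" "length nm' \<le> Suc (length nm)"
proof -
  show "length K' \<le> Suc (length K)"
  proof (cases "name_end c s")
    case True
    then have "return K (signed c (lookup y (rev nm))) = (c', K')" using assms by (auto split: prod.splits)
    from length_return[OF this] show ?thesis by simp
  next
    case False
    then show ?thesis using assms by (auto split: option.splits)
  qed
  show "length nm' \<le> Suc (length nm)" using assms by (auto split: if_splits prod.splits)
qed

lemma exec_step_loop:
  assumes "foldl (mstep pm y) (c, K, nm) x = (c', K', nm')"
    and "length nm + length x \<le> m" "length K + length x \<le> m" "length y \<le> m"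
  shows "exec (While (\<lambda>t. t 0 \<noteq> None) (step_body pm ;; Pop 0)) (vmain (map Bit x) y K nm c) out
     (length x * (step_cost m + 1) + 1) (vmain [] y K' nm' c') out"
  using assms
proof (induction x arbitrary: c K nm)
  case Nil
  then show ?case by (auto intro!: exec_while_end simp: tops_vst)
next
  case (Cons s x)
  obtain c1 K1 nm1 where 1: "mstep pm y (c, K, nm) s = (c1, K1, nm1)" by (cases "mstep pm y (c, K, nm) s")
  have body: "exec (step_body pm ;; Pop 0) (vmain (map Bit (s # x)) y K nm c) out (step_cost m)
     (vmain (map Bit x) y K1 nm1 c1) out"
    by (rule exec_step[OF 1]) (use Cons.prems in simp_all)
  have rest: "exec (While (\<lambda>t. t 0 \<noteq> None) (step_body pm ;; Pop 0)) (vmain (map Bit x) y K1 nm1 c1) out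
     (length x * (step_cost m + 1) + 1) (vmain [] y K' nm' c') out"
  proof (rule Cons.IH)
    show "foldl (mstep pm y) (c1, K1, nm1) x = (c', K', nm')" using Cons.prems(1) 1 by (simp del: mstep.simps)
  qed (use Cons.prems mstep_length[OF 1] in simp_all)
  show ?case
    by (rule exec_while[OF _ body rest]) (simp_all add: tops_vst)
qed

section \<open>Running time of the verifier and the result\<close>

definition verifier :: "bool \<Rightarrow> vsym cmd" where
  "verifier pm = Push 6 (\<lambda>_. Tag0) ;; Push 7 (\<lambda>_. reg0 {}) ;; While (\<lambda>t. t 0 \<noteq> None) (step_body pm ;; Pop 0)"

lemma uses_verifier: "uses_tapes 10 False (verifier pm)"
  by (simp add: verifier_def step_body_def name_prog_def lookup_prog_def lookup_step_def return_prog_def return_body_def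
    upd_def mv_def drain_def clear_def)

lemma poly_time_verifies: "poly_time_decidable2 (verifies pm)"
proof -
  define total where "total n = 2 + (2 + (n * (step_cost n + 1) + 1) + 1) + 1" for n
  have "poly_bounded total" unfolding total_def step_cost_def by (intro poly_bounded_intros)
  then obtain T :: "nat poly" where T: "\<And>n. total n \<le> poly T n" unfolding poly_bounded_def by blast
  have "inj Bit" by (rule injI) simp
  then show ?thesis
  proof (rule poly_time_decidable2I[OF _ _ uses_verifier[of pm], where T = T
      and good = "\<lambda>t. \<exists>S. t 6 = Some (Val S) \<and> S \<noteq> {}"])
    fix x y :: "bool list"
    obtain c K nm where f: "foldl (mstep pm y) (Tag0, [], []) x = (c, K, nm)"
      by (cases "foldl (mstep pm y) (Tag0, [], []) x")
    let ?m = "length x + length y"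
    let ?\<sigma> = "(\<lambda>_. [])(0 := map Bit x, 1 := map Bit y) :: vsym store"
    let ?end = "vmain [] y K nm c"
    have 1: "exec (Push 6 (\<lambda>_. Tag0)) ?\<sigma> [] 2 (?\<sigma>(6 := [Tag0])) []" by (rule exec_push) simp_all
    have 2: "exec (Push 7 (\<lambda>_. reg0 {})) (?\<sigma>(6 := [Tag0])) [] 2 (vmain (map Bit x) y [] [] Tag0) []"
      by (rule exec_push) (auto simp: vst_def fun_eq_iff)
    have 3: "exec (While (\<lambda>t. t 0 \<noteq> None) (step_body pm ;; Pop 0)) (vmain (map Bit x) y [] [] Tag0) []
       (length x * (step_cost ?m + 1) + 1) ?end []"
      using exec_step_loop[OF f, of ?m "[]"] by simp
    have "exec (verifier pm) ?\<sigma> [] (2 + (2 + (length x * (step_cost ?m + 1) + 1) + 1) + 1) ?end []"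
      unfolding verifier_def by (rule exec_seq[OF 1 exec_seq[OF 2 3 order_refl] order_refl])
    then have "exec (verifier pm) ?\<sigma> [] (poly T ?m) ?end []"
      by (rule exec_mono) (rule order_trans[OF _ T], simp add: total_def add_mult_distrib)
    moreover have "(\<exists>S. tops ?end 6 = Some (Val S) \<and> S \<noteq> {}) = verifies pm x y"
      by (simp add: tops_vst verifies_def f)
    ultimately show "\<exists>\<sigma>'. exec (verifier pm) ?\<sigma> [] (poly T ?m) \<sigma>' [] \<and>
        (\<exists>S. tops \<sigma>' 6 = Some (Val S) \<and> S \<noteq> {}) = verifies pm x y"
      by (intro exI[of _ ?end] conjI)
  qed simp
qed

theorem theorem2:
  "NP_complete (sat_problem F3) \<and> NP_complete (poor_man_sat_problem F3)"
proof -
  have enc: "encode \<phi> \<in> {encode \<psi> |\<psi>. P \<psi>} \<longleftrightarrow> P \<phi>" for \<phi> P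
    using inj_encode by (auto dest: injD)
  have "sat_problem F3 \<in> NP" "poor_man_sat_problem F3 \<in> NP"
    using in_NP_if_verifies[OF poly_time_verifies, of False] in_NP_if_verifies[OF poly_time_verifies, of True]
    by (simp_all add: sat_problem_def poor_man_sat_problem_def)
  \<comment> \<open>For the second language the extra conjunct \<open>poor_man\<close> is the
    premise under which \<open>NP_hard_if\<close> compares it with satisfiability.\<close>
  moreover have "NP_hard (sat_problem F3)" "NP_hard (poor_man_sat_problem F3)"
    unfolding sat_problem_def poor_man_sat_problem_def by (rule NP_hard_if; simp only: enc simp_thms)+
  ultimately show ?thesis unfolding NP_complete_def by blast
qed

end
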